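(* Let $\mathcal C$ be a monoidal category, $\mathcal A$ an abelian monoidal category, $\Sigma$ a class of weak equivalences in $\mathbf{Mon}(\mathcal C,\mathbf C_*(\mathcal A))$ which contains the homotopy equivalences and is compatible with the Eilenberg–MacLane simple functor $s_{EM}$, and $\mathbf G=(G,\varepsilon,\delta)$ a cotriple in $\mathbf{Mon}(\mathcal C,\mathbf C_*(\mathcal A))$. Let $K_*$ be a $\mathbf G$-presentable object of $\mathbf{Mon}(\mathcal C,\mathbf C_*(\mathcal A))$ and $s:L_*\to M_*$ a $\mathbf G$-weak equivalence. Suppose that $\mathbf G$ is compatible with $\Sigma$, that is, $G(\Sigma)\subseteq\Sigma$. Then, for any morphism $\alpha:K_*\to M_*$ there exists a unique morphism $\widetilde\alpha:K_*\to L_*$ in $\mathbf{Mon}(\mathcal C,\mathbf C_*(\mathcal A))[\Sigma^{-1}]$ such that $\alpha=s\widetilde\alpha$ in this localized category.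
   Context: Monoidal functors are lax monoidal: $(F,\kappa,\eta)$ with natural $\kappa_{X,Y}:FX\otimes FY\to F(X\otimes Y)$ (the Künneth morphism) and $\eta:\mathbf 1\to F\mathbf 1$ compatible with associativity and unit; monoidal natural transformations are those compatible with $\kappa,\eta$. An abelian (additive) monoidal category is an abelian (additive) category with a monoidal structure whose product $\otimes$ is biadditive. $\mathbf C_*(\mathcal A)$ is the monoidal category of uniformly bounded below chain complexes in $\mathcal A$ (there is $n\in\mathbb Z$ with $C_i=0$ for $i<n$; for a functor to $\mathbf C_*(\mathcal A)$, $n$ is independent of the object, so $\mathbf{Fun}(\mathcal C,\mathbf C_*(\mathcal A))=\mathbf C_*(\mathbf{Fun}(\mathcal C,\mathcal A))$), with $(C\otimes D)_n=\bigoplus_{p+q=n}C_p\otimes D_q$ and $d=d_C\otimes\mathrm{id}+(-1)^p\,\mathrm{id}\otimes d_D$. $\mathbf{Mon}(\mathcal C,\mathbf C_*(\mathcal A))$ is the category of monoidal functors $\mathcal C\to\mathbf C_*(\mathcal A)$ and monoidal natural transformations. Acyclic class: a class $\Gamma$ of complexes in $\mathbf C_*(\mathcal B)$ ($\mathcal B$ abelian) such that (AC1) $0\in\Gamma$; (AC2) $C_*\in\Gamma$ iff $C_*[-1]\in\Gamma$, where $C_*[-1]_n=C_{n-1}$ with differential $-d$; (AC3) if $C_*,D_*$ are chain homotopy equivalent then $C_*\in\Gamma$ iff $D_*\in\Gamma$; (AC4) every complex in $\Gamma$ is acyclic; (AC5) if all rows of a bounded below double complex are in $\Gamma$, so is its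 total complex. The weak equivalences associated with $\Gamma$ are the morphisms whose mapping cone is in $\Gamma$. Here $\Gamma$ is an acyclic class in $\mathbf C_*(\mathbf{Fun}(\mathcal C,\mathcal A))=\mathbf{Fun}(\mathcal C,\mathbf C_*(\mathcal A))$, and $\Sigma$ is the class of morphisms of $\mathbf{Mon}(\mathcal C,\mathbf C_*(\mathcal A))$ that are weak equivalences when regarded in $\mathbf{Fun}(\mathcal C,\mathbf C_*(\mathcal A))$. $\mathbf{Mon}(\mathcal C,\mathbf C_*(\mathcal A))[\Sigma^{-1}]$ is the localization at $\Sigma$. Eilenberg–MacLane simple functor $s_{EM}:\Delta^o\mathbf{Mon}(\mathcal C,\mathbf C_*(\mathcal A))\to\mathbf{Mon}(\mathcal C,\mathbf C_*(\mathcal A))$: it sends a simplicial object $K_\bullet$ to the functor taking $X$ to the total complex of the double complex $K_p(X)_q$ with simplicial differential $\sum_i(-1)^i\partial_i$ and internal differential (total differential $d'+(-1)^pd''$), with Künneth morphism obtained by composing (with usual Koszul signs) the shuffle map $sh_{pq}=\sum_{(\mu,\nu)}\varepsilon(\mu,\nu)(s_{\nu_q}\cdots s_{\nu_1})\otimes(s_{\mu_p}\cdots s_{\mu_1})$ (sum over $(p,q)$-shuffles, $\varepsilon$ the signature) with the Künneth morphisms of the $K_n$. Compatibility of $\Sigma$ with $s_{EM}$: if $f_\bullet$ is a morphism of simplicial objects with every $f_n\in\Sigma$, then $s_{EM}(f_\bullet)\in\Sigma$. A cotriple is a comonad $\mathbf G=(G,\varepsilon:G\Rightarrow\mathrm{id},\delta:G\Rightarrow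 G^2)$. Its standard construction is the augmented simplicial object $B_n(K)=G^{n+1}(K)$, $\partial_i=G^i\varepsilon G^{n-i}$, $s_i=G^i\delta G^{n-i}$, with augmentation $\varepsilon:B_0(K)=G(K)\to K$. Put $B_*=s_{EM}B_\bullet$, with induced $\varepsilon:B_*\Rightarrow\mathrm{id}$. $K_*$ is $\mathbf G$-presentable if $\varepsilon:B_*(K_* )\to K_*$ is in $\Sigma$. A morphism $f$ is a $\mathbf G$-weak equivalence if $G(f)\in\Sigma$.
   Formalization: For each object K the complexes G^{n+1}(K)(X) are assumed to have one lower bound independent of n and X (and simplicial objects fed to s_EM are likewise uniformly bounded), since otherwise B_*(K)=s_EM B_•(K) need not be a bounded below complex. *)

theory Defs
  imports "HOL-Algebra.FiniteProduct" "HOL-Library.FuncSet"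
begin

section \<open>Categories\<close>

text \<open>Functors and transformations are total functions in HOL, so where they form the objects
  or arrows of a category they are required to be extensional, i.e. to take the value
  \<^term>\<open>undefined\<close> outside the domain category. This makes equality of arrows the
  mathematical one.\<close>

record ('o, 'm) cat =
  Ob :: "'o set"
  Ar :: "'m set"
  Dom :: "'m \<Rightarrow> 'o"
  Cod :: "'m \<Rightarrow> 'o"
  Idt :: "'o \<Rightarrow> 'm"
  Cmp :: "'m \<Rightarrow> 'm \<Rightarrow> 'm"  (infixr "\<cdot>\<index>" 70)

definition Hom :: "('o, 'm, 'x) cat_scheme \<Rightarrow> 'o \<Rightarrow> 'o \<Rightarrow> 'm set" where
  "Hom C X Y = {f \<in> Ar C. Dom C f = X \<and> Cod C f = Y}"

locale category =
  fixes C :: "('o, 'm, 'x) cat_scheme" (structure)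
  assumes dom_ob: "f \<in> Ar C \<Longrightarrow> Dom C f \<in> Ob C"
    and cod_ob: "f \<in> Ar C \<Longrightarrow> Cod C f \<in> Ob C"
    and idt_hom: "X \<in> Ob C \<Longrightarrow> Idt C X \<in> Hom C X X"
    and cmp_hom: "\<lbrakk>f \<in> Hom C X Y; g \<in> Hom C Y Z\<rbrakk> \<Longrightarrow> g \<cdot> f \<in> Hom C X Z"
    and cmp_idt_right: "f \<in> Hom C X Y \<Longrightarrow> f \<cdot> Idt C X = f"
    and cmp_idt_left: "f \<in> Hom C X Y \<Longrightarrow> Idt C Y \<cdot> f = f"
    and cmp_assoc: "\<lbrakk>f \<in> Hom C W X; g \<in> Hom C X Y; h \<in> Hom C Y Z\<rbrakk>
      \<Longrightarrow> (h \<cdot> g) \<cdot> f = h \<cdot> (g \<cdot> f)"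

definition iso_arr :: "('o, 'm, 'x) cat_scheme \<Rightarrow> 'm \<Rightarrow> bool" where
  "iso_arr C f \<longleftrightarrow> f \<in> Ar C \<and> (\<exists>g \<in> Hom C (Cod C f) (Dom C f).
     g \<cdot>\<^bsub>C\<^esub> f = Idt C (Dom C f) \<and> f \<cdot>\<^bsub>C\<^esub> g = Idt C (Cod C f))"

definition mono_arr :: "('o, 'm, 'x) cat_scheme \<Rightarrow> 'm \<Rightarrow> bool" where
  "mono_arr C m \<longleftrightarrow> m \<in> Ar C \<and> (\<forall>W. \<forall>f \<in> Hom C W (Dom C m). \<forall>g \<in> Hom C W (Dom C m).
     m \<cdot>\<^bsub>C\<^esub> f = m \<cdot>\<^bsub>C\<^esub> g \<longrightarrow> f = g)"

definition epi_arr :: "('o, 'm, 'x) cat_scheme \<Rightarrow> 'm \<Rightarrow> bool" where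
  "epi_arr C e \<longleftrightarrow> e \<in> Ar C \<and> (\<forall>Z. \<forall>f \<in> Hom C (Cod C e) Z. \<forall>g \<in> Hom C (Cod C e) Z.
     f \<cdot>\<^bsub>C\<^esub> e = g \<cdot>\<^bsub>C\<^esub> e \<longrightarrow> f = g)"

definition zero_object :: "('o, 'm, 'x) cat_scheme \<Rightarrow> 'o \<Rightarrow> bool" where
  "zero_object C Z \<longleftrightarrow> Z \<in> Ob C \<and>
     (\<forall>X \<in> Ob C. (\<exists>!f. f \<in> Hom C X Z) \<and> (\<exists>!f. f \<in> Hom C Z X))"

definition zob :: "('o, 'm, 'x) cat_scheme \<Rightarrow> 'o" where
  "zob C = (SOME Z. zero_object C Z)"

definition is_coproduct ::
    "('o, 'm, 'x) cat_scheme \<Rightarrow> ('i \<Rightarrow> 'o) \<Rightarrow> 'o \<times> ('i \<Rightarrow> 'm) \<Rightarrow> bool" where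
  "is_coproduct C F S \<longleftrightarrow> fst S \<in> Ob C \<and> (\<forall>i. snd S i \<in> Hom C (F i) (fst S)) \<and>
     (\<forall>T \<in> Ob C. \<forall>g. (\<forall>i. g i \<in> Hom C (F i) T) \<longrightarrow>
        (\<exists>!h. h \<in> Hom C (fst S) T \<and> (\<forall>i. h \<cdot>\<^bsub>C\<^esub> snd S i = g i)))"

text \<open>Direct sums are chosen once and for all. In an additive category a family with only
  finitely many nonzero members always has one, even if the index type is infinite.\<close>

definition coprod :: "('o, 'm, 'x) cat_scheme \<Rightarrow> ('i \<Rightarrow> 'o) \<Rightarrow> 'o \<times> ('i \<Rightarrow> 'm)" where
  "coprod C F = (SOME S. is_coproduct C F S)"

definition dsum :: "('o, 'm, 'x) cat_scheme \<Rightarrow> ('i \<Rightarrow> 'o) \<Rightarrow> 'o" where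
  "dsum C F = fst (coprod C F)"

definition incl :: "('o, 'm, 'x) cat_scheme \<Rightarrow> ('i \<Rightarrow> 'o) \<Rightarrow> 'i \<Rightarrow> 'm" where
  "incl C F i = snd (coprod C F) i"

definition copair ::
    "('o, 'm, 'x) cat_scheme \<Rightarrow> ('i \<Rightarrow> 'o) \<Rightarrow> 'o \<Rightarrow> ('i \<Rightarrow> 'm) \<Rightarrow> 'm" where
  "copair C F T g = (THE h. h \<in> Hom C (dsum C F) T \<and> (\<forall>i. h \<cdot>\<^bsub>C\<^esub> incl C F i = g i))"


section \<open>Abelian categories\<close>

record ('o, 'm) addcat = "('o, 'm) cat" +
  Plus :: "'m \<Rightarrow> 'm \<Rightarrow> 'm"
  Zer :: "'o \<Rightarrow> 'o \<Rightarrow> 'm"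

definition hgrp :: "('o, 'm) addcat \<Rightarrow> 'o \<Rightarrow> 'o \<Rightarrow> 'm monoid" where
  "hgrp A X Y = \<lparr>carrier = Hom A X Y, mult = Plus A, one = Zer A X Y\<rparr>"

definition neg :: "('o, 'm) addcat \<Rightarrow> 'm \<Rightarrow> 'm" where
  "neg A f = inv\<^bsub>hgrp A (Dom A f) (Cod A f)\<^esub> f"

text \<open>The arrow \<open>(-1)\<^sup>k f\<close>.\<close>

definition signed :: "('o, 'm) addcat \<Rightarrow> int \<Rightarrow> 'm \<Rightarrow> 'm" where
  "signed A k f = (if even k then f else neg A f)"

locale additive_category = category A for A :: "('o, 'm) addcat" +
  assumes hom_comm_group: "\<lbrakk>X \<in> Ob A; Y \<in> Ob A\<rbrakk> \<Longrightarrow> comm_group (hgrp A X Y)"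
    and cmp_plus_right: "\<lbrakk>f \<in> Hom A X Y; f' \<in> Hom A X Y; g \<in> Hom A Y Z\<rbrakk>
      \<Longrightarrow> g \<cdot>\<^bsub>A\<^esub> Plus A f f' = Plus A (g \<cdot>\<^bsub>A\<^esub> f) (g \<cdot>\<^bsub>A\<^esub> f')"
    and cmp_plus_left: "\<lbrakk>f \<in> Hom A X Y; g \<in> Hom A Y Z; g' \<in> Hom A Y Z\<rbrakk>
      \<Longrightarrow> Plus A g g' \<cdot>\<^bsub>A\<^esub> f = Plus A (g \<cdot>\<^bsub>A\<^esub> f) (g' \<cdot>\<^bsub>A\<^esub> f)"
    and ex_zero_object: "\<exists>Z. zero_object A Z"
    and ex_dsum: "\<lbrakk>X \<in> Ob A; Y \<in> Ob A\<rbrakk>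
      \<Longrightarrow> \<exists>S. is_coproduct A (\<lambda>b. if b then Y else X) S"

definition is_kernel :: "('o, 'm) addcat \<Rightarrow> 'm \<Rightarrow> 'm \<Rightarrow> bool" where
  "is_kernel A f k \<longleftrightarrow> f \<in> Ar A \<and> k \<in> Ar A \<and> Cod A k = Dom A f \<and>
     f \<cdot>\<^bsub>A\<^esub> k = Zer A (Dom A k) (Cod A f) \<and>
     (\<forall>W. \<forall>t \<in> Hom A W (Dom A f). f \<cdot>\<^bsub>A\<^esub> t = Zer A W (Cod A f) \<longrightarrow>
        (\<exists>!u. u \<in> Hom A W (Dom A k) \<and> k \<cdot>\<^bsub>A\<^esub> u = t))"

definition is_cokernel :: "('o, 'm) addcat \<Rightarrow> 'm \<Rightarrow> 'm \<Rightarrow> bool" where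
  "is_cokernel A f c \<longleftrightarrow> f \<in> Ar A \<and> c \<in> Ar A \<and> Dom A c = Cod A f \<and>
     c \<cdot>\<^bsub>A\<^esub> f = Zer A (Dom A f) (Cod A c) \<and>
     (\<forall>Z. \<forall>t \<in> Hom A (Cod A f) Z. t \<cdot>\<^bsub>A\<^esub> f = Zer A (Dom A f) Z \<longrightarrow>
        (\<exists>!u. u \<in> Hom A (Cod A c) Z \<and> u \<cdot>\<^bsub>A\<^esub> c = t))"

locale abelian_category = additive_category +
  assumes ex_kernel: "f \<in> Ar A \<Longrightarrow> \<exists>k. is_kernel A f k"
    and ex_cokernel: "f \<in> Ar A \<Longrightarrow> \<exists>c. is_cokernel A f c"
    and mono_is_kernel: "mono_arr A m \<Longrightarrow> \<exists>f. is_kernel A f m"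
    and epi_is_cokernel: "epi_arr A e \<Longrightarrow> \<exists>f. is_cokernel A f e"

text \<open>Exactness of \<open>X \<rightarrow> Y \<rightarrow> Z\<close> at \<open>Y\<close>: the comparison arrow from \<open>X\<close> to the kernel of
  \<open>g\<close> is an epimorphism.\<close>

definition exact :: "('o, 'm) addcat \<Rightarrow> 'm \<Rightarrow> 'm \<Rightarrow> bool" where
  "exact A f g \<longleftrightarrow> (\<exists>k e. is_kernel A g k \<and> epi_arr A e \<and>
     e \<in> Hom A (Dom A f) (Dom A k) \<and> k \<cdot>\<^bsub>A\<^esub> e = f)"


section \<open>Functors and natural transformations\<close>

record ('c, 'd, 'e, 'f) fct =
  FO :: "'c \<Rightarrow> 'e"
  FA :: "'d \<Rightarrow> 'f"

text \<open>A family of arrows together with its source and target; used both for natural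
  transformations (indexed by objects) and for chain maps (indexed by degrees).\<close>

record ('F, 'i, 'f) trf =
  Src :: 'F
  Tgt :: 'F
  At :: "'i \<Rightarrow> 'f"

definition is_functor ::
    "('c, 'd, 'x) cat_scheme \<Rightarrow> ('e, 'f, 'y) cat_scheme \<Rightarrow> ('c, 'd, 'e, 'f, 'z) fct_scheme \<Rightarrow> bool"
  where
  "is_functor C D F \<longleftrightarrow>
     (\<forall>X \<in> Ob C. FO F X \<in> Ob D \<and> FA F (Idt C X) = Idt D (FO F X)) \<and>
     (\<forall>X Y. \<forall>f \<in> Hom C X Y. FA F f \<in> Hom D (FO F X) (FO F Y)) \<and>
     (\<forall>X Y Z. \<forall>f \<in> Hom C X Y. \<forall>g \<in> Hom C Y Z. FA F (g \<cdot>\<^bsub>C\<^esub> f) = FA F g \<cdot>\<^bsub>D\<^esub> FA F f)"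

definition ext_functor ::
    "('c, 'd, 'x) cat_scheme \<Rightarrow> ('e, 'f, 'y) cat_scheme \<Rightarrow> ('c, 'd, 'e, 'f, 'z) fct_scheme \<Rightarrow> bool"
  where
  "ext_functor C D F \<longleftrightarrow> is_functor C D F \<and>
     FO F \<in> extensional (Ob C) \<and> FA F \<in> extensional (Ar C)"

definition nat_trans :: "('c, 'd, 'x) cat_scheme \<Rightarrow> ('e, 'f, 'y) cat_scheme
    \<Rightarrow> (('c, 'd, 'e, 'f, 'z) fct_scheme, 'c, 'f) trf \<Rightarrow> bool" where
  "nat_trans C D t \<longleftrightarrow> At t \<in> extensional (Ob C) \<and>
     (\<forall>X \<in> Ob C. At t X \<in> Hom D (FO (Src t) X) (FO (Tgt t) X)) \<and>
     (\<forall>X Y. \<forall>f \<in> Hom C X Y.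
        At t Y \<cdot>\<^bsub>D\<^esub> FA (Src t) f = FA (Tgt t) f \<cdot>\<^bsub>D\<^esub> At t X)"

definition trf_idt :: "('c, 'd, 'x) cat_scheme \<Rightarrow> ('e, 'f, 'y) cat_scheme
    \<Rightarrow> ('c, 'd, 'e, 'f, 'z) fct_scheme \<Rightarrow> (('c, 'd, 'e, 'f, 'z) fct_scheme, 'c, 'f) trf" where
  "trf_idt C D F = \<lparr>Src = F, Tgt = F, At = (\<lambda>X \<in> Ob C. Idt D (FO F X))\<rparr>"

definition trf_cmp :: "('c, 'd, 'x) cat_scheme \<Rightarrow> ('e, 'f, 'y) cat_scheme
    \<Rightarrow> ('F, 'c, 'f) trf \<Rightarrow> ('F, 'c, 'f) trf \<Rightarrow> ('F, 'c, 'f) trf" where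
  "trf_cmp C D t u = \<lparr>Src = Src u, Tgt = Tgt t, At = (\<lambda>X \<in> Ob C. At t X \<cdot>\<^bsub>D\<^esub> At u X)\<rparr>"

definition fun_cat :: "('c, 'd) cat \<Rightarrow> ('a, 'b) addcat
    \<Rightarrow> (('c, 'd, 'a, 'b) fct, (('c, 'd, 'a, 'b) fct, 'c, 'b) trf) addcat" where
  "fun_cat C A = \<lparr>
     Ob = {F. ext_functor C A F},
     Ar = {t. ext_functor C A (Src t) \<and> ext_functor C A (Tgt t) \<and> nat_trans C A t},
     Dom = Src, Cod = Tgt,
     Idt = trf_idt C A,
     Cmp = trf_cmp C A,
     Plus = (\<lambda>t u. \<lparr>Src = Src t, Tgt = Tgt t, At = (\<lambda>X \<in> Ob C. Plus A (At t X) (At u X))\<rparr>),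
     Zer = (\<lambda>F G. \<lparr>Src = F, Tgt = G, At = (\<lambda>X \<in> Ob C. Zer A (FO F X) (FO G X))\<rparr>)\<rparr>"


section \<open>Monoidal categories and lax monoidal functors\<close>

record ('o, 'm) monstr =
  TO :: "'o \<Rightarrow> 'o \<Rightarrow> 'o"
  TA :: "'m \<Rightarrow> 'm \<Rightarrow> 'm"
  Unt :: 'o
  Asc :: "'o \<Rightarrow> 'o \<Rightarrow> 'o \<Rightarrow> 'm"
  Lun :: "'o \<Rightarrow> 'm"
  Run :: "'o \<Rightarrow> 'm"

locale monoidal_category = category C for C :: "('o, 'm, 'x) cat_scheme" (structure) +
  fixes T :: "('o, 'm) monstr"
  assumes tensor_ob: "\<lbrakk>X \<in> Ob C; Y \<in> Ob C\<rbrakk> \<Longrightarrow> TO T X Y \<in> Ob C"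
    and tensor_hom: "\<lbrakk>f \<in> Hom C X X'; g \<in> Hom C Y Y'\<rbrakk>
      \<Longrightarrow> TA T f g \<in> Hom C (TO T X Y) (TO T X' Y')"
    and tensor_idt: "\<lbrakk>X \<in> Ob C; Y \<in> Ob C\<rbrakk> \<Longrightarrow> TA T (Idt C X) (Idt C Y) = Idt C (TO T X Y)"
    and tensor_cmp: "\<lbrakk>f \<in> Hom C X X'; f' \<in> Hom C X' X''; g \<in> Hom C Y Y'; g' \<in> Hom C Y' Y''\<rbrakk>
      \<Longrightarrow> TA T (f' \<cdot> f) (g' \<cdot> g) = TA T f' g' \<cdot> TA T f g"
    and unit_ob: "Unt T \<in> Ob C"
    and asc_hom: "\<lbrakk>X \<in> Ob C; Y \<in> Ob C; Z \<in> Ob C\<rbrakk>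
      \<Longrightarrow> Asc T X Y Z \<in> Hom C (TO T (TO T X Y) Z) (TO T X (TO T Y Z))"
    and asc_iso: "\<lbrakk>X \<in> Ob C; Y \<in> Ob C; Z \<in> Ob C\<rbrakk> \<Longrightarrow> iso_arr C (Asc T X Y Z)"
    and asc_nat: "\<lbrakk>f \<in> Hom C X X'; g \<in> Hom C Y Y'; h \<in> Hom C Z Z'\<rbrakk>
      \<Longrightarrow> Asc T X' Y' Z' \<cdot> TA T (TA T f g) h = TA T f (TA T g h) \<cdot> Asc T X Y Z"
    and lun_hom: "X \<in> Ob C \<Longrightarrow> Lun T X \<in> Hom C (TO T (Unt T) X) X"
    and lun_iso: "X \<in> Ob C \<Longrightarrow> iso_arr C (Lun T X)"
    and lun_nat: "f \<in> Hom C X X' \<Longrightarrow> Lun T X' \<cdot> TA T (Idt C (Unt T)) f = f \<cdot> Lun T X"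
    and run_hom: "X \<in> Ob C \<Longrightarrow> Run T X \<in> Hom C (TO T X (Unt T)) X"
    and run_iso: "X \<in> Ob C \<Longrightarrow> iso_arr C (Run T X)"
    and run_nat: "f \<in> Hom C X X' \<Longrightarrow> Run T X' \<cdot> TA T f (Idt C (Unt T)) = f \<cdot> Run T X"
    and pentagon: "\<lbrakk>W \<in> Ob C; X \<in> Ob C; Y \<in> Ob C; Z \<in> Ob C\<rbrakk>
      \<Longrightarrow> Asc T W X (TO T Y Z) \<cdot> Asc T (TO T W X) Y Z =
          TA T (Idt C W) (Asc T X Y Z) \<cdot> Asc T W (TO T X Y) Z \<cdot> TA T (Asc T W X Y) (Idt C Z)"
    and triangle: "\<lbrakk>X \<in> Ob C; Y \<in> Ob C\<rbrakk>
      \<Longrightarrow> TA T (Idt C X) (Lun T Y) \<cdot> Asc T X (Unt T) Y = TA T (Run T X) (Idt C Y)"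

locale abelian_monoidal_category = abelian_category A + monoidal_category A U
  for A :: "('a, 'b) addcat" and U :: "('a, 'b) monstr" +
  assumes tensor_plus_left: "\<lbrakk>f \<in> Hom A X X'; f' \<in> Hom A X X'; g \<in> Hom A Y Y'\<rbrakk>
      \<Longrightarrow> TA U (Plus A f f') g = Plus A (TA U f g) (TA U f' g)"
    and tensor_plus_right: "\<lbrakk>f \<in> Hom A X X'; g \<in> Hom A Y Y'; g' \<in> Hom A Y Y'\<rbrakk>
      \<Longrightarrow> TA U f (Plus A g g') = Plus A (TA U f g) (TA U f g')"

record ('c, 'd, 'e, 'f) mfct = "('c, 'd, 'e, 'f) fct" +
  Kap :: "'c \<Rightarrow> 'c \<Rightarrow> 'f"
  Eta :: 'f

definition monoidal_functor :: "('c, 'd) cat \<Rightarrow> ('c, 'd) monstr \<Rightarrow> ('e, 'f) cat \<Rightarrow> ('e, 'f) monstr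
    \<Rightarrow> ('c, 'd, 'e, 'f) mfct \<Rightarrow> bool" where
  "monoidal_functor C T D V F \<longleftrightarrow> ext_functor C D F \<and>
     (\<forall>X Y. X \<notin> Ob C \<or> Y \<notin> Ob C \<longrightarrow> Kap F X Y = undefined) \<and>
     (\<forall>X \<in> Ob C. \<forall>Y \<in> Ob C.
        Kap F X Y \<in> Hom D (TO V (FO F X) (FO F Y)) (FO F (TO T X Y))) \<and>
     Eta F \<in> Hom D (Unt V) (FO F (Unt T)) \<and>
     (\<forall>X X' Y Y'. \<forall>f \<in> Hom C X X'. \<forall>g \<in> Hom C Y Y'.
        Kap F X' Y' \<cdot>\<^bsub>D\<^esub> TA V (FA F f) (FA F g) = FA F (TA T f g) \<cdot>\<^bsub>D\<^esub> Kap F X Y) \<and>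
     (\<forall>X \<in> Ob C. \<forall>Y \<in> Ob C. \<forall>Z \<in> Ob C.
        FA F (Asc T X Y Z) \<cdot>\<^bsub>D\<^esub> Kap F (TO T X Y) Z \<cdot>\<^bsub>D\<^esub> TA V (Kap F X Y) (Idt D (FO F Z)) =
        Kap F X (TO T Y Z) \<cdot>\<^bsub>D\<^esub> TA V (Idt D (FO F X)) (Kap F Y Z)
          \<cdot>\<^bsub>D\<^esub> Asc V (FO F X) (FO F Y) (FO F Z)) \<and>
     (\<forall>X \<in> Ob C.
        FA F (Lun T X) \<cdot>\<^bsub>D\<^esub> Kap F (Unt T) X \<cdot>\<^bsub>D\<^esub> TA V (Eta F) (Idt D (FO F X)) = Lun V (FO F X) \<and>
        FA F (Run T X) \<cdot>\<^bsub>D\<^esub> Kap F X (Unt T) \<cdot>\<^bsub>D\<^esub> TA V (Idt D (FO F X)) (Eta F) = Run V (FO F X))"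

definition monoidal_trans :: "('c, 'd) cat \<Rightarrow> ('c, 'd) monstr \<Rightarrow> ('e, 'f) cat \<Rightarrow> ('e, 'f) monstr
    \<Rightarrow> (('c, 'd, 'e, 'f) mfct, 'c, 'f) trf \<Rightarrow> bool" where
  "monoidal_trans C T D V t \<longleftrightarrow> nat_trans C D t \<and>
     (\<forall>X \<in> Ob C. \<forall>Y \<in> Ob C.
        At t (TO T X Y) \<cdot>\<^bsub>D\<^esub> Kap (Src t) X Y = Kap (Tgt t) X Y \<cdot>\<^bsub>D\<^esub> TA V (At t X) (At t Y)) \<and>
     At t (Unt T) \<cdot>\<^bsub>D\<^esub> Eta (Src t) = Eta (Tgt t)"


section \<open>Chain complexes\<close>

record ('o, 'm) cpx =
  Cob :: "int \<Rightarrow> 'o"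
  Cdf :: "int \<Rightarrow> 'm"

type_synonym ('o, 'm) cmap = "(('o, 'm) cpx, int, 'm) trf"

definition is_cpx :: "('o, 'm) addcat \<Rightarrow> ('o, 'm) cpx \<Rightarrow> bool" where
  "is_cpx A K \<longleftrightarrow> (\<forall>n. Cob K n \<in> Ob A \<and> Cdf K n \<in> Hom A (Cob K n) (Cob K (n - 1)) \<and>
     Cdf K (n - 1) \<cdot>\<^bsub>A\<^esub> Cdf K n = Zer A (Cob K n) (Cob K (n - 2)))"

definition bounded_below :: "('o, 'm) addcat \<Rightarrow> ('o, 'm) cpx \<Rightarrow> bool" where
  "bounded_below A K \<longleftrightarrow> (\<exists>m. \<forall>n < m. zero_object A (Cob K n))"

definition is_cmap :: "('o, 'm) addcat \<Rightarrow> ('o, 'm) cmap \<Rightarrow> bool" where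
  "is_cmap A f \<longleftrightarrow> (\<forall>n. At f n \<in> Hom A (Cob (Src f) n) (Cob (Tgt f) n) \<and>
     At f (n - 1) \<cdot>\<^bsub>A\<^esub> Cdf (Src f) n = Cdf (Tgt f) n \<cdot>\<^bsub>A\<^esub> At f n)"

definition chain_cat :: "('o, 'm) addcat \<Rightarrow> (('o, 'm) cpx, ('o, 'm) cmap) cat" where
  "chain_cat A = \<lparr>
     Ob = {K. is_cpx A K \<and> bounded_below A K},
     Ar = {f. is_cpx A (Src f) \<and> bounded_below A (Src f) \<and>
              is_cpx A (Tgt f) \<and> bounded_below A (Tgt f) \<and> is_cmap A f},
     Dom = Src, Cod = Tgt,
     Idt = (\<lambda>K. \<lparr>Src = K, Tgt = K, At = (\<lambda>n. Idt A (Cob K n))\<rparr>),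
     Cmp = (\<lambda>g f. \<lparr>Src = Src f, Tgt = Tgt g, At = (\<lambda>n. At g n \<cdot>\<^bsub>A\<^esub> At f n)\<rparr>)\<rparr>"

definition zero_cpx :: "('o, 'm) addcat \<Rightarrow> ('o, 'm) cpx" where
  "zero_cpx A = \<lparr>Cob = (\<lambda>n. zob A), Cdf = (\<lambda>n. Zer A (zob A) (zob A))\<rparr>"

definition shift :: "('o, 'm) addcat \<Rightarrow> ('o, 'm) cpx \<Rightarrow> ('o, 'm) cpx" where
  "shift A K = \<lparr>Cob = (\<lambda>n. Cob K (n - 1)), Cdf = (\<lambda>n. neg A (Cdf K (n - 1)))\<rparr>"

definition acyclic_cpx :: "('o, 'm) addcat \<Rightarrow> ('o, 'm) cpx \<Rightarrow> bool" where
  "acyclic_cpx A K \<longleftrightarrow> (\<forall>n. exact A (Cdf K (n + 1)) (Cdf K n))"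

definition homotopic :: "('o, 'm) addcat \<Rightarrow> ('o, 'm) cmap \<Rightarrow> ('o, 'm) cmap \<Rightarrow> bool" where
  "homotopic A f g \<longleftrightarrow> Src f = Src g \<and> Tgt f = Tgt g \<and>
     (\<exists>h. \<forall>n. h n \<in> Hom A (Cob (Src f) n) (Cob (Tgt f) (n + 1)) \<and>
        At f n = Plus A (At g n)
          (Plus A (Cdf (Tgt f) (n + 1) \<cdot>\<^bsub>A\<^esub> h n) (h (n - 1) \<cdot>\<^bsub>A\<^esub> Cdf (Src f) n)))"

definition homotopy_equivalence :: "('o, 'm) addcat \<Rightarrow> ('o, 'm) cmap \<Rightarrow> bool" where
  "homotopy_equivalence A f \<longleftrightarrow> f \<in> Ar (chain_cat A) \<and>
     (\<exists>g \<in> Hom (chain_cat A) (Tgt f) (Src f).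
        homotopic A (g \<cdot>\<^bsub>chain_cat A\<^esub> f) (Idt (chain_cat A) (Src f)) \<and>
        homotopic A (f \<cdot>\<^bsub>chain_cat A\<^esub> g) (Idt (chain_cat A) (Tgt f)))"

definition cone :: "('o, 'm) addcat \<Rightarrow> ('o, 'm) cmap \<Rightarrow> ('o, 'm) cpx" where
  "cone A f = (let F = (\<lambda>n b. if b then Cob (Tgt f) n else Cob (Src f) (n - 1)) in
     \<lparr>Cob = (\<lambda>n. dsum A (F n)),
      Cdf = (\<lambda>n. copair A (F n) (dsum A (F (n - 1)))
        (\<lambda>b. if b then incl A (F (n - 1)) True \<cdot>\<^bsub>A\<^esub> Cdf (Tgt f) n
             else Plus A (incl A (F (n - 1)) False \<cdot>\<^bsub>A\<^esub> neg A (Cdf (Src f) (n - 1)))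
                         (incl A (F (n - 1)) True \<cdot>\<^bsub>A\<^esub> At f (n - 1))))\<rparr>)"


subsection \<open>Double complexes\<close>

text \<open>The differentials commute; the sign enters in the total differential \<open>d' + (-1)\<^sup>p d''\<close>.\<close>

record ('o, 'm) dcpx =
  Dob :: "int \<Rightarrow> int \<Rightarrow> 'o"
  Dh :: "int \<Rightarrow> int \<Rightarrow> 'm"
  Dv :: "int \<Rightarrow> int \<Rightarrow> 'm"

definition is_dcpx :: "('o, 'm) addcat \<Rightarrow> ('o, 'm) dcpx \<Rightarrow> bool" where
  "is_dcpx A D \<longleftrightarrow> (\<forall>p q. Dob D p q \<in> Ob A \<and>
     Dh D p q \<in> Hom A (Dob D p q) (Dob D (p - 1) q) \<and>
     Dv D p q \<in> Hom A (Dob D p q) (Dob D p (q - 1)) \<and>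
     Dh D (p - 1) q \<cdot>\<^bsub>A\<^esub> Dh D p q = Zer A (Dob D p q) (Dob D (p - 2) q) \<and>
     Dv D p (q - 1) \<cdot>\<^bsub>A\<^esub> Dv D p q = Zer A (Dob D p q) (Dob D p (q - 2)) \<and>
     Dh D p (q - 1) \<cdot>\<^bsub>A\<^esub> Dv D p q = Dv D (p - 1) q \<cdot>\<^bsub>A\<^esub> Dh D p q)"

definition dcpx_bounded_below :: "('o, 'm) addcat \<Rightarrow> ('o, 'm) dcpx \<Rightarrow> bool" where
  "dcpx_bounded_below A D \<longleftrightarrow> (\<exists>m. \<forall>p q. p < m \<or> q < m \<longrightarrow> zero_object A (Dob D p q))"

definition row :: "('o, 'm) dcpx \<Rightarrow> int \<Rightarrow> ('o, 'm) cpx" where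
  "row D q = \<lparr>Cob = (\<lambda>p. Dob D p q), Cdf = (\<lambda>p. Dh D p q)\<rparr>"

text \<open>Degree \<open>n\<close> of the total complex is the direct sum of all \<open>D p (n - p)\<close>;
  \<open>tinj A D n p\<close> is the inclusion of the \<open>p\<close>-th summand.\<close>

definition diag :: "('o, 'm) dcpx \<Rightarrow> int \<Rightarrow> int \<Rightarrow> 'o" where
  "diag D n p = Dob D p (n - p)"

definition tinj :: "('o, 'm) addcat \<Rightarrow> ('o, 'm) dcpx \<Rightarrow> int \<Rightarrow> int \<Rightarrow> 'm" where
  "tinj A D n p = incl A (diag D n) p"

definition Tot :: "('o, 'm) addcat \<Rightarrow> ('o, 'm) dcpx \<Rightarrow> ('o, 'm) cpx" where
  "Tot A D = \<lparr>Cob = (\<lambda>n. dsum A (diag D n)),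
     Cdf = (\<lambda>n. copair A (diag D n) (dsum A (diag D (n - 1)))
       (\<lambda>p. Plus A (tinj A D (n - 1) (p - 1) \<cdot>\<^bsub>A\<^esub> Dh D p (n - p))
                   (signed A p (tinj A D (n - 1) p \<cdot>\<^bsub>A\<^esub> Dv D p (n - p)))))\<rparr>"

definition tot_map :: "('o, 'm) addcat \<Rightarrow> ('o, 'm) dcpx \<Rightarrow> ('o, 'm) dcpx \<Rightarrow> (int \<Rightarrow> int \<Rightarrow> 'm)
    \<Rightarrow> ('o, 'm) cmap" where
  "tot_map A D E g = \<lparr>Src = Tot A D, Tgt = Tot A E,
     At = (\<lambda>n. copair A (diag D n) (dsum A (diag E n))
                 (\<lambda>p. tinj A E n p \<cdot>\<^bsub>A\<^esub> g p (n - p)))\<rparr>"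


subsection \<open>The monoidal structure on chain complexes\<close>

definition tensor_dcpx :: "('a, 'b) addcat \<Rightarrow> ('a, 'b) monstr \<Rightarrow> ('a, 'b) cpx \<Rightarrow> ('a, 'b) cpx
    \<Rightarrow> ('a, 'b) dcpx" where
  "tensor_dcpx A U K L = \<lparr>Dob = (\<lambda>p q. TO U (Cob K p) (Cob L q)),
     Dh = (\<lambda>p q. TA U (Cdf K p) (Idt A (Cob L q))),
     Dv = (\<lambda>p q. TA U (Idt A (Cob K p)) (Cdf L q))\<rparr>"

definition tensor_cpx :: "('a, 'b) addcat \<Rightarrow> ('a, 'b) monstr \<Rightarrow> ('a, 'b) cpx \<Rightarrow> ('a, 'b) cpx
    \<Rightarrow> ('a, 'b) cpx" where
  "tensor_cpx A U K L = Tot A (tensor_dcpx A U K L)"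

text \<open>The associator is the unique family of arrows restricting to the associators of \<open>A\<close> on the
  summands \<open>(K\<^sub>p \<otimes> L\<^sub>q) \<otimes> M\<^sub>r\<close>.\<close>

definition chain_asc :: "('a, 'b) addcat \<Rightarrow> ('a, 'b) monstr \<Rightarrow> ('a, 'b) cpx \<Rightarrow> ('a, 'b) cpx
    \<Rightarrow> ('a, 'b) cpx \<Rightarrow> ('a, 'b) cmap" where
  "chain_asc A U K L M = (let KL = tensor_cpx A U K L; LM = tensor_cpx A U L M;
       KL_M = tensor_cpx A U KL M; K_LM = tensor_cpx A U K LM in
     \<lparr>Src = KL_M, Tgt = K_LM,
      At = (\<lambda>n. THE h. h \<in> Hom A (Cob KL_M n) (Cob K_LM n) \<and>
        (\<forall>p q r. p + q + r = n \<longrightarrow>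
           h \<cdot>\<^bsub>A\<^esub> tinj A (tensor_dcpx A U KL M) n (p + q)
             \<cdot>\<^bsub>A\<^esub> TA U (tinj A (tensor_dcpx A U K L) (p + q) p) (Idt A (Cob M r)) =
           tinj A (tensor_dcpx A U K LM) n p
             \<cdot>\<^bsub>A\<^esub> TA U (Idt A (Cob K p)) (tinj A (tensor_dcpx A U L M) (q + r) q)
             \<cdot>\<^bsub>A\<^esub> Asc U (Cob K p) (Cob L q) (Cob M r)))\<rparr>)"

definition unit_cpx :: "('a, 'b) addcat \<Rightarrow> ('a, 'b) monstr \<Rightarrow> ('a, 'b) cpx" where
  "unit_cpx A U = (let c = (\<lambda>n::int. if n = 0 then Unt U else zob A) in
     \<lparr>Cob = c, Cdf = (\<lambda>n. Zer A (c n) (c (n - 1)))\<rparr>)"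

definition chain_ten ::
    "('a, 'b) addcat \<Rightarrow> ('a, 'b) monstr \<Rightarrow> (('a, 'b) cpx, ('a, 'b) cmap) monstr" where
  "chain_ten A U = \<lparr>
     TO = tensor_cpx A U,
     TA = (\<lambda>f g. tot_map A (tensor_dcpx A U (Src f) (Src g)) (tensor_dcpx A U (Tgt f) (Tgt g))
                   (\<lambda>p q. TA U (At f p) (At g q))),
     Unt = unit_cpx A U,
     Asc = chain_asc A U,
     Lun = (\<lambda>K. \<lparr>Src = tensor_cpx A U (unit_cpx A U) K, Tgt = K,
        At = (\<lambda>n. copair A (diag (tensor_dcpx A U (unit_cpx A U) K) n) (Cob K n)
           (\<lambda>p. if p = 0 then Lun U (Cob K n)
                else Zer A (diag (tensor_dcpx A U (unit_cpx A U) K) n p) (Cob K n)))\<rparr>),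
     Run = (\<lambda>K. \<lparr>Src = tensor_cpx A U K (unit_cpx A U), Tgt = K,
        At = (\<lambda>n. copair A (diag (tensor_dcpx A U K (unit_cpx A U)) n) (Cob K n)
           (\<lambda>p. if p = n then Run U (Cob K n)
                else Zer A (diag (tensor_dcpx A U K (unit_cpx A U)) n p) (Cob K n)))\<rparr>)\<rparr>"


section \<open>The category of monoidal functors to chain complexes\<close>

type_synonym ('c, 'd, 'a, 'b) cmf = "('c, 'd, ('a, 'b) cpx, ('a, 'b) cmap) mfct"
type_synonym ('c, 'd, 'a, 'b) cmt = "(('c, 'd, 'a, 'b) cmf, 'c, ('a, 'b) cmap) trf"
type_synonym ('c, 'd, 'a, 'b) fcpx =
  "(('c, 'd, 'a, 'b) fct, (('c, 'd, 'a, 'b) fct, 'c, 'b) trf) cpx"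
type_synonym ('c, 'd, 'a, 'b) fcmap =
  "(('c, 'd, 'a, 'b) fct, (('c, 'd, 'a, 'b) fct, 'c, 'b) trf) cmap"

text \<open>The lower bound is uniform over the objects of \<open>C\<close>.\<close>

definition Mon_ob :: "('c, 'd) cat \<Rightarrow> ('c, 'd) monstr \<Rightarrow> ('a, 'b) addcat \<Rightarrow> ('a, 'b) monstr
    \<Rightarrow> ('c, 'd, 'a, 'b) cmf set" where
  "Mon_ob C T A U = {F. monoidal_functor C T (chain_cat A) (chain_ten A U) F \<and>
     (\<exists>m. \<forall>X \<in> Ob C. \<forall>n < m. zero_object A (Cob (FO F X) n))}"

definition Mon_cat :: "('c, 'd) cat \<Rightarrow> ('c, 'd) monstr \<Rightarrow> ('a, 'b) addcat \<Rightarrow> ('a, 'b) monstr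
    \<Rightarrow> (('c, 'd, 'a, 'b) cmf, ('c, 'd, 'a, 'b) cmt) cat" where
  "Mon_cat C T A U = \<lparr>
     Ob = Mon_ob C T A U,
     Ar = {t. Src t \<in> Mon_ob C T A U \<and> Tgt t \<in> Mon_ob C T A U \<and>
              monoidal_trans C T (chain_cat A) (chain_ten A U) t},
     Dom = Src, Cod = Tgt,
     Idt = trf_idt C (chain_cat A),
     Cmp = trf_cmp C (chain_cat A)\<rparr>"

text \<open>The identification of functors \<open>C \<rightarrow> C\<^sub>*(A)\<close> with complexes in the functor category;
  the monoidal structure is forgotten.\<close>

definition und_ob :: "('c, 'd) cat \<Rightarrow> ('c, 'd, 'a, 'b) cmf \<Rightarrow> ('c, 'd, 'a, 'b) fcpx" where
  "und_ob C F = (let c = (\<lambda>n. \<lparr>FO = (\<lambda>X \<in> Ob C. Cob (FO F X) n),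
                              FA = (\<lambda>f \<in> Ar C. At (FA F f) n)\<rparr>) in
     \<lparr>Cob = c,
      Cdf = (\<lambda>n. \<lparr>Src = c n, Tgt = c (n - 1), At = (\<lambda>X \<in> Ob C. Cdf (FO F X) n)\<rparr>)\<rparr>)"

definition und_ar :: "('c, 'd) cat \<Rightarrow> ('c, 'd, 'a, 'b) cmt \<Rightarrow> ('c, 'd, 'a, 'b) fcmap" where
  "und_ar C t = \<lparr>Src = und_ob C (Src t), Tgt = und_ob C (Tgt t),
     At = (\<lambda>n. \<lparr>Src = Cob (und_ob C (Src t)) n, Tgt = Cob (und_ob C (Tgt t)) n,
                 At = (\<lambda>X \<in> Ob C. At (At t X) n)\<rparr>)\<rparr>"


section \<open>Acyclic classes and weak equivalences\<close>

definition acyclic_class :: "('o, 'm) addcat \<Rightarrow> ('o, 'm) cpx set \<Rightarrow> bool" where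
  "acyclic_class B \<Gamma> \<longleftrightarrow> \<Gamma> \<subseteq> Ob (chain_cat B) \<and>
     zero_cpx B \<in> \<Gamma> \<and>
     (\<forall>K \<in> Ob (chain_cat B). K \<in> \<Gamma> \<longleftrightarrow> shift B K \<in> \<Gamma>) \<and>
     (\<forall>f. homotopy_equivalence B f \<longrightarrow> (Src f \<in> \<Gamma> \<longleftrightarrow> Tgt f \<in> \<Gamma>)) \<and>
     (\<forall>K \<in> \<Gamma>. acyclic_cpx B K) \<and>
     (\<forall>D. is_dcpx B D \<and> dcpx_bounded_below B D \<and> (\<forall>q. row D q \<in> \<Gamma>) \<longrightarrow> Tot B D \<in> \<Gamma>)"

definition weak_equivalences :: "('c, 'd) cat \<Rightarrow> ('c, 'd) monstr \<Rightarrow> ('a, 'b) addcat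
    \<Rightarrow> ('a, 'b) monstr \<Rightarrow> ('c, 'd, 'a, 'b) fcpx set \<Rightarrow> ('c, 'd, 'a, 'b) cmt set" where
  "weak_equivalences C T A U \<Gamma> =
     {f \<in> Ar (Mon_cat C T A U). cone (fun_cat C A) (und_ar C f) \<in> \<Gamma>}"

definition homotopy_equivalences :: "('c, 'd) cat \<Rightarrow> ('c, 'd) monstr \<Rightarrow> ('a, 'b) addcat
    \<Rightarrow> ('a, 'b) monstr \<Rightarrow> ('c, 'd, 'a, 'b) cmt set" where
  "homotopy_equivalences C T A U =
     {f \<in> Ar (Mon_cat C T A U). homotopy_equivalence (fun_cat C A) (und_ar C f)}"


section \<open>Simplicial objects\<close>

text \<open>\<open>Fac K n i : K\<^sub>n \<rightarrow> K\<^bsub>n-1\<^esub>\<close> for \<open>0 < n\<close>, \<open>i \<le> n\<close>, and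
  \<open>Deg K n i : K\<^sub>n \<rightarrow> K\<^bsub>n+1\<^esub>\<close> for \<open>i \<le> n\<close>; values at other indices are irrelevant.\<close>

record ('o, 'm) simp =
  SO :: "nat \<Rightarrow> 'o"
  Fac :: "nat \<Rightarrow> nat \<Rightarrow> 'm"
  Deg :: "nat \<Rightarrow> nat \<Rightarrow> 'm"

definition simplicial_object :: "('o, 'm) cat \<Rightarrow> ('o, 'm) simp \<Rightarrow> bool" where
  "simplicial_object M K \<longleftrightarrow>
     (\<forall>n. SO K n \<in> Ob M) \<and>
     (\<forall>n i. i \<le> Suc n \<longrightarrow> Fac K (Suc n) i \<in> Hom M (SO K (Suc n)) (SO K n)) \<and>
     (\<forall>n i. i \<le> n \<longrightarrow> Deg K n i \<in> Hom M (SO K n) (SO K (Suc n))) \<and>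
     (\<forall>n i j. i < j \<and> j \<le> Suc (Suc n) \<longrightarrow>
        Fac K (Suc n) i \<cdot>\<^bsub>M\<^esub> Fac K (Suc (Suc n)) j =
        Fac K (Suc n) (j - 1) \<cdot>\<^bsub>M\<^esub> Fac K (Suc (Suc n)) i) \<and>
     (\<forall>n i j. i \<le> j \<and> j \<le> n \<longrightarrow>
        Deg K (Suc n) i \<cdot>\<^bsub>M\<^esub> Deg K n j = Deg K (Suc n) (Suc j) \<cdot>\<^bsub>M\<^esub> Deg K n i) \<and>
     (\<forall>n i j. i < j \<and> j \<le> n \<longrightarrow>
        Fac K (Suc n) i \<cdot>\<^bsub>M\<^esub> Deg K n j = Deg K (n - 1) (j - 1) \<cdot>\<^bsub>M\<^esub> Fac K n i) \<and>
     (\<forall>n j. j \<le> n \<longrightarrow>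
        Fac K (Suc n) j \<cdot>\<^bsub>M\<^esub> Deg K n j = Idt M (SO K n) \<and>
        Fac K (Suc n) (Suc j) \<cdot>\<^bsub>M\<^esub> Deg K n j = Idt M (SO K n)) \<and>
     (\<forall>n i j. Suc j < i \<and> i \<le> Suc n \<longrightarrow>
        Fac K (Suc n) i \<cdot>\<^bsub>M\<^esub> Deg K n j = Deg K (n - 1) j \<cdot>\<^bsub>M\<^esub> Fac K n (i - 1))"

definition simplicial_map ::
    "('o, 'm) cat \<Rightarrow> ('o, 'm) simp \<Rightarrow> ('o, 'm) simp \<Rightarrow> (nat \<Rightarrow> 'm) \<Rightarrow> bool" where
  "simplicial_map M K L f \<longleftrightarrow>
     (\<forall>n. f n \<in> Hom M (SO K n) (SO L n)) \<and>
     (\<forall>n i. i \<le> Suc n \<longrightarrow> f n \<cdot>\<^bsub>M\<^esub> Fac K (Suc n) i = Fac L (Suc n) i \<cdot>\<^bsub>M\<^esub> f (Suc n)) \<and>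
     (\<forall>n i. i \<le> n \<longrightarrow> f (Suc n) \<cdot>\<^bsub>M\<^esub> Deg K n i = Deg L n i \<cdot>\<^bsub>M\<^esub> f n)"

fun degs :: "('o, 'm) cat \<Rightarrow> ('o, 'm) simp \<Rightarrow> nat \<Rightarrow> nat list \<Rightarrow> 'm" where
  "degs M K n [] = Idt M (SO K n)"
| "degs M K n (i # ns) = degs M K (Suc n) ns \<cdot>\<^bsub>M\<^esub> Deg K n i"

text \<open>Simplicial monoidal functors, i.e. functors from the opposite simplex category to
  \<open>Mon(C, C\<^sub>*(A))\<close>. As for every functor to complexes, the lower bound is uniform, here also
  in the simplicial degree; this is what makes the total complex bounded below.\<close>

definition sMon :: "('c, 'd) cat \<Rightarrow> ('c, 'd) monstr \<Rightarrow> ('a, 'b) addcat \<Rightarrow> ('a, 'b) monstr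
    \<Rightarrow> (('c, 'd, 'a, 'b) cmf, ('c, 'd, 'a, 'b) cmt) simp set" where
  "sMon C T A U = {K. simplicial_object (Mon_cat C T A U) K \<and>
     (\<exists>m. \<forall>p. \<forall>X \<in> Ob C. \<forall>n < m. zero_object A (Cob (FO (SO K p) X) n))}"


section \<open>The Eilenberg--MacLane simple functor\<close>

definition sdcpx :: "('a, 'b) addcat \<Rightarrow> (('c, 'd, 'a, 'b) cmf, ('c, 'd, 'a, 'b) cmt) simp
    \<Rightarrow> 'c \<Rightarrow> ('a, 'b) dcpx" where
  "sdcpx A K X = (let D = (\<lambda>p q. if 0 \<le> p then Cob (FO (SO K (nat p)) X) q else zob A) in
     \<lparr>Dob = D,
      Dh = (\<lambda>p q. if 0 < p
              then finprod (hgrp A (D p q) (D (p - 1) q))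
                     (\<lambda>i. signed A (int i) (At (At (Fac K (nat p) i) X) q)) {0..nat p}
              else Zer A (D p q) (D (p - 1) q)),
      Dv = (\<lambda>p q. if 0 \<le> p then Cdf (FO (SO K (nat p)) X) q
                  else Zer A (D p q) (D p (q - 1)))\<rparr>)"

text \<open>A \<open>(p,q)\<close>-shuffle is determined by the set \<open>\<mu>\<close> of its \<open>p\<close> first values, \<open>\<nu>\<close> being the
  complement of \<open>\<mu>\<close> in \<open>{0,\<dots>,p+q-1}\<close>; its signature is given by the number of inversions.
  The result is the component of the shuffle map from \<open>K\<^sub>p(X)\<^sub>i \<otimes> K\<^sub>q(Y)\<^sub>j\<close> to
  \<open>K\<^bsub>p+q\<^esub>(X)\<^sub>i \<otimes> K\<^bsub>p+q\<^esub>(Y)\<^sub>j\<close>.\<close>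

definition shuffle :: "('c, 'd) cat \<Rightarrow> ('c, 'd) monstr \<Rightarrow> ('a, 'b) addcat \<Rightarrow> ('a, 'b) monstr
    \<Rightarrow> (('c, 'd, 'a, 'b) cmf, ('c, 'd, 'a, 'b) cmt) simp \<Rightarrow> 'c \<Rightarrow> 'c
    \<Rightarrow> nat \<Rightarrow> nat \<Rightarrow> int \<Rightarrow> int \<Rightarrow> 'b" where
  "shuffle C T A U K X Y p q i j =
     finprod (hgrp A (TO U (Cob (FO (SO K p) X) i) (Cob (FO (SO K q) Y) j))
                     (TO U (Cob (FO (SO K (p + q)) X) i) (Cob (FO (SO K (p + q)) Y) j)))
       (\<lambda>\<mu>. let \<nu> = {..<p + q} - \<mu>; M = Mon_cat C T A U in
          signed A (int (card {(a, b). a \<in> \<mu> \<and> b \<in> \<nu> \<and> b < a}))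
            (TA U (At (At (degs M K p (sorted_list_of_set \<nu>)) X) i)
                  (At (At (degs M K q (sorted_list_of_set \<mu>)) Y) j)))
       {\<mu>. \<mu> \<subseteq> {..<p + q} \<and> card \<mu> = p}"

text \<open>On the summand \<open>K\<^sub>p(X)\<^sub>i \<otimes> K\<^sub>q(Y)\<^sub>j\<close> the Kuenneth morphism is the shuffle map followed by
  that of \<open>K\<^bsub>p+q\<^esub>\<close>; the Koszul sign \<open>(-1)\<^bsup>iq\<^esup>\<close> comes from moving the internal degree \<open>i\<close> past
  the simplicial degree \<open>q\<close>.\<close>

definition sEM_kap :: "('c, 'd) cat \<Rightarrow> ('c, 'd) monstr \<Rightarrow> ('a, 'b) addcat \<Rightarrow> ('a, 'b) monstr
    \<Rightarrow> (('c, 'd, 'a, 'b) cmf, ('c, 'd, 'a, 'b) cmt) simp \<Rightarrow> 'c \<Rightarrow> 'c \<Rightarrow> ('a, 'b) cmap" where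
  "sEM_kap C T A U K X Y = (let
       SX = Tot A (sdcpx A K X); SY = Tot A (sdcpx A K Y); SXY = Tot A (sdcpx A K (TO T X Y)) in
     \<lparr>Src = tensor_cpx A U SX SY, Tgt = SXY,
      At = (\<lambda>n. THE h. h \<in> Hom A (Cob (tensor_cpx A U SX SY) n) (Cob SXY n) \<and>
        (\<forall>p q i j. int p + i + (int q + j) = n \<longrightarrow>
           h \<cdot>\<^bsub>A\<^esub> tinj A (tensor_dcpx A U SX SY) n (int p + i)
             \<cdot>\<^bsub>A\<^esub> TA U (tinj A (sdcpx A K X) (int p + i) (int p))
                       (tinj A (sdcpx A K Y) (int q + j) (int q)) =
           signed A (i * int q)
             (tinj A (sdcpx A K (TO T X Y)) n (int (p + q))
               \<cdot>\<^bsub>A\<^esub> At (Kap (SO K (p + q)) X Y) (i + j)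
               \<cdot>\<^bsub>A\<^esub> tinj A (tensor_dcpx A U (FO (SO K (p + q)) X) (FO (SO K (p + q)) Y)) (i + j) i
               \<cdot>\<^bsub>A\<^esub> shuffle C T A U K X Y p q i j)))\<rparr>)"

definition sEM_ob :: "('c, 'd) cat \<Rightarrow> ('c, 'd) monstr \<Rightarrow> ('a, 'b) addcat \<Rightarrow> ('a, 'b) monstr
    \<Rightarrow> (('c, 'd, 'a, 'b) cmf, ('c, 'd, 'a, 'b) cmt) simp \<Rightarrow> ('c, 'd, 'a, 'b) cmf" where
  "sEM_ob C T A U K = \<lparr>
     FO = (\<lambda>X \<in> Ob C. Tot A (sdcpx A K X)),
     FA = (\<lambda>f \<in> Ar C. tot_map A (sdcpx A K (Dom C f)) (sdcpx A K (Cod C f))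
             (\<lambda>p q. if 0 \<le> p then At (FA (SO K (nat p)) f) q else Zer A (zob A) (zob A))),
     Kap = (\<lambda>X Y. if X \<in> Ob C \<and> Y \<in> Ob C then sEM_kap C T A U K X Y else undefined),
     Eta = \<lparr>Src = unit_cpx A U, Tgt = Tot A (sdcpx A K (Unt T)),
            At = (\<lambda>n. tinj A (sdcpx A K (Unt T)) n 0 \<cdot>\<^bsub>A\<^esub> At (Eta (SO K 0)) n)\<rparr>\<rparr>"

definition sEM_ar :: "('c, 'd) cat \<Rightarrow> ('c, 'd) monstr \<Rightarrow> ('a, 'b) addcat \<Rightarrow> ('a, 'b) monstr
    \<Rightarrow> (('c, 'd, 'a, 'b) cmf, ('c, 'd, 'a, 'b) cmt) simp
    \<Rightarrow> (('c, 'd, 'a, 'b) cmf, ('c, 'd, 'a, 'b) cmt) simp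
    \<Rightarrow> (nat \<Rightarrow> ('c, 'd, 'a, 'b) cmt) \<Rightarrow> ('c, 'd, 'a, 'b) cmt" where
  "sEM_ar C T A U K L f = \<lparr>
     Src = sEM_ob C T A U K, Tgt = sEM_ob C T A U L,
     At = (\<lambda>X \<in> Ob C. tot_map A (sdcpx A K X) (sdcpx A L X)
             (\<lambda>p q. if 0 \<le> p then At (At (f (nat p)) X) q else Zer A (zob A) (zob A)))\<rparr>"

definition sEM_compatible :: "('c, 'd) cat \<Rightarrow> ('c, 'd) monstr \<Rightarrow> ('a, 'b) addcat
    \<Rightarrow> ('a, 'b) monstr \<Rightarrow> ('c, 'd, 'a, 'b) cmt set \<Rightarrow> bool" where
  "sEM_compatible C T A U \<Sigma> \<longleftrightarrow>
     (\<forall>K \<in> sMon C T A U. \<forall>L \<in> sMon C T A U. \<forall>f.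
        simplicial_map (Mon_cat C T A U) K L f \<and> (\<forall>n. f n \<in> \<Sigma>) \<longrightarrow> sEM_ar C T A U K L f \<in> \<Sigma>)"


section \<open>Cotriples\<close>

record ('o, 'm) cotr = "('o, 'm, 'o, 'm) fct" +
  Eps :: "'o \<Rightarrow> 'm"
  Del :: "'o \<Rightarrow> 'm"

locale cotriple = category M for M :: "('o, 'm) cat" (structure) +
  fixes G :: "('o, 'm) cotr"
  assumes G_functor: "is_functor M M G"
    and eps_hom: "K \<in> Ob M \<Longrightarrow> Eps G K \<in> Hom M (FO G K) K"
    and eps_nat: "f \<in> Hom M K L \<Longrightarrow> Eps G L \<cdot> FA G f = f \<cdot> Eps G K"
    and del_hom: "K \<in> Ob M \<Longrightarrow> Del G K \<in> Hom M (FO G K) (FO G (FO G K))"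
    and del_nat: "f \<in> Hom M K L \<Longrightarrow> Del G L \<cdot> FA G f = FA G (FA G f) \<cdot> Del G K"
    and counit_left: "K \<in> Ob M \<Longrightarrow> Eps G (FO G K) \<cdot> Del G K = Idt M (FO G K)"
    and counit_right: "K \<in> Ob M \<Longrightarrow> FA G (Eps G K) \<cdot> Del G K = Idt M (FO G K)"
    and coassoc: "K \<in> Ob M \<Longrightarrow> Del G (FO G K) \<cdot> Del G K = FA G (Del G K) \<cdot> Del G K"

definition standard_construction :: "('o, 'm) cotr \<Rightarrow> 'o \<Rightarrow> ('o, 'm) simp" where
  "standard_construction G K = \<lparr>
     SO = (\<lambda>n. (FO G ^^ Suc n) K),
     Fac = (\<lambda>n i. (FA G ^^ i) (Eps G ((FO G ^^ (n - i)) K))),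
     Deg = (\<lambda>n i. (FA G ^^ i) (Del G ((FO G ^^ (n - i)) K)))\<rparr>"

text \<open>The standard construction of every object has a uniform lower bound; this is needed for
  \<open>B\<^sub>*(K) = s\<^bsub>EM\<^esub>(B(K))\<close> to be an object of \<open>Mon(C, C\<^sub>*(A))\<close>.\<close>

definition uniformly_bounded_cotriple :: "('c, 'd) cat \<Rightarrow> ('c, 'd) monstr \<Rightarrow> ('a, 'b) addcat
    \<Rightarrow> ('a, 'b) monstr \<Rightarrow> (('c, 'd, 'a, 'b) cmf, ('c, 'd, 'a, 'b) cmt) cotr \<Rightarrow> bool" where
  "uniformly_bounded_cotriple C T A U G \<longleftrightarrow> (\<forall>K \<in> Ob (Mon_cat C T A U).
     \<exists>m. \<forall>p. \<forall>X \<in> Ob C. \<forall>n < m.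
       zero_object A (Cob (FO (SO (standard_construction G K) p) X) n))"

definition Bstar :: "('c, 'd) cat \<Rightarrow> ('c, 'd) monstr \<Rightarrow> ('a, 'b) addcat \<Rightarrow> ('a, 'b) monstr
    \<Rightarrow> (('c, 'd, 'a, 'b) cmf, ('c, 'd, 'a, 'b) cmt) cotr
    \<Rightarrow> ('c, 'd, 'a, 'b) cmf \<Rightarrow> ('c, 'd, 'a, 'b) cmf" where
  "Bstar C T A U G K = sEM_ob C T A U (standard_construction G K)"

text \<open>The morphism \<open>B\<^sub>*(K) \<rightarrow> K\<close> is the counit on the summand of simplicial degree 0 and zero on
  all other summands.\<close>

definition augmentation :: "('c, 'd) cat \<Rightarrow> ('c, 'd) monstr \<Rightarrow> ('a, 'b) addcat
    \<Rightarrow> ('a, 'b) monstr \<Rightarrow> (('c, 'd, 'a, 'b) cmf, ('c, 'd, 'a, 'b) cmt) cotr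
    \<Rightarrow> ('c, 'd, 'a, 'b) cmf \<Rightarrow> ('c, 'd, 'a, 'b) cmt" where
  "augmentation C T A U G K = \<lparr>Src = Bstar C T A U G K, Tgt = K,
     At = (\<lambda>X \<in> Ob C. let D = sdcpx A (standard_construction G K) X in
       \<lparr>Src = Tot A D, Tgt = FO K X,
        At = (\<lambda>n. copair A (diag D n) (Cob (FO K X) n)
          (\<lambda>p. if p = 0 then At (At (Eps G K) X) n
               else Zer A (diag D n p) (Cob (FO K X) n)))\<rparr>)\<rparr>"

definition presentable :: "('c, 'd) cat \<Rightarrow> ('c, 'd) monstr \<Rightarrow> ('a, 'b) addcat
    \<Rightarrow> ('a, 'b) monstr \<Rightarrow> (('c, 'd, 'a, 'b) cmf, ('c, 'd, 'a, 'b) cmt) cotr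
    \<Rightarrow> ('c, 'd, 'a, 'b) cmt set \<Rightarrow> ('c, 'd, 'a, 'b) cmf \<Rightarrow> bool" where
  "presentable C T A U G \<Sigma> K \<longleftrightarrow> K \<in> Ob (Mon_cat C T A U) \<and> augmentation C T A U G K \<in> \<Sigma>"

definition G_weak_equivalence ::
    "('o, 'm) cat \<Rightarrow> ('o, 'm) cotr \<Rightarrow> 'm set \<Rightarrow> 'm \<Rightarrow> bool" where
  "G_weak_equivalence M G \<Sigma> f \<longleftrightarrow> f \<in> Ar M \<and> FA G f \<in> \<Sigma>"


section \<open>Localization\<close>

text \<open>The localization of \<open>M\<close> at \<open>W\<close> has the objects of \<open>M\<close>; its arrows are the zigzags
  (lists of steps, in diagrammatic order) modulo the congruence generated by composition in \<open>M\<close>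
  and by making each element of \<open>W\<close> and its formal inverse mutually inverse.\<close>

datatype 'm step = Fwd 'm | Bwd 'm

fun zigzag :: "('o, 'm) cat \<Rightarrow> 'm set \<Rightarrow> 'o \<Rightarrow> 'm step list \<Rightarrow> 'o \<Rightarrow> bool" where
  "zigzag M W X [] Y \<longleftrightarrow> X \<in> Ob M \<and> X = Y"
| "zigzag M W X (Fwd f # l) Y \<longleftrightarrow> f \<in> Ar M \<and> Dom M f = X \<and> zigzag M W (Cod M f) l Y"
| "zigzag M W X (Bwd f # l) Y \<longleftrightarrow> f \<in> W \<and> f \<in> Ar M \<and> Cod M f = X \<and> zigzag M W (Dom M f) l Y"

inductive zzeq :: "('o, 'm) cat \<Rightarrow> 'm set \<Rightarrow> 'o \<Rightarrow> 'o \<Rightarrow> 'm step list \<Rightarrow> 'm step list \<Rightarrow> bool"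
  for M W where
  zzeq_refl: "zigzag M W X l Y \<Longrightarrow> zzeq M W X Y l l"
| zzeq_sym: "zzeq M W X Y l l' \<Longrightarrow> zzeq M W X Y l' l"
| zzeq_trans: "\<lbrakk>zzeq M W X Y l l'; zzeq M W X Y l' l''\<rbrakk> \<Longrightarrow> zzeq M W X Y l l''"
| zzeq_append: "\<lbrakk>zzeq M W X Y l l'; zzeq M W Y Z k k'\<rbrakk> \<Longrightarrow> zzeq M W X Z (l @ k) (l' @ k')"
| zzeq_idt: "X \<in> Ob M \<Longrightarrow> zzeq M W X X [Fwd (Idt M X)] []"
| zzeq_cmp: "\<lbrakk>f \<in> Hom M X Y; g \<in> Hom M Y Z\<rbrakk>
    \<Longrightarrow> zzeq M W X Z [Fwd f, Fwd g] [Fwd (g \<cdot>\<^bsub>M\<^esub> f)]"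
| zzeq_inv_right: "\<lbrakk>w \<in> W; w \<in> Hom M X Y\<rbrakk> \<Longrightarrow> zzeq M W X X [Fwd w, Bwd w] []"
| zzeq_inv_left: "\<lbrakk>w \<in> W; w \<in> Hom M X Y\<rbrakk> \<Longrightarrow> zzeq M W Y Y [Bwd w, Fwd w] []"

definition zzclass :: "('o, 'm) cat \<Rightarrow> 'm set \<Rightarrow> 'o \<Rightarrow> 'm step list \<Rightarrow> 'o
    \<Rightarrow> ('o, unit, 'm step list set) trf" where
  "zzclass M W X l Y = \<lparr>Src = X, Tgt = Y, At = (\<lambda>_. {l'. zzeq M W X Y l l'})\<rparr>"

definition localization ::
    "('o, 'm) cat \<Rightarrow> 'm set \<Rightarrow> ('o, ('o, unit, 'm step list set) trf) cat" where
  "localization M W = \<lparr>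
     Ob = Ob M,
     Ar = {zzclass M W X l Y | X l Y. zigzag M W X l Y},
     Dom = Src, Cod = Tgt,
     Idt = (\<lambda>X. zzclass M W X [] X),
     Cmp = (\<lambda>b a. \<lparr>Src = Src a, Tgt = Tgt b,
       At = (\<lambda>_. {l. \<exists>x \<in> At a (). \<exists>y \<in> At b (). zzeq M W (Src a) (Tgt b) (x @ y) l})\<rparr>)\<rparr>"

definition loc :: "('o, 'm) cat \<Rightarrow> 'm set \<Rightarrow> 'm \<Rightarrow> ('o, unit, 'm step list set) trf" where
  "loc M W f = zzclass M W (Dom M f) [Fwd f] (Cod M f)"

end

theory Submission
  imports Defs
begin

text \<open>Let \<open>B = s\<^sub>E\<^sub>M B\<^sub>\<bullet>\<close> be the functor given by the standard construction, with its augmentation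
  \<open>\<epsilon> : B \<Rightarrow> id\<close>. Since \<open>G\<close> and \<open>s\<^sub>E\<^sub>M\<close> preserve \<open>\<Sigma>\<close>, so does \<open>B\<close>, and \<open>B(s)\<close> is in \<open>\<Sigma>\<close> because every
  \<open>G\<^sup>n\<^sup>+\<^sup>1(s)\<close> is. Hence \<open>B\<close> and \<open>\<epsilon>\<close> descend to the localization, where \<open>\<epsilon>\<close> at \<open>K\<close> and \<open>B(s)\<close> become
  invertible. If \<open>s\<beta> = \<alpha>\<close>, then \<open>B(s)B(\<beta>) = B(\<alpha>)\<close> and \<open>\<beta>\<epsilon>\<^sub>K = \<epsilon>\<^sub>L B(\<beta>)\<close>, which forces
  \<open>\<beta> = \<epsilon>\<^sub>L B(s)\<^sup>-\<^sup>1 B(\<alpha>) \<epsilon>\<^sub>K\<^sup>-\<^sup>1\<close>; conversely this composite solves the equation by naturality of \<open>\<epsilon>\<close>.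
  What has to be checked by hand is that \<open>B\<close> of an arbitrary morphism and \<open>\<epsilon>\<close> are monoidal: both
  sides are compared on the summands of the tensor product of two total complexes, where the
  Kuenneth morphism is determined by the shuffle map.\<close>

section \<open>Additive categories\<close>

text \<open>The localization is built from zigzags without a calculus of fractions, so the functor
  and its augmentation must be carried along backward steps too; naturality there is the naturality
  square with two opposite sides inverted. The lifting argument is formal once this is available,
  and it is stated for an arbitrary functor with an augmentation. The weight lies in the Kuenneth
  morphism of a total complex. It is a definite description of an arrow with prescribed components,
  so existence and uniqueness of such an arrow come before any computation. The tensor product is
  only biadditive, and total complexes are sums over all integers. Boundedness leaves finitely many
  nonzero summands, so the identity of such a sum is a finite sum of inclusions after projections,
  and biadditivity carries this equation through the tensor product. The augmentation is monoidal
  because the only (0,0)-shuffle is trivial, while everything of positive simplicial degree is sent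
  to zero on both sides of the equation.\<close>

lemma Hom_iff: "f \<in> Hom C X Y \<longleftrightarrow> f \<in> Ar C \<and> Dom C f = X \<and> Cod C f = Y"
  by (auto simp: Hom_def)

context category
begin

lemma cmp_typing [simp]:
  assumes "f \<in> Ar C" "g \<in> Ar C" "Cod C f = Dom C g"
  shows "g \<cdot> f \<in> Ar C" "Dom C (g \<cdot> f) = Dom C f" "Cod C (g \<cdot> f) = Cod C g"
  using cmp_hom[of f "Dom C f" "Cod C f" g "Cod C g"] assms by (auto simp: Hom_iff)

lemma idt_typing [simp]:
  assumes "X \<in> Ob C"
  shows "Idt C X \<in> Ar C" "Dom C (Idt C X) = X" "Cod C (Idt C X) = X"
  using idt_hom[OF assms] by (auto simp: Hom_iff)

lemma assoc [simp]:
  assumes "f \<in> Ar C" "g \<in> Ar C" "h \<in> Ar C" "Cod C f = Dom C g" "Cod C g = Dom C h"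
  shows "(h \<cdot> g) \<cdot> f = h \<cdot> (g \<cdot> f)"
  using assms by (intro cmp_assoc) (auto simp: Hom_iff)

lemma idt_left [simp]: "\<lbrakk>f \<in> Ar C; Cod C f = Y\<rbrakk> \<Longrightarrow> Idt C Y \<cdot> f = f"
  by (rule cmp_idt_left) (auto simp: Hom_iff)

lemma idt_right [simp]: "\<lbrakk>f \<in> Ar C; Dom C f = X\<rbrakk> \<Longrightarrow> f \<cdot> Idt C X = f"
  by (rule cmp_idt_right) (auto simp: Hom_iff)

text \<open>Composites are normalised to right-nested form, where an equation for
  \<open>g \<cdot> f\<close> no longer matches once \<open>f\<close> is itself composed with a
  further arrow. This version rewrites inside such a chain.\<close>

lemma cmp_sub:
  assumes "g \<cdot> f = k" "f \<in> Ar C" "g \<in> Ar C" "t \<in> Ar C" "Cod C f = Dom C g" "Cod C t = Dom C f"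
  shows "g \<cdot> (f \<cdot> t) = k \<cdot> t"
  using assms by (metis assoc)

lemmas ob_typing [simp] = dom_ob cod_ob

lemma hom_obD: "f \<in> Hom C X Y \<Longrightarrow> X \<in> Ob C \<and> Y \<in> Ob C"
  by (auto simp: Hom_iff)

lemma hom_self: "f \<in> Ar C \<Longrightarrow> f \<in> Hom C (Dom C f) (Cod C f)"
  by (simp add: Hom_iff)

end

context additive_category
begin

section \<open>Hom groups: zero arrows, sums, negatives and signs\<close>

lemma carrier_hgrp [simp]: "carrier (hgrp A X Y) = Hom A X Y"
  by (simp add: hgrp_def)

lemma mult_hgrp [simp]: "mult (hgrp A X Y) = Plus A"
  by (simp add: hgrp_def)

lemma one_hgrp [simp]: "one (hgrp A X Y) = Zer A X Y"
  by (simp add: hgrp_def)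

lemma zer_hom: "\<lbrakk>X \<in> Ob A; Y \<in> Ob A\<rbrakk> \<Longrightarrow> Zer A X Y \<in> Hom A X Y"
  using comm_group.axioms(1)[OF hom_comm_group, THEN comm_monoid.axioms(1), THEN monoid.one_closed]
  by simp

lemma plus_hom: "\<lbrakk>f \<in> Hom A X Y; g \<in> Hom A X Y; X \<in> Ob A; Y \<in> Ob A\<rbrakk> \<Longrightarrow> Plus A f g \<in> Hom A X Y"
  using comm_group.axioms(1)[OF hom_comm_group, THEN comm_monoid.axioms(1), THEN monoid.m_closed, of X Y f g]
  by simp

lemma neg_hom: "\<lbrakk>f \<in> Hom A X Y; X \<in> Ob A; Y \<in> Ob A\<rbrakk> \<Longrightarrow> neg A f \<in> Hom A X Y"
  using comm_group.axioms(2)[OF hom_comm_group, THEN group.inv_closed, of X Y f]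
  by (simp add: neg_def Hom_iff)

lemma zer_typing [simp]:
  assumes "X \<in> Ob A" "Y \<in> Ob A"
  shows "Zer A X Y \<in> Ar A" "Dom A (Zer A X Y) = X" "Cod A (Zer A X Y) = Y"
  using zer_hom[OF assms] by (auto simp: Hom_iff)

lemma plus_typing [simp]:
  assumes "f \<in> Ar A" "g \<in> Ar A" "Dom A f = Dom A g" "Cod A f = Cod A g"
  shows "Plus A f g \<in> Ar A" "Dom A (Plus A f g) = Dom A g" "Cod A (Plus A f g) = Cod A g"
  using plus_hom[of f "Dom A g" "Cod A g" g] assms by (auto simp: Hom_iff)

lemma neg_typing [simp]:
  assumes "f \<in> Ar A"
  shows "neg A f \<in> Ar A" "Dom A (neg A f) = Dom A f" "Cod A (neg A f) = Cod A f"
  using neg_hom[of f "Dom A f" "Cod A f"] assms by (auto simp: Hom_iff)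

lemma plus_zer_left [simp]:
  assumes "f \<in> Ar A" "Dom A f = X" "Cod A f = Y"
  shows "Plus A (Zer A X Y) f = f"
proof -
  interpret H: comm_group "hgrp A X Y" using assms by (intro hom_comm_group) auto
  show ?thesis using H.l_one[of f] assms by (simp add: Hom_iff)
qed

lemma plus_comm:
  assumes "f \<in> Ar A" "g \<in> Ar A" "Dom A f = Dom A g" "Cod A f = Cod A g"
  shows "Plus A f g = Plus A g f"
proof -
  interpret H: comm_group "hgrp A (Dom A g) (Cod A g)" using assms by (intro hom_comm_group) auto
  show ?thesis using H.m_comm[of f g] assms by (simp add: Hom_iff)
qed

lemma plus_zer_right [simp]:
  assumes "f \<in> Ar A" "Dom A f = X" "Cod A f = Y"
  shows "Plus A f (Zer A X Y) = f"
  using assms plus_comm[of f "Zer A X Y"] by (metis cod_ob dom_ob plus_zer_left zer_typing)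

lemma plus_neg [simp]:
  assumes "f \<in> Ar A"
  shows "Plus A f (neg A f) = Zer A (Dom A f) (Cod A f)"
proof -
  interpret H: comm_group "hgrp A (Dom A f) (Cod A f)" using assms by (intro hom_comm_group) auto
  show ?thesis using H.r_inv[of f] assms by (simp add: Hom_iff neg_def)
qed

lemma plus_cancel:
  assumes "Plus A f g = f" "f \<in> Ar A" "g \<in> Ar A" "Dom A f = Dom A g" "Cod A f = Cod A g"
  shows "g = Zer A (Dom A g) (Cod A g)"
proof -
  interpret H: comm_group "hgrp A (Dom A g) (Cod A g)" using assms by (intro hom_comm_group) auto
  show ?thesis using H.r_cancel_one[of f g] assms
    by (metis H.l_cancel_one' Hom_iff carrier_hgrp mult_hgrp one_hgrp)
qed

lemma neg_unique:
  assumes "Plus A f g = Zer A (Dom A g) (Cod A g)" "f \<in> Ar A" "g \<in> Ar A"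
    "Dom A f = Dom A g" "Cod A f = Cod A g"
  shows "g = neg A f"
proof -
  interpret H: comm_group "hgrp A (Dom A g) (Cod A g)" using assms by (intro hom_comm_group) auto
  show ?thesis using H.inv_equality[of g f] assms H.m_comm[of f g]
    by (simp add: Hom_iff neg_def)
qed

lemma cmp_plus [simp]:
  assumes "f \<in> Ar A" "f' \<in> Ar A" "Dom A f = Dom A f'" "Cod A f = Cod A f'" "g \<in> Ar A" "Dom A g = Cod A f'"
  shows "g \<cdot>\<^bsub>A\<^esub> Plus A f f' = Plus A (g \<cdot>\<^bsub>A\<^esub> f) (g \<cdot>\<^bsub>A\<^esub> f')"
  using assms by (intro cmp_plus_right) (auto simp: Hom_iff)

lemma plus_cmp [simp]:
  assumes "f \<in> Ar A" "f' \<in> Ar A" "Dom A f = Dom A f'" "Cod A f = Cod A f'" "g \<in> Ar A" "Cod A g = Dom A f'"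
  shows "Plus A f f' \<cdot>\<^bsub>A\<^esub> g = Plus A (f \<cdot>\<^bsub>A\<^esub> g) (f' \<cdot>\<^bsub>A\<^esub> g)"
  using assms by (intro cmp_plus_left) (auto simp: Hom_iff)

text \<open>By distributivity the composite z satisfies z + z = z, and \<open>plus_cancel\<close>
  makes it zero. The same argument serves precomposition and the tensor product.\<close>

lemma cmp_zer [simp]:
  assumes "g \<in> Ar A" "X \<in> Ob A" "Dom A g = Y"
  shows "g \<cdot>\<^bsub>A\<^esub> Zer A X Y = Zer A X (Cod A g)"
proof -
  have Y: "Y \<in> Ob A" using assms by auto
  have "Plus A (g \<cdot>\<^bsub>A\<^esub> Zer A X Y) (g \<cdot>\<^bsub>A\<^esub> Zer A X Y) = g \<cdot>\<^bsub>A\<^esub> Plus A (Zer A X Y) (Zer A X Y)"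
    using assms Y by (intro cmp_plus[symmetric]) auto
  also have "\<dots> = g \<cdot>\<^bsub>A\<^esub> Zer A X Y" using assms Y by (subst plus_zer_left) auto
  finally show ?thesis using assms Y by (auto dest!: plus_cancel)
qed

lemma zer_cmp [simp]:
  assumes "g \<in> Ar A" "Z \<in> Ob A" "Cod A g = Y"
  shows "Zer A Y Z \<cdot>\<^bsub>A\<^esub> g = Zer A (Dom A g) Z"
proof -
  have Y: "Y \<in> Ob A" using assms by auto
  have "Plus A (Zer A Y Z \<cdot>\<^bsub>A\<^esub> g) (Zer A Y Z \<cdot>\<^bsub>A\<^esub> g) = Plus A (Zer A Y Z) (Zer A Y Z) \<cdot>\<^bsub>A\<^esub> g"
    using assms Y by (intro plus_cmp[symmetric]) auto
  also have "\<dots> = Zer A Y Z \<cdot>\<^bsub>A\<^esub> g" using assms Y by (subst plus_zer_left) auto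
  finally show ?thesis using assms Y by (auto dest!: plus_cancel)
qed

lemma cmp_neg [simp]:
  assumes "f \<in> Ar A" "g \<in> Ar A" "Cod A f = Dom A g"
  shows "g \<cdot>\<^bsub>A\<^esub> neg A f = neg A (g \<cdot>\<^bsub>A\<^esub> f)"
proof (rule neg_unique)
  show "Plus A (g \<cdot>\<^bsub>A\<^esub> f) (g \<cdot>\<^bsub>A\<^esub> neg A f) = Zer A (Dom A (g \<cdot>\<^bsub>A\<^esub> neg A f)) (Cod A (g \<cdot>\<^bsub>A\<^esub> neg A f))"
    using assms by (subst cmp_plus[symmetric]) auto
qed (use assms in auto)

lemma neg_cmp [simp]:
  assumes "f \<in> Ar A" "g \<in> Ar A" "Cod A f = Dom A g"
  shows "neg A g \<cdot>\<^bsub>A\<^esub> f = neg A (g \<cdot>\<^bsub>A\<^esub> f)"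
proof (rule neg_unique)
  show "Plus A (g \<cdot>\<^bsub>A\<^esub> f) (neg A g \<cdot>\<^bsub>A\<^esub> f) = Zer A (Dom A (neg A g \<cdot>\<^bsub>A\<^esub> f)) (Cod A (neg A g \<cdot>\<^bsub>A\<^esub> f))"
    using assms by (subst plus_cmp[symmetric]) auto
qed (use assms in auto)

lemma neg_zer [simp]: "\<lbrakk>X \<in> Ob A; Y \<in> Ob A\<rbrakk> \<Longrightarrow> neg A (Zer A X Y) = Zer A X Y"
  by (rule neg_unique[symmetric]) auto

lemma signed_typing [simp]:
  assumes "f \<in> Ar A"
  shows "signed A k f \<in> Ar A" "Dom A (signed A k f) = Dom A f" "Cod A (signed A k f) = Cod A f"
  using assms by (auto simp: signed_def)

lemma signed_zer [simp]: "\<lbrakk>X \<in> Ob A; Y \<in> Ob A\<rbrakk> \<Longrightarrow> signed A k (Zer A X Y) = Zer A X Y"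
  by (simp add: signed_def)

lemma signed_0 [simp]: "signed A 0 f = f"
  by (simp add: signed_def)

lemma cmp_signed [simp]:
  assumes "f \<in> Ar A" "g \<in> Ar A" "Cod A f = Dom A g"
  shows "g \<cdot>\<^bsub>A\<^esub> signed A k f = signed A k (g \<cdot>\<^bsub>A\<^esub> f)"
  using assms by (simp add: signed_def)

lemma signed_cmp [simp]:
  assumes "f \<in> Ar A" "g \<in> Ar A" "Cod A f = Dom A g"
  shows "signed A k g \<cdot>\<^bsub>A\<^esub> f = signed A k (g \<cdot>\<^bsub>A\<^esub> f)"
  using assms by (simp add: signed_def)

text \<open>Face sums and shuffle maps are written with \<open>finprod\<close> in a hom group.
  Keeping the two end objects as arguments fixes the group, also for the empty sum.\<close>

definition hsum :: "'o \<Rightarrow> 'o \<Rightarrow> ('i \<Rightarrow> 'm) \<Rightarrow> 'i set \<Rightarrow> 'm" where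
  "hsum X Y f S = finprod (hgrp A X Y) f S"

lemma hsum_empty [simp]:
  assumes "X \<in> Ob A" "Y \<in> Ob A"
  shows "hsum X Y f {} = Zer A X Y"
proof -
  interpret H: comm_group "hgrp A X Y" using assms by (intro hom_comm_group) auto
  show ?thesis by (simp add: hsum_def)
qed

lemma hsum_insert:
  assumes "X \<in> Ob A" "Y \<in> Ob A" "finite S" "i \<notin> S" "\<And>j. j \<in> insert i S \<Longrightarrow> f j \<in> Hom A X Y"
  shows "hsum X Y f (insert i S) = Plus A (f i) (hsum X Y f S)"
proof -
  interpret H: comm_group "hgrp A X Y" using assms by (intro hom_comm_group) auto
  show ?thesis using assms by (simp add: hsum_def H.finprod_insert Pi_def)
qed

lemma hsum_hom:
  assumes "X \<in> Ob A" "Y \<in> Ob A" "\<And>j. j \<in> S \<Longrightarrow> f j \<in> Hom A X Y"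
  shows "hsum X Y f S \<in> Hom A X Y"
proof -
  interpret H: comm_group "hgrp A X Y" using assms by (intro hom_comm_group) auto
  show ?thesis using assms H.finprod_closed[of f S] by (simp add: hsum_def Pi_def)
qed

lemma hsum_typing [simp]:
  assumes "X \<in> Ob A" "Y \<in> Ob A" "\<And>j. j \<in> S \<Longrightarrow> f j \<in> Hom A X Y"
  shows "hsum X Y f S \<in> Ar A" "Dom A (hsum X Y f S) = X" "Cod A (hsum X Y f S) = Y"
  using hsum_hom[of X Y S f] assms by (auto simp: Hom_iff)

lemma hsum_cong:
  assumes "X \<in> Ob A" "Y \<in> Ob A" "\<And>i. i \<in> S \<Longrightarrow> f i = g i" "\<And>j. j \<in> S \<Longrightarrow> f j \<in> Hom A X Y"
  shows "hsum X Y f S = hsum X Y g S"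
proof -
  interpret H: comm_group "hgrp A X Y" using assms by (intro hom_comm_group) auto
  show ?thesis using assms unfolding hsum_def by (intro H.finprod_cong') auto
qed

text \<open>The induction uses only additivity and preservation of zero, so composition on either
  side, and tensoring followed by composition, become instances.\<close>

lemma hsum_map:
  assumes "finite S" "X \<in> Ob A" "Y \<in> Ob A" "X' \<in> Ob A" "Y' \<in> Ob A"
    and f: "\<And>j. j \<in> S \<Longrightarrow> f j \<in> Hom A X Y"
    and \<phi>: "\<And>h. h \<in> Hom A X Y \<Longrightarrow> \<phi> h \<in> Hom A X' Y'"
    and z: "\<phi> (Zer A X Y) = Zer A X' Y'"
    and p: "\<And>h k. \<lbrakk>h \<in> Hom A X Y; k \<in> Hom A X Y\<rbrakk> \<Longrightarrow> \<phi> (Plus A h k) = Plus A (\<phi> h) (\<phi> k)"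
  shows "\<phi> (hsum X Y f S) = hsum X' Y' (\<lambda>i. \<phi> (f i)) S"
  using assms(1) f
proof (induction S rule: finite_induct)
  case empty
  then show ?case using z assms by simp
next
  case (insert i S)
  have "\<phi> (hsum X Y f (insert i S)) = \<phi> (Plus A (f i) (hsum X Y f S))"
    using insert assms by (subst hsum_insert) auto
  also have "\<dots> = Plus A (\<phi> (f i)) (\<phi> (hsum X Y f S))"
    using insert assms by (intro p hsum_hom) auto
  also have "\<dots> = hsum X' Y' (\<lambda>i. \<phi> (f i)) (insert i S)"
    using insert assms by (subst hsum_insert) auto
  finally show ?case .
qed

lemma cmp_hsum:
  assumes "finite S" "X \<in> Ob A" "g \<in> Ar A" "Dom A g = Y" "\<And>j. j \<in> S \<Longrightarrow> f j \<in> Hom A X Y"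
  shows "g \<cdot>\<^bsub>A\<^esub> hsum X Y f S = hsum X (Cod A g) (\<lambda>i. g \<cdot>\<^bsub>A\<^esub> f i) S"
  using assms by (intro hsum_map) (auto simp: Hom_iff)

lemma hsum_cmp:
  assumes "finite S" "Y \<in> Ob A" "g \<in> Ar A" "Cod A g = X" "\<And>j. j \<in> S \<Longrightarrow> f j \<in> Hom A X Y"
  shows "hsum X Y f S \<cdot>\<^bsub>A\<^esub> g = hsum (Dom A g) Y (\<lambda>i. f i \<cdot>\<^bsub>A\<^esub> g) S"
  using assms by (intro hsum_map[where \<phi> = "\<lambda>h. h \<cdot>\<^bsub>A\<^esub> g"]) (auto simp: Hom_iff)

lemma hsum_zer:
  assumes "X \<in> Ob A" "Y \<in> Ob A" "\<And>j. j \<in> S \<Longrightarrow> f j = Zer A X Y"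
  shows "hsum X Y f S = Zer A X Y"
proof -
  interpret H: comm_group "hgrp A X Y" using assms by (intro hom_comm_group) auto
  show ?thesis using assms H.finprod_one_eqI[of S f] by (simp add: hsum_def)
qed

lemma hsum_single:
  assumes "finite S" "k \<in> S" "X \<in> Ob A" "Y \<in> Ob A" "f k \<in> Hom A X Y"
    and "\<And>j. j \<in> S \<Longrightarrow> j \<noteq> k \<Longrightarrow> f j = Zer A X Y"
  shows "hsum X Y f S = f k"
proof -
  have "f j \<in> Hom A X Y" if "j \<in> S" for j
    using assms that by (cases "j = k") (auto simp: Hom_iff)
  then have "hsum X Y f S = Plus A (f k) (hsum X Y f (S - {k}))"
    using assms hsum_insert[of X Y "S - {k}" k f] by (auto simp: insert_absorb)
  also have "hsum X Y f (S - {k}) = Zer A X Y"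
    using assms by (intro hsum_zer) auto
  finally show ?thesis using assms by (simp add: Hom_iff)
qed

text \<open>For the differential out of simplicial degree 1, which has exactly two faces.\<close>

lemma hsum_pair:
  assumes "X \<in> Ob A" "Y \<in> Ob A" "f 0 \<in> Hom A X Y" "f (Suc 0) \<in> Hom A X Y"
  shows "hsum X Y f {0..Suc 0} = Plus A (f 0) (f (Suc 0))"
proof -
  have s: "{0..Suc 0} = insert 0 {Suc 0}" by auto
  have "hsum X Y f (insert 0 {Suc 0}) = Plus A (f 0) (hsum X Y f {Suc 0})"
    using assms by (intro hsum_insert) auto
  moreover have "hsum X Y f {Suc 0} = f (Suc 0)"
    using assms by (intro hsum_single) auto
  ultimately show ?thesis by (simp add: s)
qed

subsection \<open>Zero objects\<close>

lemma zero_object_ob [simp]: "zero_object A Z \<Longrightarrow> Z \<in> Ob A"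
  by (simp add: zero_object_def)

lemma zero_object_zob [simp]: "zero_object A (zob A)"
  using ex_zero_object unfolding zob_def by (rule someI_ex)

lemma zero_object_unique:
  assumes "zero_object A (Dom A f) \<or> zero_object A (Cod A f)"
    and "f \<in> Ar A" "g \<in> Ar A" "Dom A f = Dom A g" "Cod A f = Cod A g"
  shows "f = g"
proof -
  have "f \<in> Hom A (Dom A g) (Cod A g)" "g \<in> Hom A (Dom A g) (Cod A g)"
    "Dom A g \<in> Ob A" "Cod A g \<in> Ob A"
    using assms by (auto simp: Hom_iff)
  then show ?thesis using assms(1,4,5) unfolding zero_object_def by metis
qed

text \<open>The right-hand side is an equation between arrows, so it passes through additive
  constructions such as the tensor product, where the universal property would be awkward.\<close>

lemma zero_object_iff:
  "zero_object A Z \<longleftrightarrow> Z \<in> Ob A \<and> Idt A Z = Zer A Z Z"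
proof
  assume "zero_object A Z"
  then show "Z \<in> Ob A \<and> Idt A Z = Zer A Z Z"
    using zero_object_unique[of "Idt A Z" "Zer A Z Z"] by simp
next
  assume Z: "Z \<in> Ob A \<and> Idt A Z = Zer A Z Z"
  have "f = Zer A X Z" if "f \<in> Hom A X Z" for f X
    using that Z idt_left[of f Z] by (simp add: Hom_iff del: idt_left)
  moreover have "f = Zer A Z X" if "f \<in> Hom A Z X" for f X
    using that Z idt_right[of f Z] by (simp add: Hom_iff del: idt_right)
  ultimately show "zero_object A Z"
    using Z unfolding zero_object_def by (metis zer_hom)
qed

subsection \<open>Finitely supported direct sums\<close>

text \<open>Total complexes are indexed by all integers, while an additive category has finite
  direct sums. Members outside a finite set are zero objects and contribute nothing, so the
  coproduct still exists.\<close>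

definition fin_supp :: "('i \<Rightarrow> 'o) \<Rightarrow> bool" where
  "fin_supp F \<longleftrightarrow> (\<forall>i. F i \<in> Ob A) \<and> finite {i. \<not> zero_object A (F i)}"

lemma fin_suppI:
  assumes "\<And>i. F i \<in> Ob A" "finite S" "\<And>i. i \<notin> S \<Longrightarrow> zero_object A (F i)"
  shows "fin_supp F"
proof -
  have "{i. \<not> zero_object A (F i)} \<subseteq> S" using assms(3) by auto
  then show ?thesis using assms finite_subset unfolding fin_supp_def by auto
qed

text \<open>Induction on the finite set that may carry nonzero members: the new member is replaced
  by a zero object for the induction hypothesis and then put back by a binary sum.\<close>

lemma ex_coproduct_aux:
  assumes "finite S" "\<And>i. F i \<in> Ob A" "\<And>i. i \<notin> S \<Longrightarrow> zero_object A (F i)"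
  shows "\<exists>D. is_coproduct A F D"
  using assms
proof (induction S arbitrary: F rule: finite_induct)
  case empty
  have "is_coproduct A F (zob A, \<lambda>i. Zer A (F i) (zob A))"
    unfolding is_coproduct_def
  proof (intro conjI allI ballI impI)
    fix T g assume T: "T \<in> Ob A" and g: "\<forall>i. g i \<in> Hom A (F i) T"
    show "\<exists>!h. h \<in> Hom A (fst (zob A, \<lambda>i. Zer A (F i) (zob A))) T \<and>
        (\<forall>i. h \<cdot>\<^bsub>A\<^esub> snd (zob A, \<lambda>i. Zer A (F i) (zob A)) i = g i)"
    proof (rule ex1I[of _ "Zer A (zob A) T"])
      show "Zer A (zob A) T \<in> Hom A (fst (zob A, \<lambda>i. Zer A (F i) (zob A))) T \<and>
        (\<forall>i. Zer A (zob A) T \<cdot>\<^bsub>A\<^esub> snd (zob A, \<lambda>i. Zer A (F i) (zob A)) i = g i)"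
        using T g empty by (auto simp: Hom_iff intro!: zero_object_unique)
    next
      fix h assume "h \<in> Hom A (fst (zob A, \<lambda>i. Zer A (F i) (zob A))) T \<and>
        (\<forall>i. h \<cdot>\<^bsub>A\<^esub> snd (zob A, \<lambda>i. Zer A (F i) (zob A)) i = g i)"
      then show "h = Zer A (zob A) T"
        using T by (intro zero_object_unique) (auto simp: Hom_iff)
    qed
  qed (use empty in \<open>auto simp: Hom_iff\<close>)
  then show ?case ..
next
  case (insert k S)
  define F' where "F' = F(k := zob A)"
  obtain D' where D': "is_coproduct A F' D'"
    using insert.IH[of F'] insert.prems unfolding F'_def
    by (metis fun_upd_apply insertE zero_object_ob zero_object_zob)
  obtain D where D: "is_coproduct A (\<lambda>b. if b then F k else fst D') D"
    using ex_dsum[of "fst D'" "F k"] D' insert.prems by (auto simp: is_coproduct_def)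
  have D'1: "fst D' \<in> Ob A" "\<And>i. snd D' i \<in> Hom A (F' i) (fst D')"
    and D'2: "\<And>T g. T \<in> Ob A \<Longrightarrow> (\<And>i. g i \<in> Hom A (F' i) T) \<Longrightarrow>
      \<exists>!h. h \<in> Hom A (fst D') T \<and> (\<forall>i. h \<cdot>\<^bsub>A\<^esub> snd D' i = g i)"
    using D' unfolding is_coproduct_def by auto
  have D1: "fst D \<in> Ob A" "snd D True \<in> Hom A (F k) (fst D)" "snd D False \<in> Hom A (fst D') (fst D)"
    and D2: "\<And>T g. T \<in> Ob A \<Longrightarrow> (\<And>b. g b \<in> Hom A (if b then F k else fst D') T) \<Longrightarrow>
      \<exists>!h. h \<in> Hom A (fst D) T \<and> (\<forall>b. h \<cdot>\<^bsub>A\<^esub> snd D b = g b)"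
    using D unfolding is_coproduct_def by auto (metis (full_types))+
  define I where "I = (\<lambda>i. if i = k then snd D True else snd D False \<cdot>\<^bsub>A\<^esub> snd D' i)"
  have I: "I i \<in> Hom A (F i) (fst D)" for i
    using D1 D'1(2)[of i] by (auto simp: I_def F'_def Hom_iff)
  have "is_coproduct A F (fst D, I)"
    unfolding is_coproduct_def
  proof (intro conjI allI ballI impI)
    fix T g assume T: "T \<in> Ob A" and g: "\<forall>i. g i \<in> Hom A (F i) T"
    \<comment> \<open>At the emptied index the source is a zero object, so the zero arrow is the
      only possible component.\<close>
    have g': "(if i = k then Zer A (zob A) T else g i) \<in> Hom A (F' i) T" for i
      using T g by (simp add: F'_def zer_hom)
    obtain h' where h': "h' \<in> Hom A (fst D') T"
      "\<And>i. h' \<cdot>\<^bsub>A\<^esub> snd D' i = (if i = k then Zer A (zob A) T else g i)"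
      using D'2[OF T g'] by blast
    have gb: "(if b then g k else h') \<in> Hom A (if b then F k else fst D') T" for b
      using g h' by auto
    obtain h where h0: "h \<in> Hom A (fst D) T" "\<And>b. h \<cdot>\<^bsub>A\<^esub> snd D b = (if b then g k else h')"
      using D2[OF T gb] by blast
    have h: "h \<in> Hom A (fst D) T" "h \<cdot>\<^bsub>A\<^esub> snd D True = g k" "h \<cdot>\<^bsub>A\<^esub> snd D False = h'"
      using h0(1) h0(2)[of True] h0(2)[of False] by simp_all
    show "\<exists>!h. h \<in> Hom A (fst (fst D, I)) T \<and> (\<forall>i. h \<cdot>\<^bsub>A\<^esub> snd (fst D, I) i = g i)"
    proof (rule ex1I[of _ h])
      have "h \<cdot>\<^bsub>A\<^esub> I i = g i" for i
      proof (cases "i = k")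
        case False
        then have "h \<cdot>\<^bsub>A\<^esub> I i = (h \<cdot>\<^bsub>A\<^esub> snd D False) \<cdot>\<^bsub>A\<^esub> snd D' i"
          using h(1) D1 D'1(2)[of i] by (simp add: I_def Hom_iff)
        then show ?thesis using h(3) h'(2)[of i] False by simp
      qed (simp add: I_def h)
      then show "h \<in> Hom A (fst (fst D, I)) T \<and> (\<forall>i. h \<cdot>\<^bsub>A\<^esub> snd (fst D, I) i = g i)"
        using h by simp
    next
      fix u assume "u \<in> Hom A (fst (fst D, I)) T \<and> (\<forall>i. u \<cdot>\<^bsub>A\<^esub> snd (fst D, I) i = g i)"
      then have u: "u \<in> Hom A (fst D) T" "\<And>i. u \<cdot>\<^bsub>A\<^esub> I i = g i" by auto
      have "(u \<cdot>\<^bsub>A\<^esub> snd D False) \<cdot>\<^bsub>A\<^esub> snd D' i = (if i = k then Zer A (zob A) T else g i)" for i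
      proof (cases "i = k")
        case True
        then show ?thesis using u(1) D1 D'1(2)[of i] T
          by (auto simp: F'_def Hom_iff intro!: zero_object_unique)
      next
        case False
        then show ?thesis using u(1) D1 D'1(2)[of i] u(2)[of i] by (simp add: I_def Hom_iff)
      qed
      moreover have "u \<cdot>\<^bsub>A\<^esub> snd D False \<in> Hom A (fst D') T" using u D1 by (simp add: Hom_iff)
      ultimately have "u \<cdot>\<^bsub>A\<^esub> snd D False = h'"
        using D'2[OF T g'] h' by blast
      moreover have "u \<cdot>\<^bsub>A\<^esub> snd D True = g k" using u(2)[of k] by (simp add: I_def)
      ultimately have "\<forall>b. u \<cdot>\<^bsub>A\<^esub> snd D b = (if b then g k else h')" by simp
      then show "u = h" using D2[OF T gb] u(1) h0 by blast
    qed
  qed (use D1 I in auto)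
  then show ?case ..
qed

lemma is_coproduct_coprod:
  assumes "fin_supp F"
  shows "is_coproduct A F (coprod A F)"
proof -
  have "\<exists>D. is_coproduct A F D"
    using assms by (intro ex_coproduct_aux[of "{i. \<not> zero_object A (F i)}"]) (auto simp: fin_supp_def)
  then show ?thesis unfolding coprod_def by (rule someI_ex)
qed

lemma fin_supp_ob [simp]: "fin_supp F \<Longrightarrow> F i \<in> Ob A"
  by (simp add: fin_supp_def)

lemma dsum_ob [simp]: "fin_supp F \<Longrightarrow> dsum A F \<in> Ob A"
  using is_coproduct_coprod[of F] by (simp add: is_coproduct_def dsum_def)

lemma incl_typing [simp]:
  assumes "fin_supp F"
  shows "incl A F i \<in> Ar A" "Dom A (incl A F i) = F i" "Cod A (incl A F i) = dsum A F"
  using is_coproduct_coprod[of F] assms by (simp_all add: is_coproduct_def dsum_def incl_def Hom_iff)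

lemma copair_ex1:
  assumes "fin_supp F" "T \<in> Ob A" "\<And>i. g i \<in> Hom A (F i) T"
  shows "\<exists>!h. h \<in> Hom A (dsum A F) T \<and> (\<forall>i. h \<cdot>\<^bsub>A\<^esub> incl A F i = g i)"
  using is_coproduct_coprod[OF assms(1)] assms unfolding is_coproduct_def dsum_def incl_def by blast

lemma copair_typing [simp]:
  assumes "fin_supp F" "T \<in> Ob A" "\<And>i. g i \<in> Hom A (F i) T"
  shows "copair A F T g \<in> Ar A" "Dom A (copair A F T g) = dsum A F" "Cod A (copair A F T g) = T"
  using theI'[OF copair_ex1[OF assms]] by (simp_all add: copair_def Hom_iff)

lemma copair_incl [simp]:
  assumes "fin_supp F" "T \<in> Ob A" "\<And>i. g i \<in> Hom A (F i) T"
  shows "copair A F T g \<cdot>\<^bsub>A\<^esub> incl A F i = g i"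
  using theI'[OF copair_ex1[OF assms]] by (simp add: copair_def)

lemma dsum_ext:
  assumes "fin_supp F" "h \<in> Ar A" "h' \<in> Ar A" "Dom A h = dsum A F" "Dom A h' = dsum A F"
    "Cod A h = Cod A h'" "\<And>i. h \<cdot>\<^bsub>A\<^esub> incl A F i = h' \<cdot>\<^bsub>A\<^esub> incl A F i"
  shows "h = h'"
  using copair_ex1[OF assms(1), of "Cod A h'" "\<lambda>i. h' \<cdot>\<^bsub>A\<^esub> incl A F i"] assms
  by (auto simp: Hom_iff)

text \<open>The sum is chosen as a coproduct only. Zero arrows between different summands supply the
  projections that make it a biproduct.\<close>

definition prj :: "('i \<Rightarrow> 'o) \<Rightarrow> 'i \<Rightarrow> 'm" where
  "prj F i = copair A F (F i) (\<lambda>j. if j = i then Idt A (F i) else Zer A (F j) (F i))"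

lemma prj_typing [simp]:
  assumes "fin_supp F"
  shows "prj F i \<in> Ar A" "Dom A (prj F i) = dsum A F" "Cod A (prj F i) = F i"
  using assms by (auto simp: prj_def Hom_iff)

lemma prj_incl:
  assumes "fin_supp F"
  shows "prj F i \<cdot>\<^bsub>A\<^esub> incl A F j = (if j = i then Idt A (F i) else Zer A (F j) (F i))"
  unfolding prj_def by (subst copair_incl) (auto simp: assms Hom_iff)

text \<open>After restriction to a summand with index in \<open>S\<close> only its own term
  survives; the other summands are zero objects. \<open>S\<close> may be any finite set containing
  the support.\<close>

lemma sum_incl_prj:
  assumes F: "fin_supp F" and S: "finite S" "\<And>i. i \<notin> S \<Longrightarrow> zero_object A (F i)"
  shows "hsum (dsum A F) (dsum A F) (\<lambda>i. incl A F i \<cdot>\<^bsub>A\<^esub> prj F i) S = Idt A (dsum A F)"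
    (is "?s = _")
proof (rule dsum_ext[OF F])
  fix j
  have hom: "incl A F i \<cdot>\<^bsub>A\<^esub> prj F i \<in> Hom A (dsum A F) (dsum A F)" for i
    using F by (simp add: Hom_iff)
  have "?s \<cdot>\<^bsub>A\<^esub> incl A F j = hsum (F j) (dsum A F) (\<lambda>i. (incl A F i \<cdot>\<^bsub>A\<^esub> prj F i) \<cdot>\<^bsub>A\<^esub> incl A F j) S"
    using hsum_cmp[OF S(1), of "dsum A F" "incl A F j" "dsum A F"] F hom by simp
  also have "\<dots> = incl A F j"
  proof (cases "j \<in> S")
    case True
    have "hsum (F j) (dsum A F) (\<lambda>i. (incl A F i \<cdot>\<^bsub>A\<^esub> prj F i) \<cdot>\<^bsub>A\<^esub> incl A F j) S =
        (incl A F j \<cdot>\<^bsub>A\<^esub> prj F j) \<cdot>\<^bsub>A\<^esub> incl A F j"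
      using S F True by (intro hsum_single) (auto simp: Hom_iff prj_incl)
    then show ?thesis using F by (simp add: prj_incl)
  next
    case False
    then show ?thesis using F S(2)[OF False] hom
      by (intro zero_object_unique) (auto simp: Hom_iff)
  qed
  finally show "?s \<cdot>\<^bsub>A\<^esub> incl A F j = Idt A (dsum A F) \<cdot>\<^bsub>A\<^esub> incl A F j" using F by simp
qed (use F in \<open>auto simp: Hom_iff\<close>)

end

section \<open>Factorizations in a localized category\<close>

lemma zigzag_append:
  "zigzag M W X l Y \<Longrightarrow> zigzag M W Y k Z \<Longrightarrow> zigzag M W X (l @ k) Z"
proof (induction l arbitrary: X)
  case (Cons a l)
  then show ?case by (cases a) auto
qed simp

text \<open>The zigzag hypothesis puts \<open>l\<close> into its own class by reflexivity; otherwise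
  both classes might be empty and their equality would carry no information.\<close>

lemma zzclass_eq_iff:
  assumes "zigzag C W X l Y"
  shows "zzclass C W X l Y = zzclass C W X l' Y \<longleftrightarrow> zzeq C W X Y l l'"
proof
  assume "zzclass C W X l Y = zzclass C W X l' Y"
  then have "{k. zzeq C W X Y l k} = {k. zzeq C W X Y l' k}"
    by (simp add: zzclass_def fun_eq_iff)
  then have "zzeq C W X Y l' l" using zzeq_refl[OF assms] by auto
  then show "zzeq C W X Y l l'" by (rule zzeq_sym)
next
  assume "zzeq C W X Y l l'"
  then have "zzeq C W X Y l k \<longleftrightarrow> zzeq C W X Y l' k" for k
    using zzeq_sym zzeq_trans by metis
  then show "zzclass C W X l Y = zzclass C W X l' Y" by (simp add: zzclass_def)
qed

lemma zzclass_cmp: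
  assumes l: "zigzag C W X l Y" and k: "zigzag C W Y k Z"
  shows "zzclass C W Y k Z \<cdot>\<^bsub>localization C W\<^esub> zzclass C W X l Y = zzclass C W X (l @ k) Z"
proof -
  have "(\<exists>x. zzeq C W X Y l x \<and> (\<exists>y. zzeq C W Y Z k y \<and> zzeq C W X Z (x @ y) j)) \<longleftrightarrow>
      zzeq C W X Z (l @ k) j" for j
    using zzeq_append zzeq_trans zzeq_refl[OF l] zzeq_refl[OF k] by metis
  then show ?thesis by (simp add: zzclass_def localization_def)
qed

lemma hom_localization:
  "\<beta> \<in> Hom (localization C W) X Y \<longleftrightarrow> (\<exists>l. zigzag C W X l Y \<and> \<beta> = zzclass C W X l Y)"
  by (auto simp: localization_def Hom_iff zzclass_def)

fun map_step :: "('m \<Rightarrow> 'n) \<Rightarrow> 'm step \<Rightarrow> 'n step" where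
  "map_step \<phi> (Fwd f) = Fwd (\<phi> f)"
| "map_step \<phi> (Bwd f) = Bwd (\<phi> f)"

text \<open>The formal content of the theorem: a functor preserving \<open>W\<close> with a natural
  transformation to the identity. Membership of \<open>e\<close> in \<open>W\<close> is asked only
  at the object \<open>K\<close> of \<open>ex1_lift\<close>.\<close>

locale augmented_functor = category M for M :: "('o, 'm) cat" (structure) +
  fixes W :: "'m set" and BO :: "'o \<Rightarrow> 'o" and BA :: "'m \<Rightarrow> 'm" and e :: "'o \<Rightarrow> 'm"
  assumes W_ar: "w \<in> W \<Longrightarrow> w \<in> Ar M"
    and B_hom: "f \<in> Hom M X Y \<Longrightarrow> BA f \<in> Hom M (BO X) (BO Y)"
    and B_idt: "X \<in> Ob M \<Longrightarrow> BA (Idt M X) = Idt M (BO X)"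
    and B_cmp: "\<lbrakk>f \<in> Hom M X Y; g \<in> Hom M Y Z\<rbrakk> \<Longrightarrow> BA (g \<cdot> f) = BA g \<cdot> BA f"
    and B_W: "w \<in> W \<Longrightarrow> BA w \<in> W"
    and e_hom: "X \<in> Ob M \<Longrightarrow> e X \<in> Hom M (BO X) X"
    and e_nat: "f \<in> Hom M X Y \<Longrightarrow> e Y \<cdot> BA f = f \<cdot> e X"
begin

lemma B_ob: "X \<in> Ob M \<Longrightarrow> BO X \<in> Ob M"
  using hom_obD[OF e_hom] by simp

lemma B_typing:
  assumes "f \<in> Ar M"
  shows "BA f \<in> Ar M" "Dom M (BA f) = BO (Dom M f)" "Cod M (BA f) = BO (Cod M f)"
  using B_hom[of f "Dom M f" "Cod M f"] assms by (auto simp: Hom_iff)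

lemma B_zigzag:
  "zigzag M W X l Y \<Longrightarrow> zigzag M W (BO X) (map (map_step BA) l) (BO Y)"
proof (induction l arbitrary: X)
  case Nil
  then show ?case by (auto intro: B_ob)
next
  case (Cons a l)
  then show ?case by (cases a) (auto simp: B_typing B_W)
qed

text \<open>Each generating relation goes to one of the same kind, because \<open>BA\<close> is
  functorial and preserves \<open>W\<close>. Hence \<open>BA\<close> acts on arrows of the
  localization.\<close>

lemma B_zzeq:
  "zzeq M W X Y l l' \<Longrightarrow> zzeq M W (BO X) (BO Y) (map (map_step BA) l) (map (map_step BA) l')"
proof (induction rule: zzeq.induct)
  case (zzeq_cmp f X Y g Z)
  then show ?case using zzeq.zzeq_cmp[OF B_hom B_hom, of f X Y g Z W] by (simp add: B_cmp)
next
  case (zzeq_inv_right w X Y)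
  then show ?case using zzeq.zzeq_inv_right[OF B_W B_hom] by simp
next
  case (zzeq_inv_left w X Y)
  then show ?case using zzeq.zzeq_inv_left[OF B_W B_hom] by simp
qed (auto simp: B_idt B_ob B_hom B_W B_zigzag intro: zzeq.intros)

lemma zzeq_fwd_cong:
  assumes "f \<in> Hom M X Y" "g \<in> Hom M Y Z" "f' \<in> Hom M X Y'" "g' \<in> Hom M Y' Z" "g \<cdot> f = g' \<cdot> f'"
  shows "zzeq M W X Z [Fwd f, Fwd g] [Fwd f', Fwd g']"
  using zzeq_cmp[OF assms(1,2), of W] zzeq_cmp[OF assms(3,4), of W] assms(5)
    zzeq_sym zzeq_trans by metis

text \<open>Naturality passes to the localization because a commuting square still commutes after
  two opposite sides have been inverted. The zigzag is processed one step at a time.\<close>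

lemma e_zigzag:
  "zigzag M W X l Y \<Longrightarrow>
    zzeq M W (BO X) Y (Fwd (e X) # l) (map (map_step BA) l @ [Fwd (e Y)])"
proof (induction l arbitrary: X)
  case Nil
  then show ?case using e_hom[of X] by (auto simp: Hom_iff intro!: zzeq_refl)
next
  case (Cons a l)
  show ?case
  proof (cases a)
    case (Fwd f)
    define Z where "Z = Cod M f"
    have f: "f \<in> Hom M X Z" and l: "zigzag M W Z l Y"
      using Cons.prems Fwd by (auto simp: Hom_iff Z_def)
    then have X: "X \<in> Ob M" and Z: "Z \<in> Ob M" by (auto simp: Hom_iff)
    have "zzeq M W (BO X) Z [Fwd (e X), Fwd f] [Fwd (BA f), Fwd (e Z)]"
      using zzeq_fwd_cong[OF e_hom[OF X] f B_hom[OF f] e_hom[OF Z]] e_nat[OF f] by simp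
    from zzeq_append[OF this zzeq_refl[OF l]]
    have "zzeq M W (BO X) Y (Fwd (e X) # Fwd f # l) (Fwd (BA f) # Fwd (e Z) # l)" by simp
    moreover
    have "zigzag M W (BO X) [Fwd (BA f)] (BO Z)" using B_hom[OF f] B_ob[OF Z] by (auto simp: Hom_iff)
    from zzeq_append[OF zzeq_refl[OF this] Cons.IH[OF l]]
    have "zzeq M W (BO X) Y (Fwd (BA f) # Fwd (e Z) # l)
        (Fwd (BA f) # map (map_step BA) l @ [Fwd (e Y)])" by simp
    ultimately show ?thesis using Fwd zzeq_trans by fastforce
  next
    \<comment> \<open>In diagrammatic order: put the inverse of \<open>BA f\<close> followed by
      \<open>BA f\<close> in front (\<open>3\<close> read backwards), replace \<open>BA f\<close>,
      \<open>e X\<close> by \<open>e Z\<close>, \<open>f\<close> (\<open>2\<close>), and cancel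
      \<open>f\<close> against its inverse (\<open>4\<close>).\<close>
    case (Bwd f)
    define Z where "Z = Dom M f"
    have f: "f \<in> Hom M Z X" and fW: "f \<in> W" and l: "zigzag M W Z l Y"
      using Cons.prems Bwd by (auto simp: Hom_iff Z_def)
    then have X: "X \<in> Ob M" and Z: "Z \<in> Ob M" by (auto simp: Hom_iff)
    have zB: "zigzag M W (BO X) [Bwd (BA f)] (BO Z)"
      using B_hom[OF f] B_W[OF fW] B_ob[OF Z] by (auto simp: Hom_iff)
    have ze: "zigzag M W (BO X) [Fwd (e X)] X" using e_hom[OF X] X by (auto simp: Hom_iff)
    have zf: "zigzag M W X [Bwd f] Z" using f fW by (auto simp: Hom_iff)
    have 1: "zzeq M W (BO Z) X [Fwd (e Z), Fwd f] [Fwd (BA f), Fwd (e X)]"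
      using zzeq_fwd_cong[OF e_hom[OF Z] f B_hom[OF f] e_hom[OF X]] e_nat[OF f] by simp
    have 2: "zzeq M W (BO X) Z ([Bwd (BA f)] @ [Fwd (BA f), Fwd (e X)] @ [Bwd f])
        ([Bwd (BA f)] @ [Fwd (e Z), Fwd f] @ [Bwd f])"
      using zzeq_append[OF zzeq_refl[OF zB] zzeq_append[OF zzeq_sym[OF 1] zzeq_refl[OF zf]]] .
    have 3: "zzeq M W (BO X) Z ([Bwd (BA f), Fwd (BA f)] @ [Fwd (e X), Bwd f]) ([] @ [Fwd (e X), Bwd f])"
      using zzeq_append[OF zzeq_inv_left[OF B_W[OF fW] B_hom[OF f]] zzeq_refl[OF zigzag_append[OF ze zf]]]
      by simp
    have "zigzag M W (BO X) [Bwd (BA f), Fwd (e Z)] Z"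
      using zB e_hom[OF Z] Z by (auto simp: Hom_iff)
    from zzeq_append[OF zzeq_refl[OF this] zzeq_inv_right[OF fW f]]
    have 4: "zzeq M W (BO X) Z ([Bwd (BA f), Fwd (e Z)] @ [Fwd f, Bwd f]) ([Bwd (BA f), Fwd (e Z)] @ [])" .
    have "zzeq M W (BO X) Z [Fwd (e X), Bwd f] [Bwd (BA f), Fwd (e Z)]"
      using zzeq_trans[OF zzeq_trans[OF zzeq_sym[OF 3[simplified]] 2[simplified]] 4[simplified]] .
    from zzeq_append[OF this zzeq_refl[OF l]]
    have "zzeq M W (BO X) Y (Fwd (e X) # Bwd f # l) (Bwd (BA f) # Fwd (e Z) # l)" by simp
    moreover
    from zzeq_append[OF zzeq_refl[OF zB] Cons.IH[OF l]]
    have "zzeq M W (BO X) Y (Bwd (BA f) # Fwd (e Z) # l)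
        (Bwd (BA f) # map (map_step BA) l @ [Fwd (e Y)])" by simp
    ultimately show ?thesis using Bwd zzeq_trans by fastforce
  qed
qed

theorem ex1_lift:
  assumes K: "K \<in> Ob M" "e K \<in> W" and s: "s \<in> Hom M L N" "BA s \<in> W" and a: "\<alpha> \<in> Hom M K N"
  shows "\<exists>!\<beta>. \<beta> \<in> Hom (localization M W) K L \<and>
    loc M W \<alpha> = loc M W s \<cdot>\<^bsub>localization M W\<^esub> \<beta>"
proof -
  have obs: "L \<in> Ob M" "N \<in> Ob M" using s by (auto simp: Hom_iff)
  have eK: "e K \<in> Hom M (BO K) K" and eL: "e L \<in> Hom M (BO L) L" and eN: "e N \<in> Hom M (BO N) N"
    using e_hom K obs by auto
  have Bs: "BA s \<in> Hom M (BO L) (BO N)" and Ba: "BA \<alpha> \<in> Hom M (BO K) (BO N)"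
    using B_hom s a by auto
  have zs: "zigzag M W L [Fwd s] N" and za: "zigzag M W K [Fwd \<alpha>] N"
    using s a by (auto simp: Hom_iff)
  have loc: "loc M W s = zzclass M W L [Fwd s] N" "loc M W \<alpha> = zzclass M W K [Fwd \<alpha>] N"
    using s a by (auto simp: loc_def Hom_iff)
  \<comment> \<open>Zigzags are in diagrammatic order, so the list begins with the factor applied
    first.\<close>
  define l0 where "l0 = [Bwd (e K), Fwd (BA \<alpha>), Bwd (BA s), Fwd (e L)]"
  have z1: "zigzag M W K [Bwd (e K)] (BO K)" using eK K B_ob by (auto simp: Hom_iff)
  have z2: "zigzag M W (BO K) [Fwd (BA \<alpha>)] (BO N)" using Ba obs B_ob by (auto simp: Hom_iff)
  have z3: "zigzag M W (BO N) [Bwd (BA s)] (BO L)" using Bs s obs B_ob by (auto simp: Hom_iff)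
  have z4: "zigzag M W (BO L) [Fwd (e L)] L" using eL obs by (auto simp: Hom_iff)
  have z0: "zigzag M W K l0 L"
    using zigzag_append[OF z1 zigzag_append[OF z2 zigzag_append[OF z3 z4]]] by (simp add: l0_def obs)
  have "zzeq M W K N (l0 @ [Fwd s]) [Fwd \<alpha>]"
  proof -
    have 1: "zzeq M W (BO L) N [Fwd (e L), Fwd s] [Fwd (BA s), Fwd (e N)]"
      using zzeq_fwd_cong[OF eL s(1) Bs eN] e_nat[OF s(1)] by simp
    have 2: "zzeq M W (BO K) N [Fwd (BA \<alpha>), Fwd (e N)] [Fwd (e K), Fwd \<alpha>]"
      using zzeq_fwd_cong[OF Ba eN eK a] e_nat[OF a] by (simp add: obs B_ob)
    have z123: "zigzag M W K [Bwd (e K), Fwd (BA \<alpha>), Bwd (BA s)] (BO L)"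
      using zigzag_append[OF z1 zigzag_append[OF z2 z3]] by (simp add: obs B_ob)
    have z12: "zigzag M W K [Bwd (e K), Fwd (BA \<alpha>)] (BO N)"
      using zigzag_append[OF z1 z2] by (simp add: obs B_ob)
    have zN: "zigzag M W (BO N) [Fwd (e N)] N" using eN obs by (auto simp: Hom_iff)
    have "zzeq M W K N (l0 @ [Fwd s]) [Bwd (e K), Fwd (BA \<alpha>), Bwd (BA s), Fwd (BA s), Fwd (e N)]"
      using zzeq_append[OF zzeq_refl[OF z123] 1] by (simp add: l0_def)
    moreover have "zzeq M W K N [Bwd (e K), Fwd (BA \<alpha>), Bwd (BA s), Fwd (BA s), Fwd (e N)]
        [Bwd (e K), Fwd (BA \<alpha>), Fwd (e N)]"
      using zzeq_append[OF zzeq_refl[OF z12]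
          zzeq_append[OF zzeq_inv_left[OF s(2) Bs] zzeq_refl[OF zN]]] by simp
    moreover have "zzeq M W K N [Bwd (e K), Fwd (BA \<alpha>), Fwd (e N)] [Bwd (e K), Fwd (e K), Fwd \<alpha>]"
      using zzeq_append[OF zzeq_refl[OF z1] 2] by simp
    moreover have "zzeq M W K N [Bwd (e K), Fwd (e K), Fwd \<alpha>] [Fwd \<alpha>]"
      using zzeq_append[OF zzeq_inv_left[OF K(2) eK] zzeq_refl[OF za]] by simp
    ultimately show ?thesis using zzeq_trans by metis
  qed
  then have ex: "loc M W \<alpha> = loc M W s \<cdot>\<^bsub>localization M W\<^esub> zzclass M W K l0 L"
    using zzclass_cmp[OF z0 zs] zzclass_eq_iff[OF za] zzeq_sym loc by metis
  have uniq: "\<beta> = zzclass M W K l0 L"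
    if b: "\<beta> \<in> Hom (localization M W) K L" "loc M W \<alpha> = loc M W s \<cdot>\<^bsub>localization M W\<^esub> \<beta>" for \<beta>
  proof -
    obtain l where l: "zigzag M W K l L" "\<beta> = zzclass M W K l L"
      using b(1) by (auto simp: hom_localization)
    let ?B = "map (map_step BA)"
    have zl: "zigzag M W (BO K) (?B l) (BO L)" using B_zigzag[OF l(1)] .
    \<comment> \<open>Equality of classes is turned into a relation between representatives, because
      \<open>BA\<close> acts on zigzags. Cancelling \<open>BA s\<close> then determines the image of
      \<open>l\<close> up to the relation, whatever \<open>l\<close> is.\<close>
    have "zzeq M W K N (l @ [Fwd s]) [Fwd \<alpha>]"
      using b(2) zzclass_cmp[OF l(1) zs] zzclass_eq_iff[OF za] zzeq_sym loc l(2) by metis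
    from B_zzeq[OF this] have 1: "zzeq M W (BO K) (BO N) (?B l @ [Fwd (BA s)]) [Fwd (BA \<alpha>)]" by simp
    have "zzeq M W (BO K) (BO L) (?B l @ [Fwd (BA s), Bwd (BA s)]) [Fwd (BA \<alpha>), Bwd (BA s)]"
      using zzeq_append[OF 1 zzeq_refl[OF z3]] by simp
    moreover have "zzeq M W (BO K) (BO L) (?B l @ [Fwd (BA s), Bwd (BA s)]) (?B l)"
      using zzeq_append[OF zzeq_refl[OF zl] zzeq_inv_right[OF s(2) Bs]] by simp
    ultimately have 2: "zzeq M W (BO K) (BO L) (?B l) [Fwd (BA \<alpha>), Bwd (BA s)]"
      using zzeq_sym zzeq_trans by metis
    have 3: "zzeq M W (BO K) L (Fwd (e K) # l) [Fwd (BA \<alpha>), Bwd (BA s), Fwd (e L)]"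
      using zzeq_trans[OF e_zigzag[OF l(1)] zzeq_append[OF 2 zzeq_refl[OF z4]]] by simp
    have 4: "zzeq M W K L (Bwd (e K) # Fwd (e K) # l) l0"
      using zzeq_append[OF zzeq_refl[OF z1] 3] by (simp add: l0_def)
    have "zzeq M W K L (Bwd (e K) # Fwd (e K) # l) l"
      using zzeq_append[OF zzeq_inv_left[OF K(2) eK] zzeq_refl[OF l(1)]] by simp
    then have "zzeq M W K L l l0" using 4 zzeq_sym zzeq_trans by metis
    then show ?thesis using zzclass_eq_iff[OF l(1)] l(2) by simp
  qed
  have "zzclass M W K l0 L \<in> Hom (localization M W) K L" using z0 by (auto simp: hom_localization)
  then show ?thesis using ex uniq by blast
qed

end

section \<open>The standard construction of a cotriple\<close>

lemma funpow_shift: "(h ^^ n) (h x) = h ((h ^^ n) x)"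
  by (simp add: funpow_swap1)

lemma funpow_collect: "(h ^^ m) ((h ^^ n) x) = (h ^^ (m + n)) x"
  by (simp add: funpow_add)

context cotriple
begin

section \<open>Powers of the functor underlying a cotriple\<close>

lemma G_ob: "X \<in> Ob M \<Longrightarrow> FO G X \<in> Ob M"
  using G_functor by (simp add: is_functor_def)

lemma G_pow_ob: "X \<in> Ob M \<Longrightarrow> (FO G ^^ n) X \<in> Ob M"
  by (induction n) (auto simp: G_ob)

lemma G_hom: "f \<in> Hom M X Y \<Longrightarrow> FA G f \<in> Hom M (FO G X) (FO G Y)"
  using G_functor unfolding is_functor_def by blast

lemma G_pow_hom: "f \<in> Hom M X Y \<Longrightarrow> (FA G ^^ n) f \<in> Hom M ((FO G ^^ n) X) ((FO G ^^ n) Y)"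
  by (induction n) (auto simp: G_hom)

lemma G_cmp: "\<lbrakk>f \<in> Hom M X Y; g \<in> Hom M Y Z\<rbrakk> \<Longrightarrow> FA G (g \<cdot> f) = FA G g \<cdot> FA G f"
  using G_functor unfolding is_functor_def by blast

lemma G_pow_cmp:
  assumes "f \<in> Hom M X Y" "g \<in> Hom M Y Z"
  shows "(FA G ^^ n) (g \<cdot> f) = (FA G ^^ n) g \<cdot> (FA G ^^ n) f"
proof (induction n)
  case (Suc n)
  then show ?case using G_cmp[OF G_pow_hom[OF assms(1)] G_pow_hom[OF assms(2)], of n] by simp
qed simp

lemma G_pow_idt: "X \<in> Ob M \<Longrightarrow> (FA G ^^ n) (Idt M X) = Idt M ((FO G ^^ n) X)"
  by (induction n) (use G_functor in \<open>auto simp: is_functor_def G_pow_ob\<close>)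

lemma pow_square:
  assumes "f \<in> Hom M W X" "g \<in> Hom M X Z" "f' \<in> Hom M W Y" "g' \<in> Hom M Y Z" "g \<cdot> f = g' \<cdot> f'"
  shows "(FA G ^^ i) g \<cdot> (FA G ^^ i) f = (FA G ^^ i) g' \<cdot> (FA G ^^ i) f'"
  using G_pow_cmp[OF assms(1,2)] G_pow_cmp[OF assms(3,4)] assms(5) by metis

lemma standard_construction_simps [simp]:
  "SO (standard_construction G K) n = (FO G ^^ Suc n) K"
  "Fac (standard_construction G K) n i = (FA G ^^ i) (Eps G ((FO G ^^ (n - i)) K))"
  "Deg (standard_construction G K) n i = (FA G ^^ i) (Del G ((FO G ^^ (n - i)) K))"
  by (simp_all add: standard_construction_def)

lemma pow_eps_hom: "X \<in> Ob M \<Longrightarrow> (FA G ^^ i) (Eps G X) \<in> Hom M ((FO G ^^ Suc i) X) ((FO G ^^ i) X)"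
  using G_pow_hom[OF eps_hom, of X i] by (simp add: funpow_shift)

lemma pow_del_hom: "X \<in> Ob M \<Longrightarrow> (FA G ^^ i) (Del G X) \<in> Hom M ((FO G ^^ Suc i) X) ((FO G ^^ Suc (Suc i)) X)"
  using G_pow_hom[OF del_hom, of X i] by (simp add: funpow_shift)

lemma eps_hom_pow: "X \<in> Ob M \<Longrightarrow> Eps G ((FO G ^^ i) X) \<in> Hom M ((FO G ^^ Suc i) X) ((FO G ^^ i) X)"
  using eps_hom[OF G_pow_ob, of X i] by simp

lemma del_hom_pow: "X \<in> Ob M \<Longrightarrow> Del G ((FO G ^^ i) X) \<in> Hom M ((FO G ^^ Suc i) X) ((FO G ^^ Suc (Suc i)) X)"
  using del_hom[OF G_pow_ob, of X i] by simp

text \<open>The simplicial identities are reduced, by stripping the powers of \<open>G\<close> common to both sides,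
  to the naturality and comonad laws below.\<close>

lemma eps_eps:
  assumes "Z \<in> Ob M"
  shows "Eps G ((FO G ^^ d) Z) \<cdot> (FA G ^^ Suc d) (Eps G Z) = (FA G ^^ d) (Eps G Z) \<cdot> Eps G ((FO G ^^ Suc d) Z)"
  using eps_nat[OF pow_eps_hom[OF assms, of d]] by simp

lemma del_del:
  assumes "Z \<in> Ob M"
  shows "Del G ((FO G ^^ Suc d) Z) \<cdot> (FA G ^^ d) (Del G Z) = (FA G ^^ Suc d) (Del G Z) \<cdot> Del G ((FO G ^^ d) Z)"
\<comment> \<open>Adjacent positions need coassociativity. With \<open>d = Suc e\<close> the inner
  arrow lies in the image of \<open>FA G\<close>, and naturality of \<open>Del\<close>
  applies.\<close>
proof (cases d)
  case 0
  then show ?thesis using coassoc[OF assms] by simp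
next
  case (Suc e)
  then show ?thesis using del_nat[OF pow_del_hom[OF assms, of e]] by simp
qed

lemma eps_del:
  assumes "Z \<in> Ob M"
  shows "Eps G ((FO G ^^ Suc (Suc d)) Z) \<cdot> (FA G ^^ Suc d) (Del G Z) = (FA G ^^ d) (Del G Z) \<cdot> Eps G ((FO G ^^ Suc d) Z)"
  using eps_nat[OF pow_del_hom[OF assms, of d]] by simp

lemma del_eps:
  assumes "Z \<in> Ob M"
  shows "(FA G ^^ Suc (Suc d)) (Eps G Z) \<cdot> Del G ((FO G ^^ Suc d) Z) = Del G ((FO G ^^ d) Z) \<cdot> (FA G ^^ Suc d) (Eps G Z)"
  using del_nat[OF pow_eps_hom[OF assms, of d]] by simp

lemma simplicial_object_standard_construction:
  assumes K: "K \<in> Ob M"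
  shows "simplicial_object M (standard_construction G K)"
  unfolding simplicial_object_def standard_construction_simps
proof (intro conjI allI impI)
  note ob = G_pow_ob[OF K]
  fix n
  show "(FO G ^^ Suc n) K \<in> Ob M" by (rule ob)
next
  note ob = G_pow_ob[OF K]
  fix n i :: nat assume "i \<le> Suc n"
  then show "(FA G ^^ i) (Eps G ((FO G ^^ (Suc n - i)) K)) \<in> Hom M ((FO G ^^ Suc (Suc n)) K) ((FO G ^^ Suc n) K)"
    using pow_eps_hom[OF ob, of i "Suc n - i"] by (simp add: funpow_collect flip: funpow.simps)
next
  note ob = G_pow_ob[OF K]
  fix n i :: nat assume "i \<le> n"
  then show "(FA G ^^ i) (Del G ((FO G ^^ (n - i)) K)) \<in> Hom M ((FO G ^^ Suc n) K) ((FO G ^^ Suc (Suc n)) K)"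
    using pow_del_hom[OF ob, of i "n - i"] by (simp add: funpow_collect flip: funpow.simps)
next
  note ob = G_pow_ob[OF K]
  fix n i j :: nat assume ij: "i < j \<and> j \<le> Suc (Suc n)"
  \<comment> \<open>\<open>d\<close> measures the gap between the two positions and \<open>m\<close>
    counts the copies of \<open>G\<close> inside both. After stripping the power \<open>i\<close> of
    \<open>G\<close> the identity becomes \<open>eps_eps\<close> at \<open>Z\<close>; the other
    exchange identities below follow the same pattern.\<close>
  define d where "d = j - Suc i"
  define m where "m = Suc (Suc n) - j"
  define Z where "Z = (FO G ^^ m) K"
  have Z: "Z \<in> Ob M" by (simp add: Z_def ob)
  have k: "Suc n - i = d + m" "Suc (Suc n) - i = Suc d + m" "Suc n - (j - 1) = m" "j = i + Suc d" "j - 1 = i + d"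
    using ij unfolding d_def m_def by linarith+
  have e: "(FO G ^^ (Suc n - i)) K = (FO G ^^ d) Z" "(FO G ^^ (Suc (Suc n) - i)) K = (FO G ^^ Suc d) Z"
    "(FO G ^^ (Suc n - (j - 1))) K = Z" "j = i + Suc d" "j - 1 = i + d" "(FO G ^^ (Suc (Suc n) - j)) K = Z"
    by (simp_all only: k(1-3) Z_def funpow_collect) (simp_all only: k(4,5) m_def)
  show "(FA G ^^ i) (Eps G ((FO G ^^ (Suc n - i)) K)) \<cdot> (FA G ^^ j) (Eps G ((FO G ^^ (Suc (Suc n) - j)) K)) =
    (FA G ^^ (j - 1)) (Eps G ((FO G ^^ (Suc n - (j - 1))) K)) \<cdot> (FA G ^^ i) (Eps G ((FO G ^^ (Suc (Suc n) - i)) K))"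
    \<comment> \<open>The order matters: rewriting \<open>j\<close> first would also hit the
      \<open>j\<close> inside \<open>j - 1\<close>.\<close>
    unfolding e(1-3,6) unfolding e(5) unfolding e(4) funpow_collect[symmetric]
    using pow_square[OF _ _ _ _ eps_eps[OF Z, of d], of "(FO G ^^ Suc (Suc d)) Z" "(FO G ^^ Suc d) Z"
        "(FO G ^^ d) Z" "(FO G ^^ Suc d) Z" i]
      pow_eps_hom[OF Z] eps_hom_pow[OF Z] by blast
next
  note ob = G_pow_ob[OF K]
  fix n i j :: nat assume ij: "i \<le> j \<and> j \<le> n"
  define d where "d = j - i"
  define m where "m = n - j"
  define Z where "Z = (FO G ^^ m) K"
  have Z: "Z \<in> Ob M" by (simp add: Z_def ob)
  have k: "Suc n - i = Suc d + m" "n - i = d + m" "Suc n - Suc j = m" "j = i + d" "Suc j = i + Suc d"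
    using ij unfolding d_def m_def by linarith+
  have e: "(FO G ^^ (Suc n - i)) K = (FO G ^^ Suc d) Z" "(FO G ^^ (n - i)) K = (FO G ^^ d) Z"
    "(FO G ^^ (Suc n - Suc j)) K = Z" "j = i + d" "Suc j = i + Suc d" "(FO G ^^ (n - j)) K = Z"
    by (simp_all only: k(1-3) Z_def funpow_collect) (simp_all only: k(4,5) m_def)
  show "(FA G ^^ i) (Del G ((FO G ^^ (Suc n - i)) K)) \<cdot> (FA G ^^ j) (Del G ((FO G ^^ (n - j)) K)) =
    (FA G ^^ Suc j) (Del G ((FO G ^^ (Suc n - Suc j)) K)) \<cdot> (FA G ^^ i) (Del G ((FO G ^^ (n - i)) K))"
    unfolding e(1-3,6) unfolding e(5) unfolding e(4) funpow_collect[symmetric]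
    using pow_square[OF _ _ _ _ del_del[OF Z, of d], of "(FO G ^^ Suc d) Z" "(FO G ^^ Suc (Suc d)) Z"
        "(FO G ^^ Suc (Suc (Suc d))) Z" "(FO G ^^ Suc (Suc d)) Z" i]
      pow_del_hom[OF Z] del_hom_pow[OF Z] by blast
next
  note ob = G_pow_ob[OF K]
  fix n i j :: nat assume ij: "i < j \<and> j \<le> n"
  define d where "d = j - Suc i"
  define m where "m = n - j"
  define Z where "Z = (FO G ^^ m) K"
  have Z: "Z \<in> Ob M" by (simp add: Z_def ob)
  have k: "Suc n - i = Suc (Suc d) + m" "n - i = Suc d + m" "n - 1 - (j - 1) = m" "j = i + Suc d" "j - 1 = i + d"
    using ij unfolding d_def m_def by linarith+
  have e: "(FO G ^^ (Suc n - i)) K = (FO G ^^ Suc (Suc d)) Z" "(FO G ^^ (n - i)) K = (FO G ^^ Suc d) Z"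
    "(FO G ^^ (n - 1 - (j - 1))) K = Z" "j = i + Suc d" "j - 1 = i + d" "(FO G ^^ (n - j)) K = Z"
    by (simp_all only: k(1-3) Z_def funpow_collect) (simp_all only: k(4,5) m_def)
  show "(FA G ^^ i) (Eps G ((FO G ^^ (Suc n - i)) K)) \<cdot> (FA G ^^ j) (Del G ((FO G ^^ (n - j)) K)) =
    (FA G ^^ (j - 1)) (Del G ((FO G ^^ (n - 1 - (j - 1))) K)) \<cdot> (FA G ^^ i) (Eps G ((FO G ^^ (n - i)) K))"
    unfolding e(1-3,6) unfolding e(5) unfolding e(4) funpow_collect[symmetric]
    using pow_square[OF _ _ _ _ eps_del[OF Z, of d], of "(FO G ^^ Suc (Suc d)) Z" "(FO G ^^ Suc (Suc (Suc d))) Z"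
        "(FO G ^^ Suc (Suc d)) Z" "(FO G ^^ Suc d) Z" i]
      pow_del_hom[OF Z] eps_hom_pow[OF Z] by blast
next
  note ob = G_pow_ob[OF K]
  fix n j :: nat assume j: "j \<le> n"
  \<comment> \<open>Here face and degeneracy cancel. Under \<open>j\<close> copies of
    \<open>G\<close>, face \<open>j\<close> gives \<open>counit_left\<close> at \<open>Z\<close> and
    face \<open>Suc j\<close> gives \<open>counit_right\<close>.\<close>
  define Z where "Z = (FO G ^^ (n - j)) K"
  have Z: "Z \<in> Ob M" by (simp add: Z_def ob)
  have e: "(FO G ^^ (Suc n - j)) K = FO G Z" "(FO G ^^ Suc n) K = (FO G ^^ j) (FO G Z)"
    unfolding Z_def funpow_shift funpow_collect using j by (auto simp: Suc_diff_le)
  have h: "Eps G (FO G Z) \<in> Hom M (FO G (FO G Z)) (FO G Z)" "FA G (Eps G Z) \<in> Hom M (FO G (FO G Z)) (FO G Z)"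
    using eps_hom[OF G_ob[OF Z]] G_hom[OF eps_hom[OF Z]] by auto
  show "(FA G ^^ j) (Eps G ((FO G ^^ (Suc n - j)) K)) \<cdot> (FA G ^^ j) (Del G ((FO G ^^ (n - j)) K)) =
    Idt M ((FO G ^^ Suc n) K)"
    unfolding e Z_def[symmetric] using G_pow_cmp[OF del_hom[OF Z] h(1), of j] counit_left[OF Z]
      G_pow_idt[OF G_ob[OF Z]] by simp
  have s: "Suc n - Suc j = n - j" "Suc j = j + 1" by simp_all
  show "(FA G ^^ Suc j) (Eps G ((FO G ^^ (Suc n - Suc j)) K)) \<cdot> (FA G ^^ j) (Del G ((FO G ^^ (n - j)) K)) =
    Idt M ((FO G ^^ Suc n) K)"
    unfolding e s(1) Z_def[symmetric] unfolding s(2) funpow_collect[symmetric]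
    using G_pow_cmp[OF del_hom[OF Z] h(2), of j] counit_right[OF Z] G_pow_idt[OF G_ob[OF Z]] by simp
next
  note ob = G_pow_ob[OF K]
  fix n i j :: nat assume ij: "Suc j < i \<and> i \<le> Suc n"
  define d where "d = i - Suc (Suc j)"
  define m where "m = Suc n - i"
  define Z where "Z = (FO G ^^ m) K"
  have Z: "Z \<in> Ob M" by (simp add: Z_def ob)
  have k: "n - j = Suc d + m" "n - 1 - j = d + m" "n - (i - 1) = m" "i = j + Suc (Suc d)" "i - 1 = j + Suc d"
    using ij unfolding d_def m_def by linarith+
  have e: "(FO G ^^ (n - j)) K = (FO G ^^ Suc d) Z" "(FO G ^^ (n - 1 - j)) K = (FO G ^^ d) Z"
    "(FO G ^^ (n - (i - 1))) K = Z" "i = j + Suc (Suc d)" "i - 1 = j + Suc d" "(FO G ^^ (Suc n - i)) K = Z"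
    by (simp_all only: k(1-3) Z_def funpow_collect) (simp_all only: k(4,5) m_def)
  show "(FA G ^^ i) (Eps G ((FO G ^^ (Suc n - i)) K)) \<cdot> (FA G ^^ j) (Del G ((FO G ^^ (n - j)) K)) =
    (FA G ^^ j) (Del G ((FO G ^^ (n - 1 - j)) K)) \<cdot> (FA G ^^ (i - 1)) (Eps G ((FO G ^^ (n - (i - 1))) K))"
    unfolding e(1-3,6) unfolding e(5) unfolding e(4) funpow_collect[symmetric]
    using pow_square[OF _ _ _ _ del_eps[OF Z, of d], of "(FO G ^^ Suc (Suc d)) Z" "(FO G ^^ Suc (Suc (Suc d))) Z"
        "(FO G ^^ Suc (Suc d)) Z" "(FO G ^^ Suc d) Z" j]
      pow_eps_hom[OF Z] del_hom_pow[OF Z] by blast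
qed

text \<open>Faces and degeneracies are a power of \<open>G\<close> applied to \<open>Eps\<close> or
  \<open>Del\<close> at an iterated value, so each square is that power of a naturality square at an
  iterate of \<open>f\<close>.\<close>

lemma simplicial_map_standard_construction:
  assumes f: "f \<in> Hom M K L"
  shows "simplicial_map M (standard_construction G K) (standard_construction G L) (\<lambda>n. (FA G ^^ Suc n) f)"
  unfolding simplicial_map_def standard_construction_simps
proof (intro conjI allI impI)
  fix n show "(FA G ^^ Suc n) f \<in> Hom M ((FO G ^^ Suc n) K) ((FO G ^^ Suc n) L)"
    by (rule G_pow_hom[OF f])
next
  fix n i :: nat assume i: "i \<le> Suc n"
  define d where "d = Suc n - i"
  have e: "Suc n = i + d" "Suc (Suc n) = i + Suc d" using i by (simp_all add: d_def)
  have ob: "K \<in> Ob M" "L \<in> Ob M" using hom_obD[OF f] by auto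
  have eq: "(FA G ^^ d) f \<cdot> Eps G ((FO G ^^ d) K) = Eps G ((FO G ^^ d) L) \<cdot> (FA G ^^ Suc d) f"
    using eps_nat[OF G_pow_hom[OF f], of d] by simp
  show "(FA G ^^ Suc n) f \<cdot> (FA G ^^ i) (Eps G ((FO G ^^ (Suc n - i)) K)) =
      (FA G ^^ i) (Eps G ((FO G ^^ (Suc n - i)) L)) \<cdot> (FA G ^^ Suc (Suc n)) f"
    unfolding d_def[symmetric] e(2) unfolding e(1) funpow_collect[symmetric]
    by (rule pow_square[OF eps_hom_pow[OF ob(1)] G_pow_hom[OF f] G_pow_hom[OF f] eps_hom_pow[OF ob(2)] eq])
next
  fix n i :: nat assume i: "i \<le> n"
  define d where "d = n - i"
  have e: "Suc (Suc n) = i + Suc (Suc d)" "Suc n = i + Suc d" using i by (simp_all add: d_def)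
  have ob: "K \<in> Ob M" "L \<in> Ob M" using hom_obD[OF f] by auto
  have eq: "(FA G ^^ Suc (Suc d)) f \<cdot> Del G ((FO G ^^ d) K) = Del G ((FO G ^^ d) L) \<cdot> (FA G ^^ Suc d) f"
    using del_nat[OF G_pow_hom[OF f], of d] by simp
  show "(FA G ^^ Suc (Suc n)) f \<cdot> (FA G ^^ i) (Del G ((FO G ^^ (n - i)) K)) =
      (FA G ^^ i) (Del G ((FO G ^^ (n - i)) L)) \<cdot> (FA G ^^ Suc n) f"
    unfolding d_def[symmetric] e(1) unfolding e(2) funpow_collect[symmetric]
    by (rule pow_square[OF del_hom_pow[OF ob(1)] G_pow_hom[OF f] G_pow_hom[OF f] del_hom_pow[OF ob(2)] eq])
qed

end

section \<open>Biadditive tensor products\<close>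

context abelian_monoidal_category
begin

lemma TO_ob [simp]: "\<lbrakk>X \<in> Ob A; Y \<in> Ob A\<rbrakk> \<Longrightarrow> TO U X Y \<in> Ob A"
  by (rule tensor_ob)

lemma Unt_ob [simp]: "Unt U \<in> Ob A"
  by (rule unit_ob)

lemma TA_typing [simp]:
  assumes "f \<in> Ar A" "g \<in> Ar A"
  shows "TA U f g \<in> Ar A" "Dom A (TA U f g) = TO U (Dom A f) (Dom A g)"
    "Cod A (TA U f g) = TO U (Cod A f) (Cod A g)"
  using tensor_hom[of f "Dom A f" "Cod A f" g "Dom A g" "Cod A g"] assms by (auto simp: Hom_iff)

lemma TA_idt [simp]: "\<lbrakk>X \<in> Ob A; Y \<in> Ob A\<rbrakk> \<Longrightarrow> TA U (Idt A X) (Idt A Y) = Idt A (TO U X Y)"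
  by (rule tensor_idt)

lemma TA_cmp [simp]:
  assumes "f \<in> Ar A" "f' \<in> Ar A" "g \<in> Ar A" "g' \<in> Ar A" "Cod A f = Dom A f'" "Cod A g = Dom A g'"
  shows "TA U f' g' \<cdot>\<^bsub>A\<^esub> TA U f g = TA U (f' \<cdot>\<^bsub>A\<^esub> f) (g' \<cdot>\<^bsub>A\<^esub> g)"
  using assms by (intro tensor_cmp[symmetric]) (auto simp: Hom_iff)

lemma TA_cmp_sub [simp]:
  assumes "f \<in> Ar A" "f' \<in> Ar A" "g \<in> Ar A" "g' \<in> Ar A" "Cod A f = Dom A f'" "Cod A g = Dom A g'"
    "t \<in> Ar A" "Cod A t = TO U (Dom A f) (Dom A g)"
  shows "TA U f' g' \<cdot>\<^bsub>A\<^esub> (TA U f g \<cdot>\<^bsub>A\<^esub> t) = TA U (f' \<cdot>\<^bsub>A\<^esub> f) (g' \<cdot>\<^bsub>A\<^esub> g) \<cdot>\<^bsub>A\<^esub> t"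
  using assms by (intro cmp_sub) auto

lemma TA_plus_left:
  assumes "f \<in> Ar A" "f' \<in> Ar A" "Dom A f = Dom A f'" "Cod A f = Cod A f'" "g \<in> Ar A"
  shows "TA U (Plus A f f') g = Plus A (TA U f g) (TA U f' g)"
  using assms by (intro tensor_plus_left) (auto simp: Hom_iff)

lemma TA_plus_right:
  assumes "f \<in> Ar A" "g \<in> Ar A" "g' \<in> Ar A" "Dom A g = Dom A g'" "Cod A g = Cod A g'"
  shows "TA U f (Plus A g g') = Plus A (TA U f g) (TA U f g')"
  using assms by (intro tensor_plus_right) (auto simp: Hom_iff)

lemma TA_zer_left [simp]:
  assumes "X \<in> Ob A" "X' \<in> Ob A" "g \<in> Ar A"
  shows "TA U (Zer A X X') g = Zer A (TO U X (Dom A g)) (TO U X' (Cod A g))"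
proof -
  have "Plus A (TA U (Zer A X X') g) (TA U (Zer A X X') g) = TA U (Plus A (Zer A X X') (Zer A X X')) g"
    using assms by (intro TA_plus_left[symmetric]) auto
  also have "\<dots> = TA U (Zer A X X') g" using assms by (subst plus_zer_left) auto
  finally show ?thesis using assms by (auto dest!: plus_cancel)
qed

lemma TA_zer_right [simp]:
  assumes "X \<in> Ob A" "X' \<in> Ob A" "g \<in> Ar A"
  shows "TA U g (Zer A X X') = Zer A (TO U (Dom A g) X) (TO U (Cod A g) X')"
proof -
  have "Plus A (TA U g (Zer A X X')) (TA U g (Zer A X X')) = TA U g (Plus A (Zer A X X') (Zer A X X'))"
    using assms by (intro TA_plus_right[symmetric]) auto
  also have "\<dots> = TA U g (Zer A X X')" using assms by (subst plus_zer_left) auto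
  finally show ?thesis using assms by (auto dest!: plus_cancel)
qed

lemma zero_object_TO:
  assumes "zero_object A X \<or> zero_object A Y" "X \<in> Ob A" "Y \<in> Ob A"
  shows "zero_object A (TO U X Y)"
proof -
  have "TA U (Idt A X) (Idt A Y) = Zer A (TO U X Y) (TO U X Y)"
    using assms unfolding zero_object_iff by (elim disjE) (auto simp del: TA_idt)
  then show ?thesis using assms by (simp add: zero_object_iff)
qed

text \<open>Preservation of direct sums by the tensor product is not assumed. Biadditivity suffices:
  an arrow is recovered from its restrictions by inserting \<open>sum_incl_prj\<close> for the
  identity.\<close>

lemma dsum_tensor_ext_left:
  assumes F: "fin_supp F" and Y: "Y \<in> Ob A"
    and h: "h \<in> Ar A" "h' \<in> Ar A" "Dom A h = TO U (dsum A F) Y" "Dom A h' = TO U (dsum A F) Y"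
      "Cod A h = Cod A h'"
    and eq: "\<And>i. h \<cdot>\<^bsub>A\<^esub> TA U (incl A F i) (Idt A Y) = h' \<cdot>\<^bsub>A\<^esub> TA U (incl A F i) (Idt A Y)"
  shows "h = h'"
proof -
  define S where "S = {i. \<not> zero_object A (F i)}"
  have S: "finite S" using F by (simp add: S_def fin_supp_def)
  let ?D = "dsum A F"
  have *: "k = hsum (Dom A k) (Cod A k) (\<lambda>i. (k \<cdot>\<^bsub>A\<^esub> TA U (incl A F i) (Idt A Y)) \<cdot>\<^bsub>A\<^esub> TA U (prj F i) (Idt A Y)) S"
    if k: "k \<in> Ar A" "Dom A k = TO U ?D Y" for k
  proof -
    have "k = k \<cdot>\<^bsub>A\<^esub> TA U (Idt A ?D) (Idt A Y)" using k F Y by simp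
    also have "\<dots> = k \<cdot>\<^bsub>A\<^esub> TA U (hsum ?D ?D (\<lambda>i. incl A F i \<cdot>\<^bsub>A\<^esub> prj F i) S) (Idt A Y)"
      by (subst sum_incl_prj[OF F S]) (auto simp: S_def)
    also have "\<dots> = hsum (Dom A k) (Cod A k) (\<lambda>i. k \<cdot>\<^bsub>A\<^esub> TA U (incl A F i \<cdot>\<^bsub>A\<^esub> prj F i) (Idt A Y)) S"
      using k F Y S
      by (intro hsum_map[where \<phi> = "\<lambda>u. k \<cdot>\<^bsub>A\<^esub> TA U u (Idt A Y)" and X = ?D and Y = ?D])
        (auto simp: Hom_iff TA_plus_left)
    also have "\<dots> = hsum (Dom A k) (Cod A k) (\<lambda>i. (k \<cdot>\<^bsub>A\<^esub> TA U (incl A F i) (Idt A Y)) \<cdot>\<^bsub>A\<^esub> TA U (prj F i) (Idt A Y)) S"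
      using k F Y by (intro hsum_cong) (auto simp: Hom_iff)
    finally show ?thesis .
  qed
  show ?thesis using *[OF h(1,3)] *[OF h(2,4)] eq h by simp
qed

lemma dsum_tensor_ext_right:
  assumes F: "fin_supp F" and Y: "Y \<in> Ob A"
    and h: "h \<in> Ar A" "h' \<in> Ar A" "Dom A h = TO U Y (dsum A F)" "Dom A h' = TO U Y (dsum A F)"
      "Cod A h = Cod A h'"
    and eq: "\<And>i. h \<cdot>\<^bsub>A\<^esub> TA U (Idt A Y) (incl A F i) = h' \<cdot>\<^bsub>A\<^esub> TA U (Idt A Y) (incl A F i)"
  shows "h = h'"
proof -
  define S where "S = {i. \<not> zero_object A (F i)}"
  have S: "finite S" using F by (simp add: S_def fin_supp_def)
  let ?D = "dsum A F"
  have *: "k = hsum (Dom A k) (Cod A k) (\<lambda>i. (k \<cdot>\<^bsub>A\<^esub> TA U (Idt A Y) (incl A F i)) \<cdot>\<^bsub>A\<^esub> TA U (Idt A Y) (prj F i)) S"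
    if k: "k \<in> Ar A" "Dom A k = TO U Y ?D" for k
  proof -
    have "k = k \<cdot>\<^bsub>A\<^esub> TA U (Idt A Y) (Idt A ?D)" using k F Y by simp
    also have "\<dots> = k \<cdot>\<^bsub>A\<^esub> TA U (Idt A Y) (hsum ?D ?D (\<lambda>i. incl A F i \<cdot>\<^bsub>A\<^esub> prj F i) S)"
      by (subst sum_incl_prj[OF F S]) (auto simp: S_def)
    also have "\<dots> = hsum (Dom A k) (Cod A k) (\<lambda>i. k \<cdot>\<^bsub>A\<^esub> TA U (Idt A Y) (incl A F i \<cdot>\<^bsub>A\<^esub> prj F i)) S"
      using k F Y S
      by (intro hsum_map[where \<phi> = "\<lambda>u. k \<cdot>\<^bsub>A\<^esub> TA U (Idt A Y) u" and X = ?D and Y = ?D])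
        (auto simp: Hom_iff TA_plus_right)
    also have "\<dots> = hsum (Dom A k) (Cod A k) (\<lambda>i. (k \<cdot>\<^bsub>A\<^esub> TA U (Idt A Y) (incl A F i)) \<cdot>\<^bsub>A\<^esub> TA U (Idt A Y) (prj F i)) S"
      using k F Y by (intro hsum_cong) (auto simp: Hom_iff)
    finally show ?thesis .
  qed
  show ?thesis using *[OF h(1,3)] *[OF h(2,4)] eq h by simp
qed

lemma dsum_tensor_ext:
  assumes F: "fin_supp F" "fin_supp F'"
    and h: "h \<in> Ar A" "h' \<in> Ar A" "Dom A h = TO U (dsum A F) (dsum A F')"
      "Dom A h' = TO U (dsum A F) (dsum A F')" "Cod A h = Cod A h'"
    and eq: "\<And>i j. h \<cdot>\<^bsub>A\<^esub> TA U (incl A F i) (incl A F' j) = h' \<cdot>\<^bsub>A\<^esub> TA U (incl A F i) (incl A F' j)"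
  shows "h = h'"
proof (rule dsum_tensor_ext_left[OF F(1)])
  fix i
  show "h \<cdot>\<^bsub>A\<^esub> TA U (incl A F i) (Idt A (dsum A F')) = h' \<cdot>\<^bsub>A\<^esub> TA U (incl A F i) (Idt A (dsum A F'))"
  proof (rule dsum_tensor_ext_right[OF F(2)])
    fix j
    show "(h \<cdot>\<^bsub>A\<^esub> TA U (incl A F i) (Idt A (dsum A F'))) \<cdot>\<^bsub>A\<^esub> TA U (Idt A (F i)) (incl A F' j) =
        (h' \<cdot>\<^bsub>A\<^esub> TA U (incl A F i) (Idt A (dsum A F'))) \<cdot>\<^bsub>A\<^esub> TA U (Idt A (F i)) (incl A F' j)"
      using h F eq by simp
  qed (use h F in auto)
qed (use h F in auto)

text \<open>The existence half, without which the definite description of the Kuenneth morphism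
  could not be evaluated.\<close>

lemma dsum_tensor_ex:
  assumes F: "fin_supp F" "fin_supp F'" and T: "T \<in> Ob A"
    and g: "\<And>i j. g i j \<in> Hom A (TO U (F i) (F' j)) T"
  shows "\<exists>h \<in> Hom A (TO U (dsum A F) (dsum A F')) T.
    \<forall>i j. h \<cdot>\<^bsub>A\<^esub> TA U (incl A F i) (incl A F' j) = g i j"
proof -
  define S where "S = {i. \<not> zero_object A (F i)} \<times> {i. \<not> zero_object A (F' i)}"
  have S: "finite S" using F by (simp add: S_def fin_supp_def)
  \<comment> \<open>Project to one pair of summands and apply the prescribed component; over pairs
    of nonzero summands this is a finite sum.\<close>
  define k where "k = (\<lambda>(i, j). g i j \<cdot>\<^bsub>A\<^esub> TA U (prj F i) (prj F' j))"
  let ?D = "TO U (dsum A F) (dsum A F')"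
  have g': "g i j \<in> Ar A" "Dom A (g i j) = TO U (F i) (F' j)" "Cod A (g i j) = T" for i j
    using g[of i j] by (auto simp: Hom_iff)
  have k: "k x \<in> Hom A ?D T" for x using g' F by (auto simp: Hom_iff k_def split: prod.split)
  have h: "hsum ?D T k S \<in> Hom A ?D T" using k F T by (intro hsum_hom) auto
  have "hsum ?D T k S \<cdot>\<^bsub>A\<^esub> TA U (incl A F i) (incl A F' j) = g i j" for i j
  proof (cases "(i, j) \<in> S")
    case True
    have "hsum ?D T k S \<cdot>\<^bsub>A\<^esub> TA U (incl A F i) (incl A F' j) =
        hsum (TO U (F i) (F' j)) T (\<lambda>x. k x \<cdot>\<^bsub>A\<^esub> TA U (incl A F i) (incl A F' j)) S"
      using hsum_cmp[OF S T, of "TA U (incl A F i) (incl A F' j)" ?D k] k F by simp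
    also have "\<dots> = k (i, j) \<cdot>\<^bsub>A\<^esub> TA U (incl A F i) (incl A F' j)"
      using S True T F g' by (intro hsum_single) (auto simp: Hom_iff k_def prj_incl split: if_splits)
    also have "\<dots> = g i j" using F g' by (simp add: k_def prj_incl)
    finally show ?thesis .
  next
    case False
    then have "zero_object A (TO U (F i) (F' j))"
      using F by (intro zero_object_TO) (auto simp: S_def)
    then show ?thesis using h F g' by (intro zero_object_unique) (auto simp: Hom_iff)
  qed
  then show ?thesis using h by blast
qed

end

section \<open>Total complexes\<close>

lemma chain_cat_simps [simp]:
  "Ob (chain_cat A) = {K. is_cpx A K \<and> bounded_below A K}"
  "Ar (chain_cat A) = {f. is_cpx A (Src f) \<and> bounded_below A (Src f) \<and>
     is_cpx A (Tgt f) \<and> bounded_below A (Tgt f) \<and> is_cmap A f}"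
  "Dom (chain_cat A) = Src" "Cod (chain_cat A) = Tgt"
  "Src (Idt (chain_cat A) K) = K" "Tgt (Idt (chain_cat A) K) = K"
  "At (Idt (chain_cat A) K) n = Idt A (Cob K n)"
  "Src (g \<cdot>\<^bsub>chain_cat A\<^esub> f) = Src f" "Tgt (g \<cdot>\<^bsub>chain_cat A\<^esub> f) = Tgt g"
  "At (g \<cdot>\<^bsub>chain_cat A\<^esub> f) n = At g n \<cdot>\<^bsub>A\<^esub> At f n"
  by (simp_all add: chain_cat_def)

lemma trf_eqI: "\<lbrakk>Src f = Src g; Tgt f = Tgt g; \<And>n. At f n = At g n\<rbrakk> \<Longrightarrow> f = (g :: ('a, 'b, 'c) trf)"
  by (rule trf.equality) auto

lemma tensor_dcpx_simps [simp]:
  "Dob (tensor_dcpx A U K L) p q = TO U (Cob K p) (Cob L q)"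
  "Dh (tensor_dcpx A U K L) p q = TA U (Cdf K p) (Idt A (Cob L q))"
  "Dv (tensor_dcpx A U K L) p q = TA U (Idt A (Cob K p)) (Cdf L q)"
  by (simp_all add: tensor_dcpx_def)

lemma tot_map_simps [simp]:
  "Src (tot_map A D E g) = Tot A D" "Tgt (tot_map A D E g) = Tot A E"
  by (simp_all add: tot_map_def)

lemma chain_ten_simps [simp]:
  "TO (chain_ten A U) K L = Tot A (tensor_dcpx A U K L)"
  "TA (chain_ten A U) f g = tot_map A (tensor_dcpx A U (Src f) (Src g)) (tensor_dcpx A U (Tgt f) (Tgt g))
     (\<lambda>p q. TA U (At f p) (At g q))"
  "Unt (chain_ten A U) = unit_cpx A U"
  by (simp_all add: chain_ten_def tensor_cpx_def)

context additive_category
begin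

lemma cpx_ob [simp]: "is_cpx A K \<Longrightarrow> Cob K n \<in> Ob A"
  by (simp add: is_cpx_def)

lemma cpx_typing [simp]:
  assumes "is_cpx A K"
  shows "Cdf K n \<in> Ar A" "Dom A (Cdf K n) = Cob K n" "Cod A (Cdf K n) = Cob K (n - 1)"
  using assms by (simp_all add: is_cpx_def Hom_iff)

lemma is_cmapD [simp]:
  assumes "is_cmap A f"
  shows "At f n \<in> Ar A" "Dom A (At f n) = Cob (Src f) n" "Cod A (At f n) = Cob (Tgt f) n"
  using assms by (simp_all add: is_cmap_def Hom_iff)

lemma tinj_typing [simp]:
  assumes "fin_supp (diag D n)"
  shows "tinj A D n p \<in> Ar A" "Dom A (tinj A D n p) = Dob D p (n - p)"
    "Cod A (tinj A D n p) = Cob (Tot A D) n"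
  using assms by (simp_all add: tinj_def Tot_def) (simp add: diag_def)

lemma Tot_ob [simp]: "fin_supp (diag D n) \<Longrightarrow> Cob (Tot A D) n \<in> Ob A"
  by (simp add: Tot_def)

lemma Tot_ext:
  assumes "fin_supp (diag D n)" "h \<in> Ar A" "h' \<in> Ar A" "Dom A h = Cob (Tot A D) n"
    "Dom A h' = Cob (Tot A D) n" "Cod A h = Cod A h'"
    "\<And>p. h \<cdot>\<^bsub>A\<^esub> tinj A D n p = h' \<cdot>\<^bsub>A\<^esub> tinj A D n p"
  shows "h = h'"
  using assms by - (rule dsum_ext[of "diag D n"]; simp add: Tot_def tinj_def)

lemma tot_map_typing:
  assumes "fin_supp (diag D n)" "fin_supp (diag E n)"
    and "\<And>p q. p + q = n \<Longrightarrow> g p q \<in> Hom A (Dob D p q) (Dob E p q)"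
  shows "At (tot_map A D E g) n \<in> Ar A"
    "Dom A (At (tot_map A D E g) n) = Cob (Tot A D) n"
    "Cod A (At (tot_map A D E g) n) = Cob (Tot A E) n"
    "At (tot_map A D E g) n \<cdot>\<^bsub>A\<^esub> tinj A D n p = tinj A E n p \<cdot>\<^bsub>A\<^esub> g p (n - p)"
proof -
  have *: "tinj A E n p \<cdot>\<^bsub>A\<^esub> g p (n - p) \<in> Hom A (diag D n p) (dsum A (diag E n))" for p
    using assms(3)[of p "n - p"] assms(2) by (auto simp: Hom_iff diag_def) (simp add: Tot_def)
  note T = copair_typing[OF assms(1) dsum_ob[OF assms(2)] *] copair_incl[OF assms(1) dsum_ob[OF assms(2)] *]
  show "At (tot_map A D E g) n \<in> Ar A"
    "Dom A (At (tot_map A D E g) n) = Cob (Tot A D) n"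
    "Cod A (At (tot_map A D E g) n) = Cob (Tot A E) n"
    using T by (simp_all add: tot_map_def Tot_def)
  show "At (tot_map A D E g) n \<cdot>\<^bsub>A\<^esub> tinj A D n p = tinj A E n p \<cdot>\<^bsub>A\<^esub> g p (n - p)"
    using T(4)[of p] by (simp add: tot_map_def tinj_def)
qed

lemma Tot_Cdf_tinj:
  assumes "fin_supp (diag D n)" "fin_supp (diag D (n - 1))"
    and h: "\<And>p. Dh D p (n - p) \<in> Hom A (Dob D p (n - p)) (Dob D (p - 1) (n - p))"
    and v: "\<And>p. Dv D p (n - p) \<in> Hom A (Dob D p (n - p)) (Dob D p (n - p - 1))"
  shows "Cdf (Tot A D) n \<cdot>\<^bsub>A\<^esub> tinj A D n p =
    Plus A (tinj A D (n - 1) (p - 1) \<cdot>\<^bsub>A\<^esub> Dh D p (n - p))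
      (signed A p (tinj A D (n - 1) p \<cdot>\<^bsub>A\<^esub> Dv D p (n - p)))"
proof -
  \<comment> \<open>In total degree n - 1 the horizontal part lands in column p - 1 of the same row,
    the vertical part in column p of the next lower row.\<close>
  have e: "n - 1 - (p - 1) = n - p" "n - 1 - p = n - p - 1" for p :: int by auto
  have d: "Dom A (tinj A D (n - 1) (p - 1)) = Dob D (p - 1) (n - p)"
    "Dom A (tinj A D (n - 1) p) = Dob D p (n - p - 1)"
    "Cod A (tinj A D (n - 1) p) = dsum A (diag D (n - 1))"
    "tinj A D (n - 1) p \<in> Ar A" for p
    using assms(2) tinj_typing(2)[OF assms(2), of "p - 1"] tinj_typing(2)[OF assms(2), of p]
    unfolding e by (auto simp: Tot_def)
  have "Plus A (tinj A D (n - 1) (p - 1) \<cdot>\<^bsub>A\<^esub> Dh D p (n - p))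
      (signed A p (tinj A D (n - 1) p \<cdot>\<^bsub>A\<^esub> Dv D p (n - p))) \<in> Hom A (diag D n p) (dsum A (diag D (n - 1)))" for p
    using h[of p] v[of p] assms(1) d by (auto simp: Hom_iff diag_def simp del: tinj_typing)
  from copair_incl[OF assms(1) dsum_ob[OF assms(2)] this]
  show ?thesis by (simp add: Tot_def tinj_def)
qed

end

context abelian_monoidal_category
begin

lemma fin_supp_tensor [simp]:
  assumes "is_cpx A K" "bounded_below A K" "is_cpx A L" "bounded_below A L"
  shows "fin_supp (diag (tensor_dcpx A U K L) n)"
proof -
  obtain a where a: "\<And>i. i < a \<Longrightarrow> zero_object A (Cob K i)" using assms by (auto simp: bounded_below_def)
  obtain b where b: "\<And>i. i < b \<Longrightarrow> zero_object A (Cob L i)" using assms by (auto simp: bounded_below_def)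
  show ?thesis
  \<comment> \<open>Below \<open>a\<close> the first factor is zero, above \<open>n - b\<close> the
    second.\<close>
  proof (rule fin_suppI[where S = "{a..n - b}"])
    fix i assume "i \<notin> {a..n - b}"
    then have "i < a \<or> n - i < b" by auto
    then show "zero_object A (diag (tensor_dcpx A U K L) n i)"
      using a b assms by (auto simp: diag_def intro!: zero_object_TO)
  qed (use assms in \<open>auto simp: diag_def\<close>)
qed

lemma chain_TA_typing:
  assumes "f \<in> Ar (chain_cat A)" "g \<in> Ar (chain_cat A)"
  shows "At (TA (chain_ten A U) f g) n \<in> Ar A"
    "Dom A (At (TA (chain_ten A U) f g) n) = Cob (Tot A (tensor_dcpx A U (Src f) (Src g))) n"
    "Cod A (At (TA (chain_ten A U) f g) n) = Cob (Tot A (tensor_dcpx A U (Tgt f) (Tgt g))) n"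
    "At (TA (chain_ten A U) f g) n \<cdot>\<^bsub>A\<^esub> tinj A (tensor_dcpx A U (Src f) (Src g)) n p =
      tinj A (tensor_dcpx A U (Tgt f) (Tgt g)) n p \<cdot>\<^bsub>A\<^esub> TA U (At f p) (At g (n - p))"
proof -
  have 1: "fin_supp (diag (tensor_dcpx A U (Src f) (Src g)) n)"
    and 2: "fin_supp (diag (tensor_dcpx A U (Tgt f) (Tgt g)) n)" using assms by auto
  have 3: "TA U (At f p) (At g q) \<in> Hom A (Dob (tensor_dcpx A U (Src f) (Src g)) p q)
      (Dob (tensor_dcpx A U (Tgt f) (Tgt g)) p q)" for p q
    using assms by (auto simp: Hom_iff)
  note T = tot_map_typing[OF 1 2 3]
  show "At (TA (chain_ten A U) f g) n \<in> Ar A"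
    "Dom A (At (TA (chain_ten A U) f g) n) = Cob (Tot A (tensor_dcpx A U (Src f) (Src g))) n"
    "Cod A (At (TA (chain_ten A U) f g) n) = Cob (Tot A (tensor_dcpx A U (Tgt f) (Tgt g))) n"
    "At (TA (chain_ten A U) f g) n \<cdot>\<^bsub>A\<^esub> tinj A (tensor_dcpx A U (Src f) (Src g)) n p =
      tinj A (tensor_dcpx A U (Tgt f) (Tgt g)) n p \<cdot>\<^bsub>A\<^esub> TA U (At f p) (At g (n - p))"
    using T by auto
qed

text \<open>Two layers of sums: over the degree \<open>m\<close> of the left factor, then over the
  columns \<open>p\<close> and \<open>q\<close> of the two total complexes. \<open>Tot_ext\<close>
  handles the first layer and \<open>dsum_tensor_ext\<close> the second.\<close>

lemma Tot_tensor_ext: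
  assumes T: "is_cpx A (Tot A D)" "bounded_below A (Tot A D)" "is_cpx A (Tot A E)" "bounded_below A (Tot A E)"
    and D: "\<And>n. fin_supp (diag D n)" and E: "\<And>n. fin_supp (diag E n)"
    and h: "h \<in> Ar A" "h' \<in> Ar A" "Dom A h = Cob (Tot A (tensor_dcpx A U (Tot A D) (Tot A E))) n"
      "Dom A h' = Cob (Tot A (tensor_dcpx A U (Tot A D) (Tot A E))) n" "Cod A h = Cod A h'"
    and eq: "\<And>m p q. h \<cdot>\<^bsub>A\<^esub> tinj A (tensor_dcpx A U (Tot A D) (Tot A E)) n m
          \<cdot>\<^bsub>A\<^esub> TA U (tinj A D m p) (tinj A E (n - m) q) =
        h' \<cdot>\<^bsub>A\<^esub> tinj A (tensor_dcpx A U (Tot A D) (Tot A E)) n m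
          \<cdot>\<^bsub>A\<^esub> TA U (tinj A D m p) (tinj A E (n - m) q)"
  shows "h = h'"
proof (rule Tot_ext[where D = "tensor_dcpx A U (Tot A D) (Tot A E)"])
  fix m
  show "h \<cdot>\<^bsub>A\<^esub> tinj A (tensor_dcpx A U (Tot A D) (Tot A E)) n m =
      h' \<cdot>\<^bsub>A\<^esub> tinj A (tensor_dcpx A U (Tot A D) (Tot A E)) n m"
  proof (rule dsum_tensor_ext[OF D[of m] E[of "n - m"]])
    fix p q
    show "(h \<cdot>\<^bsub>A\<^esub> tinj A (tensor_dcpx A U (Tot A D) (Tot A E)) n m)
          \<cdot>\<^bsub>A\<^esub> TA U (incl A (diag D m) p) (incl A (diag E (n - m)) q) =
        (h' \<cdot>\<^bsub>A\<^esub> tinj A (tensor_dcpx A U (Tot A D) (Tot A E)) n m)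
          \<cdot>\<^bsub>A\<^esub> TA U (incl A (diag D m) p) (incl A (diag E (n - m)) q)"
      using eq[of m p q] h T D E by (simp flip: tinj_def)
  qed (use h T D E in \<open>auto simp: Tot_def\<close>)
qed (use h T in auto)

lemma Tot_tensor_ex:
  assumes T: "is_cpx A (Tot A D)" "bounded_below A (Tot A D)" "is_cpx A (Tot A E)" "bounded_below A (Tot A E)"
    and D: "\<And>n. fin_supp (diag D n)" and E: "\<And>n. fin_supp (diag E n)" and Z: "Z \<in> Ob A"
    and g: "\<And>m p q. g m p q \<in> Hom A (TO U (Dob D p (m - p)) (Dob E q (n - m - q))) Z"
  shows "\<exists>h \<in> Hom A (Cob (Tot A (tensor_dcpx A U (Tot A D) (Tot A E))) n) Z.
    \<forall>m p q. h \<cdot>\<^bsub>A\<^esub> tinj A (tensor_dcpx A U (Tot A D) (Tot A E)) n m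
      \<cdot>\<^bsub>A\<^esub> TA U (tinj A D m p) (tinj A E (n - m) q) = g m p q"
proof -
  have "\<exists>h \<in> Hom A (TO U (dsum A (diag D m)) (dsum A (diag E (n - m)))) Z.
    \<forall>i j. h \<cdot>\<^bsub>A\<^esub> TA U (incl A (diag D m) i) (incl A (diag E (n - m)) j) = g m i j" for m
    using dsum_tensor_ex[OF D[of m] E[of "n - m"] Z, of "g m"] g by (auto simp: diag_def)
  then obtain k where k: "\<And>m. k m \<in> Hom A (TO U (dsum A (diag D m)) (dsum A (diag E (n - m)))) Z"
    "\<And>m i j. k m \<cdot>\<^bsub>A\<^esub> TA U (incl A (diag D m) i) (incl A (diag E (n - m)) j) = g m i j"
    by metis
  let ?F = "diag (tensor_dcpx A U (Tot A D) (Tot A E)) n"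
  have F: "fin_supp ?F" using T by simp
  have k': "k m \<in> Hom A (?F m) Z" for m using k(1)[of m] by (simp add: diag_def Tot_def)
  define h where "h = copair A ?F Z k"
  have h: "h \<in> Ar A" "Dom A h = Cob (Tot A (tensor_dcpx A U (Tot A D) (Tot A E))) n" "Cod A h = Z"
    "\<And>m. h \<cdot>\<^bsub>A\<^esub> tinj A (tensor_dcpx A U (Tot A D) (Tot A E)) n m = k m"
    using copair_typing[OF F Z k'] copair_incl[OF F Z k'] by (simp_all add: h_def Tot_def tinj_def)
  have "h \<cdot>\<^bsub>A\<^esub> tinj A (tensor_dcpx A U (Tot A D) (Tot A E)) n m
      \<cdot>\<^bsub>A\<^esub> TA U (tinj A D m p) (tinj A E (n - m) q) = g m p q" for m p q
  proof -
    have "h \<cdot>\<^bsub>A\<^esub> tinj A (tensor_dcpx A U (Tot A D) (Tot A E)) n m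
      \<cdot>\<^bsub>A\<^esub> TA U (tinj A D m p) (tinj A E (n - m) q) = k m \<cdot>\<^bsub>A\<^esub> TA U (tinj A D m p) (tinj A E (n - m) q)"
      using h T D E by (intro cmp_sub) auto
    then show ?thesis using k(2) by (simp add: tinj_def)
  qed
  then show ?thesis using h(1-3) by (intro bexI[of _ h]) (auto simp: Hom_iff)
qed

end

section \<open>Monoidal functors to chain complexes\<close>

lemma Mon_cat_simps [simp]:
  "Ob (Mon_cat C T A U) = Mon_ob C T A U"
  "Dom (Mon_cat C T A U) = Src" "Cod (Mon_cat C T A U) = Tgt"
  "Src (Idt (Mon_cat C T A U) F) = F" "Tgt (Idt (Mon_cat C T A U) F) = F"
  "Src (t \<cdot>\<^bsub>Mon_cat C T A U\<^esub> u) = Src u" "Tgt (t \<cdot>\<^bsub>Mon_cat C T A U\<^esub> u) = Tgt t"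
  by (simp_all add: Mon_cat_def trf_idt_def trf_cmp_def)

lemma Mon_cat_At [simp]:
  assumes "X \<in> Ob C"
  shows "At (Idt (Mon_cat C T A U) F) X = Idt (chain_cat A) (FO F X)"
    "At (t \<cdot>\<^bsub>Mon_cat C T A U\<^esub> u) X = At t X \<cdot>\<^bsub>chain_cat A\<^esub> At u X"
  using assms by (simp_all add: Mon_cat_def trf_idt_def trf_cmp_def)

lemma nat_1_int [simp]: "nat (1 + int k) = Suc k"
  by simp

text \<open>The positive case is written \<open>1 + int k\<close> because the simplifier puts
  \<open>int (Suc k)\<close> into that form.\<close>

lemma int_cases_nat:
  obtains "p < 0" | "p = 0" | k where "p = 1 + int k"
proof (cases "p \<le> 0")
  case False
  then have "p = 1 + int (nat (p - 1))" by simp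
  then show ?thesis using that by blast
qed (use that in fastforce)

text \<open>The entries are distinct and lie between the head and the bound, which leaves enough
  room only if the head is at most \<open>n\<close>. This makes the first index in a list of
  degeneracies admissible.\<close>

lemma strict_sorted_hd_le:
  assumes "sorted_wrt (<) (i # ns)" "\<forall>x \<in> set (i # ns). x < n + length (i # ns)"
  shows "i \<le> (n::nat)"
proof -
  have "set (i # ns) \<subseteq> {i..<n + length (i # ns)}" using assms by auto
  from card_mono[OF _ this] have "card (set (i # ns)) \<le> n + length (i # ns) - i" by simp
  moreover have "card (set (i # ns)) = length (i # ns)"
    using assms(1) strict_sorted_iff by (intro distinct_card) blast
  moreover have "i < n + length (i # ns)" using assms(2) by simp
  ultimately show ?thesis by linarith
qed

lemma finite_shuffles [simp]: "finite {\<mu>. \<mu> \<subseteq> {..<(n::nat)} \<and> card \<mu> = p}"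
  by (rule finite_subset[of _ "Pow {..<n}"]) auto

text \<open>That the monoidal functors form a category enters as an assumption, to be discharged by
  the cotriple living on them.\<close>

locale monoidal_setting = C: monoidal_category C T + abelian_monoidal_category A U +
    Mon: category "Mon_cat C T A U"
  for C :: "('c, 'd) cat" and T :: "('c, 'd) monstr"
    and A :: "('a, 'b) addcat" and U :: "('a, 'b) monstr"
begin

abbreviation Mon where "Mon \<equiv> Mon_cat C T A U"

lemma TO_obC [simp]: "\<lbrakk>X \<in> Ob C; Y \<in> Ob C\<rbrakk> \<Longrightarrow> TO T X Y \<in> Ob C"
  by (rule C.tensor_ob)

lemma Unt_obC [simp]: "Unt T \<in> Ob C"
  by (rule C.unit_ob)

section \<open>Monoidal functors and transformations, degree by degree\<close>

lemma Mon_obD: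
  assumes "F \<in> Mon_ob C T A U"
  shows "monoidal_functor C T (chain_cat A) (chain_ten A U) F" "is_functor C (chain_cat A) F"
  using assms by (auto simp: Mon_ob_def monoidal_functor_def ext_functor_def)

lemma Mon_ob_FO [simp]:
  assumes "F \<in> Mon_ob C T A U" "X \<in> Ob C"
  shows "is_cpx A (FO F X)" "bounded_below A (FO F X)"
  using Mon_obD(2)[OF assms(1)] assms(2) unfolding is_functor_def by auto

lemma Mon_ob_FA [simp]:
  assumes "F \<in> Mon_ob C T A U" "\<phi> \<in> Ar C"
  shows "is_cmap A (FA F \<phi>)" "Src (FA F \<phi>) = FO F (Dom C \<phi>)" "Tgt (FA F \<phi>) = FO F (Cod C \<phi>)"
proof -
  have "FA F \<phi> \<in> Hom (chain_cat A) (FO F (Dom C \<phi>)) (FO F (Cod C \<phi>))"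
    using Mon_obD(2)[OF assms(1)] assms(2) unfolding is_functor_def by (auto simp: Hom_def)
  then show "is_cmap A (FA F \<phi>)" "Src (FA F \<phi>) = FO F (Dom C \<phi>)" "Tgt (FA F \<phi>) = FO F (Cod C \<phi>)"
    by (simp_all add: Hom_iff)
qed

lemma Mon_ob_Kap [simp]:
  assumes "F \<in> Mon_ob C T A U" "X \<in> Ob C" "Y \<in> Ob C"
  shows "is_cmap A (Kap F X Y)" "Src (Kap F X Y) = Tot A (tensor_dcpx A U (FO F X) (FO F Y))"
    "Tgt (Kap F X Y) = FO F (TO T X Y)"
proof -
  have "Kap F X Y \<in> Hom (chain_cat A) (TO (chain_ten A U) (FO F X) (FO F Y)) (FO F (TO T X Y))"
    using Mon_obD(1)[OF assms(1)] assms(2,3) unfolding monoidal_functor_def by blast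
  then show "is_cmap A (Kap F X Y)" "Src (Kap F X Y) = Tot A (tensor_dcpx A U (FO F X) (FO F Y))"
    "Tgt (Kap F X Y) = FO F (TO T X Y)"
    by (simp_all add: Hom_iff)
qed

lemma Mon_ob_Eta [simp]:
  assumes "F \<in> Mon_ob C T A U"
  shows "is_cmap A (Eta F)" "Src (Eta F) = unit_cpx A U" "Tgt (Eta F) = FO F (Unt T)"
proof -
  have "Eta F \<in> Hom (chain_cat A) (unit_cpx A U) (FO F (Unt T))"
    using Mon_obD(1)[OF assms(1)] unfolding monoidal_functor_def by simp
  then show "is_cmap A (Eta F)" "Src (Eta F) = unit_cpx A U" "Tgt (Eta F) = FO F (Unt T)"
    by (simp_all add: Hom_iff)
qed

lemma Mon_ar_iff:
  "t \<in> Ar Mon \<longleftrightarrow> Src t \<in> Mon_ob C T A U \<and> Tgt t \<in> Mon_ob C T A U \<and>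
    monoidal_trans C T (chain_cat A) (chain_ten A U) t"
  by (simp add: Mon_cat_def)

lemma Mon_ar_ob [simp]: "t \<in> Ar Mon \<Longrightarrow> Src t \<in> Mon_ob C T A U" "t \<in> Ar Mon \<Longrightarrow> Tgt t \<in> Mon_ob C T A U"
  by (simp_all add: Mon_ar_iff)

lemma Mon_ar_At [simp]:
  assumes "t \<in> Ar Mon" "X \<in> Ob C"
  shows "is_cmap A (At t X)" "Src (At t X) = FO (Src t) X" "Tgt (At t X) = FO (Tgt t) X"
proof -
  have "At t X \<in> Hom (chain_cat A) (FO (Src t) X) (FO (Tgt t) X)"
    using assms unfolding Mon_ar_iff monoidal_trans_def nat_trans_def by blast
  then show "is_cmap A (At t X)" "Src (At t X) = FO (Src t) X" "Tgt (At t X) = FO (Tgt t) X"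
    by (simp_all add: Hom_iff)
qed

lemma Mon_ar_nat:
  assumes "t \<in> Ar Mon" "\<phi> \<in> Ar C"
  shows "At (At t (Cod C \<phi>)) n \<cdot>\<^bsub>A\<^esub> At (FA (Src t) \<phi>) n = At (FA (Tgt t) \<phi>) n \<cdot>\<^bsub>A\<^esub> At (At t (Dom C \<phi>)) n"
proof -
  have "At t (Cod C \<phi>) \<cdot>\<^bsub>chain_cat A\<^esub> FA (Src t) \<phi> = FA (Tgt t) \<phi> \<cdot>\<^bsub>chain_cat A\<^esub> At t (Dom C \<phi>)"
    using assms(1) C.hom_self[OF assms(2)] unfolding Mon_ar_iff monoidal_trans_def nat_trans_def by blast
  then show ?thesis by (metis chain_cat_simps(10))
qed

lemma Mon_ar_Cdf:
  assumes "t \<in> Ar Mon" "X \<in> Ob C"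
  shows "At (At t X) (n - 1) \<cdot>\<^bsub>A\<^esub> Cdf (FO (Src t) X) n = Cdf (FO (Tgt t) X) n \<cdot>\<^bsub>A\<^esub> At (At t X) n"
  using Mon_ar_At[OF assms] unfolding is_cmap_def by metis

lemma Mon_ar_Kap:
  assumes "t \<in> Ar Mon" "X \<in> Ob C" "Y \<in> Ob C"
  shows "At (At t (TO T X Y)) n \<cdot>\<^bsub>A\<^esub> At (Kap (Src t) X Y) n =
    At (Kap (Tgt t) X Y) n \<cdot>\<^bsub>A\<^esub> At (TA (chain_ten A U) (At t X) (At t Y)) n"
proof -
  have "At t (TO T X Y) \<cdot>\<^bsub>chain_cat A\<^esub> Kap (Src t) X Y =
      Kap (Tgt t) X Y \<cdot>\<^bsub>chain_cat A\<^esub> TA (chain_ten A U) (At t X) (At t Y)"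
    using assms unfolding Mon_ar_iff monoidal_trans_def by blast
  then show ?thesis by (metis chain_cat_simps(10))
qed

lemma Mon_ar_Eta:
  assumes "t \<in> Ar Mon"
  shows "At (At t (Unt T)) n \<cdot>\<^bsub>A\<^esub> At (Eta (Src t)) n = At (Eta (Tgt t)) n"
proof -
  have "At t (Unt T) \<cdot>\<^bsub>chain_cat A\<^esub> Eta (Src t) = Eta (Tgt t)"
    using assms unfolding Mon_ar_iff monoidal_trans_def by blast
  then show ?thesis by (metis chain_cat_simps(10))
qed

lemma Mon_arI:
  assumes F: "Src t \<in> Mon_ob C T A U" "Tgt t \<in> Mon_ob C T A U" and ext: "At t \<in> extensional (Ob C)"
    and At: "\<And>X. X \<in> Ob C \<Longrightarrow> is_cmap A (At t X)" "\<And>X. X \<in> Ob C \<Longrightarrow> Src (At t X) = FO (Src t) X"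
      "\<And>X. X \<in> Ob C \<Longrightarrow> Tgt (At t X) = FO (Tgt t) X"
    and nat: "\<And>\<phi> n. \<phi> \<in> Ar C \<Longrightarrow> At (At t (Cod C \<phi>)) n \<cdot>\<^bsub>A\<^esub> At (FA (Src t) \<phi>) n =
      At (FA (Tgt t) \<phi>) n \<cdot>\<^bsub>A\<^esub> At (At t (Dom C \<phi>)) n"
    and Kap: "\<And>X Y n. X \<in> Ob C \<Longrightarrow> Y \<in> Ob C \<Longrightarrow> At (At t (TO T X Y)) n \<cdot>\<^bsub>A\<^esub> At (Kap (Src t) X Y) n =
      At (Kap (Tgt t) X Y) n \<cdot>\<^bsub>A\<^esub> At (TA (chain_ten A U) (At t X) (At t Y)) n"
    and Eta: "\<And>n. At (At t (Unt T)) n \<cdot>\<^bsub>A\<^esub> At (Eta (Src t)) n = At (Eta (Tgt t)) n"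
  shows "t \<in> Ar Mon"
proof -
  have "nat_trans C (chain_cat A) t"
    unfolding nat_trans_def
  proof (intro conjI ballI allI)
    fix X Y \<phi> assume "\<phi> \<in> Hom C X Y"
    then have \<phi>: "\<phi> \<in> Ar C" "X = Dom C \<phi>" "Y = Cod C \<phi>" by (auto simp: Hom_iff)
    show "At t Y \<cdot>\<^bsub>chain_cat A\<^esub> FA (Src t) \<phi> = FA (Tgt t) \<phi> \<cdot>\<^bsub>chain_cat A\<^esub> At t X"
      by (rule trf_eqI) (use \<phi> F At nat in auto)
  qed (use F At ext in \<open>auto simp: Hom_iff\<close>)
  moreover have "At t (TO T X Y) \<cdot>\<^bsub>chain_cat A\<^esub> Kap (Src t) X Y =
      Kap (Tgt t) X Y \<cdot>\<^bsub>chain_cat A\<^esub> TA (chain_ten A U) (At t X) (At t Y)"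
    if "X \<in> Ob C" "Y \<in> Ob C" for X Y
    by (rule trf_eqI) (use that F At Kap in auto)
  moreover have "At t (Unt T) \<cdot>\<^bsub>chain_cat A\<^esub> Eta (Src t) = Eta (Tgt t)"
    by (rule trf_eqI) (use F At Eta in auto)
  ultimately show ?thesis using F unfolding Mon_ar_iff monoidal_trans_def by blast
qed

lemma Mon_ar_eqI:
  assumes "t \<in> Ar Mon" "u \<in> Ar Mon" "Src t = Src u" "Tgt t = Tgt u"
    and "\<And>X n. X \<in> Ob C \<Longrightarrow> At (At t X) n = At (At u X) n"
  shows "t = u"
proof (rule trf_eqI)
  show "At t X = At u X" for X
  proof (cases "X \<in> Ob C")
    case True
    show ?thesis by (rule trf_eqI) (use True assms in auto)
  next
    case False
    have "At t \<in> extensional (Ob C)" "At u \<in> extensional (Ob C)"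
      using assms(1,2) unfolding Mon_ar_iff monoidal_trans_def nat_trans_def by blast+
    then show ?thesis using False by (metis extensional_arb)
  qed
qed (use assms in auto)

section \<open>The total complex of a simplicial object\<close>

lemma sMon_ob [simp]: "K \<in> sMon C T A U \<Longrightarrow> SO K p \<in> Mon_ob C T A U"
  by (simp add: sMon_def simplicial_object_def)

lemma sMon_simplicial: "K \<in> sMon C T A U \<Longrightarrow> simplicial_object Mon K"
  by (simp add: sMon_def)

lemma sMon_Fac [simp]:
  assumes "K \<in> sMon C T A U" "i \<le> Suc n"
  shows "Fac K (Suc n) i \<in> Ar Mon" "Src (Fac K (Suc n) i) = SO K (Suc n)" "Tgt (Fac K (Suc n) i) = SO K n"
proof -
  have "Fac K (Suc n) i \<in> Hom Mon (SO K (Suc n)) (SO K n)"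
    using sMon_simplicial[OF assms(1), unfolded simplicial_object_def, THEN conjunct2, THEN conjunct1] assms(2)
    by blast
  then show "Fac K (Suc n) i \<in> Ar Mon" "Src (Fac K (Suc n) i) = SO K (Suc n)" "Tgt (Fac K (Suc n) i) = SO K n"
    by (simp_all add: Hom_iff)
qed

lemma sMon_Deg [simp]:
  assumes "K \<in> sMon C T A U" "i \<le> n"
  shows "Deg K n i \<in> Ar Mon" "Src (Deg K n i) = SO K n" "Tgt (Deg K n i) = SO K (Suc n)"
proof -
  have "Deg K n i \<in> Hom Mon (SO K n) (SO K (Suc n))"
    using sMon_simplicial[OF assms(1), unfolded simplicial_object_def, THEN conjunct2, THEN conjunct2, THEN conjunct1] assms(2)
    by blast
  then show "Deg K n i \<in> Ar Mon" "Src (Deg K n i) = SO K n" "Tgt (Deg K n i) = SO K (Suc n)"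
    by (simp_all add: Hom_iff)
qed

lemma sdcpx_Dob:
  "Dob (sdcpx A K X) p q = (if 0 \<le> p then Cob (FO (SO K (nat p)) X) q else zob A)"
  by (simp add: sdcpx_def Let_def)

lemma sdcpx_Dob_nat [simp]:
  "Dob (sdcpx A K X) (int k) q = Cob (FO (SO K k) X) q"
  "Dob (sdcpx A K X) 0 q = Cob (FO (SO K 0) X) q"
  "Dob (sdcpx A K X) (1 + int k) q = Cob (FO (SO K (Suc k)) X) q"
  by (simp_all add: sdcpx_Dob nat_add_distrib)

text \<open>The simplicial differential, indexed by its target degree so that no subtraction of
  natural numbers occurs.\<close>

definition face_sum where
  "face_sum K X k q = hsum (Cob (FO (SO K (Suc k)) X) q) (Cob (FO (SO K k) X) q)
     (\<lambda>i. signed A (int i) (At (At (Fac K (Suc k) i) X) q)) {0..Suc k}"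

lemma sdcpx_Dh [simp]:
  "Dh (sdcpx A K X) (1 + int k) q = face_sum K X k q"
  "Dh (sdcpx A K X) 0 q = Zer A (Cob (FO (SO K 0) X) q) (zob A)"
  by (simp_all add: sdcpx_def Let_def face_sum_def hsum_def nat_add_distrib)

lemma sdcpx_Dv [simp]:
  "Dv (sdcpx A K X) (int k) q = Cdf (FO (SO K k) X) q"
  "Dv (sdcpx A K X) 0 q = Cdf (FO (SO K 0) X) q"
  "Dv (sdcpx A K X) (1 + int k) q = Cdf (FO (SO K (Suc k)) X) q"
  by (simp_all add: sdcpx_def Let_def nat_add_distrib)

lemma face_sum_typing [simp]:
  assumes "K \<in> sMon C T A U" "X \<in> Ob C"
  shows "face_sum K X k q \<in> Ar A" "Dom A (face_sum K X k q) = Cob (FO (SO K (Suc k)) X) q"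
    "Cod A (face_sum K X k q) = Cob (FO (SO K k) X) q"
  unfolding face_sum_def using assms by (subst hsum_typing; simp add: Hom_iff)+

lemma sdcpx_hom:
  assumes "K \<in> sMon C T A U" "X \<in> Ob C"
  shows "Dh (sdcpx A K X) p q \<in> Hom A (Dob (sdcpx A K X) p q) (Dob (sdcpx A K X) (p - 1) q)"
    "Dv (sdcpx A K X) p q \<in> Hom A (Dob (sdcpx A K X) p q) (Dob (sdcpx A K X) p (q - 1))"
proof -
  consider "p < 0" | "p = 0" | k where "p = 1 + int k" by (rule int_cases_nat)
  then show "Dh (sdcpx A K X) p q \<in> Hom A (Dob (sdcpx A K X) p q) (Dob (sdcpx A K X) (p - 1) q)"
  proof cases
    case 1
    then show ?thesis by (simp add: Hom_iff sdcpx_def Let_def)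
  next
    case 2
    then show ?thesis using assms by (simp add: Hom_iff) (simp add: sdcpx_Dob)
  next
    case (3 k)
    then show ?thesis using assms by (simp add: Hom_iff)
  qed
  show "Dv (sdcpx A K X) p q \<in> Hom A (Dob (sdcpx A K X) p q) (Dob (sdcpx A K X) p (q - 1))"
    using assms by (simp add: Hom_iff sdcpx_def Let_def)
qed

lemma fin_supp_sdcpx [simp]:
  assumes "K \<in> sMon C T A U" "X \<in> Ob C"
  shows "fin_supp (diag (sdcpx A K X) n)"
proof -
  obtain m where m: "\<And>p q. q < m \<Longrightarrow> zero_object A (Cob (FO (SO K p) X) q)"
    using assms by (auto simp: sMon_def)
  show ?thesis
  proof (rule fin_suppI[where S = "{0..n - m}"])
    fix i assume "i \<notin> {0..n - m}"
    then have "i < 0 \<or> n - i < m" by auto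
    then show "zero_object A (diag (sdcpx A K X) n i)"
      using m by (auto simp: diag_def sdcpx_Dob)
  qed (use assms in \<open>auto simp: diag_def sdcpx_Dob\<close>)
qed

lemma sdcpx_ext:
  assumes "K \<in> sMon C T A U" "X \<in> Ob C" "h \<in> Ar A" "h' \<in> Ar A" "Dom A h = Cob (Tot A (sdcpx A K X)) n"
    "Dom A h' = Cob (Tot A (sdcpx A K X)) n" "Cod A h = Cod A h'"
    "\<And>k. h \<cdot>\<^bsub>A\<^esub> tinj A (sdcpx A K X) n (int k) = h' \<cdot>\<^bsub>A\<^esub> tinj A (sdcpx A K X) n (int k)"
  shows "h = h'"
proof (rule Tot_ext[of "sdcpx A K X" n])
  fix p
  show "h \<cdot>\<^bsub>A\<^esub> tinj A (sdcpx A K X) n p = h' \<cdot>\<^bsub>A\<^esub> tinj A (sdcpx A K X) n p"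
  proof (cases "0 \<le> p")
    case True
    then show ?thesis using assms(8)[of "nat p"] by simp
  next
    case False
    then show ?thesis using assms(1-7)
      by - (rule zero_object_unique; simp add: sdcpx_Dob)
  qed
qed (use assms in auto)

text \<open>Column -1 is a zero object, so the horizontal part of the differential vanishes and only
  the internal one remains, with positive sign.\<close>

lemma sdcpx_Cdf_0:
  assumes "K \<in> sMon C T A U" "X \<in> Ob C"
  shows "Cdf (Tot A (sdcpx A K X)) n \<cdot>\<^bsub>A\<^esub> tinj A (sdcpx A K X) n 0 =
    tinj A (sdcpx A K X) (n - 1) 0 \<cdot>\<^bsub>A\<^esub> Cdf (FO (SO K 0) X) n"
proof -
  have "Cod A (tinj A (sdcpx A K X) (n - 1) (-1)) = Cob (Tot A (sdcpx A K X)) (n - 1)"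
    "Dom A (tinj A (sdcpx A K X) (n - 1) (-1)) = zob A" using assms by (simp_all add: sdcpx_Dob)
  then show ?thesis
    using Tot_Cdf_tinj[of "sdcpx A K X" n 0] assms sdcpx_hom[OF assms] by simp
qed

lemma sdcpx_Cdf_Suc:
  assumes "K \<in> sMon C T A U" "X \<in> Ob C"
  shows "Cdf (Tot A (sdcpx A K X)) n \<cdot>\<^bsub>A\<^esub> tinj A (sdcpx A K X) n (1 + int k) =
    Plus A (tinj A (sdcpx A K X) (n - 1) (int k) \<cdot>\<^bsub>A\<^esub> face_sum K X k (n - (1 + int k)))
      (signed A (1 + int k) (tinj A (sdcpx A K X) (n - 1) (1 + int k) \<cdot>\<^bsub>A\<^esub>
        Cdf (FO (SO K (Suc k)) X) (n - (1 + int k))))"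
  using Tot_Cdf_tinj[of "sdcpx A K X" n "1 + int k"] assms sdcpx_hom[OF assms] by simp

lemma sdcpx_Dob_add [simp]: "Dob (sdcpx A K X) (int p + int q) r = Cob (FO (SO K (p + q)) X) r"
  by (simp add: sdcpx_Dob nat_add_distrib)

section \<open>Morphisms of simplicial objects\<close>

lemma simplicial_map_typing [simp]:
  assumes "simplicial_map Mon K L f"
  shows "f n \<in> Ar Mon" "Src (f n) = SO K n" "Tgt (f n) = SO L n"
proof -
  have "f n \<in> Hom Mon (SO K n) (SO L n)" using assms unfolding simplicial_map_def by blast
  then show "f n \<in> Ar Mon" "Src (f n) = SO K n" "Tgt (f n) = SO L n" by (simp_all add: Hom_iff)
qed

lemma simplicial_map_Fac:
  assumes "simplicial_map Mon K L f" "X \<in> Ob C" "i \<le> Suc k"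
  shows "At (At (f k) X) n \<cdot>\<^bsub>A\<^esub> At (At (Fac K (Suc k) i) X) n =
    At (At (Fac L (Suc k) i) X) n \<cdot>\<^bsub>A\<^esub> At (At (f (Suc k)) X) n"
proof -
  have "f k \<cdot>\<^bsub>Mon\<^esub> Fac K (Suc k) i = Fac L (Suc k) i \<cdot>\<^bsub>Mon\<^esub> f (Suc k)"
    using assms unfolding simplicial_map_def by blast
  then have "At (At (f k \<cdot>\<^bsub>Mon\<^esub> Fac K (Suc k) i) X) n = At (At (Fac L (Suc k) i \<cdot>\<^bsub>Mon\<^esub> f (Suc k)) X) n"
    by simp
  then show ?thesis using assms(2) by simp
qed

lemma simplicial_map_face_sum:
  assumes K: "K \<in> sMon C T A U" and L: "L \<in> sMon C T A U" and X: "X \<in> Ob C"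
    and f: "simplicial_map Mon K L f"
  shows "At (At (f k) X) n \<cdot>\<^bsub>A\<^esub> face_sum K X k n = face_sum L X k n \<cdot>\<^bsub>A\<^esub> At (At (f (Suc k)) X) n"
proof -
  have "At (At (f k) X) n \<cdot>\<^bsub>A\<^esub> face_sum K X k n =
      hsum (Cob (FO (SO K (Suc k)) X) n) (Cob (FO (SO L k) X) n)
        (\<lambda>i. At (At (f k) X) n \<cdot>\<^bsub>A\<^esub> signed A (int i) (At (At (Fac K (Suc k) i) X) n)) {0..Suc k}"
    unfolding face_sum_def using K L X f by (subst cmp_hsum) (auto simp: Hom_iff)
  also have "\<dots> = hsum (Cob (FO (SO K (Suc k)) X) n) (Cob (FO (SO L k) X) n)
        (\<lambda>i. signed A (int i) (At (At (Fac L (Suc k) i) X) n) \<cdot>\<^bsub>A\<^esub> At (At (f (Suc k)) X) n) {0..Suc k}"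
    using K L X f by (intro hsum_cong) (auto simp: Hom_iff simplicial_map_Fac[OF f])
  also have "\<dots> = face_sum L X k n \<cdot>\<^bsub>A\<^esub> At (At (f (Suc k)) X) n"
    unfolding face_sum_def using K L X f by (subst hsum_cmp) (auto simp: Hom_iff)
  finally show ?thesis .
qed

text \<open>Covers two uses: the total complex on an arrow of \<open>C\<close> (same
  \<open>K\<close>, different objects) and on a simplicial map (same object). The last clause is the
  fourth one for right-nested composites.\<close>

lemma sdcpx_map:
  assumes KL: "K \<in> sMon C T A U" "L \<in> sMon C T A U" "X \<in> Ob C" "Y \<in> Ob C"
    and g: "\<And>k n. At (g k) n \<in> Hom A (Cob (FO (SO K k) X) n) (Cob (FO (SO L k) Y) n)"
    and t: "t = tot_map A (sdcpx A K X) (sdcpx A L Y) (\<lambda>p q. if 0 \<le> p then At (g (nat p)) q else Zer A (zob A) (zob A))"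
  shows "At t n \<in> Ar A" "Dom A (At t n) = Cob (Tot A (sdcpx A K X)) n"
    "Cod A (At t n) = Cob (Tot A (sdcpx A L Y)) n"
    "0 \<le> r \<Longrightarrow> At t n \<cdot>\<^bsub>A\<^esub> tinj A (sdcpx A K X) n r = tinj A (sdcpx A L Y) n r \<cdot>\<^bsub>A\<^esub> At (g (nat r)) (n - r)"
    "\<lbrakk>0 \<le> r; z \<in> Ar A; Cod A z = Cob (FO (SO K (nat r)) X) (n - r)\<rbrakk> \<Longrightarrow>
      At t n \<cdot>\<^bsub>A\<^esub> (tinj A (sdcpx A K X) n r \<cdot>\<^bsub>A\<^esub> z) =
      tinj A (sdcpx A L Y) n r \<cdot>\<^bsub>A\<^esub> (At (g (nat r)) (n - r) \<cdot>\<^bsub>A\<^esub> z)"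
proof -
  have 1: "(if 0 \<le> p then At (g (nat p)) q else Zer A (zob A) (zob A)) \<in>
      Hom A (Dob (sdcpx A K X) p q) (Dob (sdcpx A L Y) p q)" for p q
    using g[of "nat p" q] by (auto simp: sdcpx_Dob Hom_iff)
  have F: "fin_supp (diag (sdcpx A K X) n)" "fin_supp (diag (sdcpx A L Y) n)" for n using KL by auto
  note T = tot_map_typing[OF F 1, folded t]
  show 2: "At t n \<in> Ar A" "Dom A (At t n) = Cob (Tot A (sdcpx A K X)) n"
    "Cod A (At t n) = Cob (Tot A (sdcpx A L Y)) n"
    "0 \<le> r \<Longrightarrow> At t n \<cdot>\<^bsub>A\<^esub> tinj A (sdcpx A K X) n r = tinj A (sdcpx A L Y) n r \<cdot>\<^bsub>A\<^esub> At (g (nat r)) (n - r)"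
    using T(1-3) T(4)[of n r] by simp_all
  assume r: "0 \<le> r" "z \<in> Ar A" "Cod A z = Cob (FO (SO K (nat r)) X) (n - r)"
  have g': "At (g k) n \<in> Ar A" "Dom A (At (g k) n) = Cob (FO (SO K k) X) n" "Cod A (At (g k) n) = Cob (FO (SO L k) Y) n"
    for k n using g[of k n] by (auto simp: Hom_iff)
  have "At t n \<cdot>\<^bsub>A\<^esub> (tinj A (sdcpx A K X) n r \<cdot>\<^bsub>A\<^esub> z) =
      (tinj A (sdcpx A L Y) n r \<cdot>\<^bsub>A\<^esub> At (g (nat r)) (n - r)) \<cdot>\<^bsub>A\<^esub> z"
    using r F 2 by (intro cmp_sub) (auto simp: sdcpx_Dob)
  then show "At t n \<cdot>\<^bsub>A\<^esub> (tinj A (sdcpx A K X) n r \<cdot>\<^bsub>A\<^esub> z) =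
      tinj A (sdcpx A L Y) n r \<cdot>\<^bsub>A\<^esub> (At (g (nat r)) (n - r) \<cdot>\<^bsub>A\<^esub> z)"
    using r F g' by (simp add: sdcpx_Dob)
qed

abbreviation sEM where "sEM K \<equiv> sEM_ob C T A U K"

lemma sEM_ob_simps [simp]:
  "X \<in> Ob C \<Longrightarrow> FO (sEM K) X = Tot A (sdcpx A K X)"
  "At (Eta (sEM K)) n = tinj A (sdcpx A K (Unt T)) n 0 \<cdot>\<^bsub>A\<^esub> At (Eta (SO K 0)) n"
  by (simp_all add: sEM_ob_def)

lemma sEM_ar_simps [simp]:
  "Src (sEM_ar C T A U K L f) = sEM K" "Tgt (sEM_ar C T A U K L f) = sEM L"
  "X \<in> Ob C \<Longrightarrow> Src (At (sEM_ar C T A U K L f) X) = Tot A (sdcpx A K X)"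
  "X \<in> Ob C \<Longrightarrow> Tgt (At (sEM_ar C T A U K L f) X) = Tot A (sdcpx A L X)"
  by (simp_all add: sEM_ar_def)

lemma sEM_FA:
  assumes "K \<in> sMon C T A U" "\<phi> \<in> Ar C"
  shows "0 \<le> r \<Longrightarrow> At (FA (sEM K) \<phi>) n \<cdot>\<^bsub>A\<^esub> tinj A (sdcpx A K (Dom C \<phi>)) n r =
      tinj A (sdcpx A K (Cod C \<phi>)) n r \<cdot>\<^bsub>A\<^esub> At (FA (SO K (nat r)) \<phi>) (n - r)"
    "\<lbrakk>0 \<le> r; z \<in> Ar A; Cod A z = Cob (FO (SO K (nat r)) (Dom C \<phi>)) (n - r)\<rbrakk> \<Longrightarrow>
      At (FA (sEM K) \<phi>) n \<cdot>\<^bsub>A\<^esub> (tinj A (sdcpx A K (Dom C \<phi>)) n r \<cdot>\<^bsub>A\<^esub> z) =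
      tinj A (sdcpx A K (Cod C \<phi>)) n r \<cdot>\<^bsub>A\<^esub> (At (FA (SO K (nat r)) \<phi>) (n - r) \<cdot>\<^bsub>A\<^esub> z)"
proof -
  have 1: "At (FA (SO K k) \<phi>) n \<in> Hom A (Cob (FO (SO K k) (Dom C \<phi>)) n) (Cob (FO (SO K k) (Cod C \<phi>)) n)" for k n
    using assms by (simp add: Hom_iff)
  have 2: "FA (sEM K) \<phi> = tot_map A (sdcpx A K (Dom C \<phi>)) (sdcpx A K (Cod C \<phi>))
      (\<lambda>p q. if 0 \<le> p then At (FA (SO K (nat p)) \<phi>) q else Zer A (zob A) (zob A))"
    using assms by (simp add: sEM_ob_def)
  have 3: "Dom C \<phi> \<in> Ob C" "Cod C \<phi> \<in> Ob C" using assms by auto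
  note T = sdcpx_map[OF assms(1,1) 3, of "\<lambda>k. FA (SO K k) \<phi>", OF 1 2]
  show "0 \<le> r \<Longrightarrow> At (FA (sEM K) \<phi>) n \<cdot>\<^bsub>A\<^esub> tinj A (sdcpx A K (Dom C \<phi>)) n r =
      tinj A (sdcpx A K (Cod C \<phi>)) n r \<cdot>\<^bsub>A\<^esub> At (FA (SO K (nat r)) \<phi>) (n - r)"
    "\<lbrakk>0 \<le> r; z \<in> Ar A; Cod A z = Cob (FO (SO K (nat r)) (Dom C \<phi>)) (n - r)\<rbrakk> \<Longrightarrow>
      At (FA (sEM K) \<phi>) n \<cdot>\<^bsub>A\<^esub> (tinj A (sdcpx A K (Dom C \<phi>)) n r \<cdot>\<^bsub>A\<^esub> z) =
      tinj A (sdcpx A K (Cod C \<phi>)) n r \<cdot>\<^bsub>A\<^esub> (At (FA (SO K (nat r)) \<phi>) (n - r) \<cdot>\<^bsub>A\<^esub> z)"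
    using T(4,5) by auto
qed

lemma sEM_ar_At:
  assumes "K \<in> sMon C T A U" "L \<in> sMon C T A U" "X \<in> Ob C" "simplicial_map Mon K L f"
  defines "t \<equiv> At (sEM_ar C T A U K L f) X"
  shows "At t n \<in> Ar A" "Dom A (At t n) = Cob (Tot A (sdcpx A K X)) n"
    "Cod A (At t n) = Cob (Tot A (sdcpx A L X)) n"
    "0 \<le> r \<Longrightarrow> At t n \<cdot>\<^bsub>A\<^esub> tinj A (sdcpx A K X) n r = tinj A (sdcpx A L X) n r \<cdot>\<^bsub>A\<^esub> At (At (f (nat r)) X) (n - r)"
    "\<lbrakk>0 \<le> r; z \<in> Ar A; Cod A z = Cob (FO (SO K (nat r)) X) (n - r)\<rbrakk> \<Longrightarrow>
      At t n \<cdot>\<^bsub>A\<^esub> (tinj A (sdcpx A K X) n r \<cdot>\<^bsub>A\<^esub> z) =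
      tinj A (sdcpx A L X) n r \<cdot>\<^bsub>A\<^esub> (At (At (f (nat r)) X) (n - r) \<cdot>\<^bsub>A\<^esub> z)"
proof -
  have 1: "At (At (f k) X) n \<in> Hom A (Cob (FO (SO K k) X) n) (Cob (FO (SO L k) X) n)" for k n
    using assms(1-4) by (simp add: Hom_iff)
  have 2: "t = tot_map A (sdcpx A K X) (sdcpx A L X)
      (\<lambda>p q. if 0 \<le> p then At (At (f (nat p)) X) q else Zer A (zob A) (zob A))"
    using assms(3) by (simp add: sEM_ar_def t_def)
  note T = sdcpx_map[OF assms(1,2,3,3), of "\<lambda>k. At (f k) X", OF 1 2]
  show "At t n \<in> Ar A" "Dom A (At t n) = Cob (Tot A (sdcpx A K X)) n"
    "Cod A (At t n) = Cob (Tot A (sdcpx A L X)) n"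
    "0 \<le> r \<Longrightarrow> At t n \<cdot>\<^bsub>A\<^esub> tinj A (sdcpx A K X) n r = tinj A (sdcpx A L X) n r \<cdot>\<^bsub>A\<^esub> At (At (f (nat r)) X) (n - r)"
    "\<lbrakk>0 \<le> r; z \<in> Ar A; Cod A z = Cob (FO (SO K (nat r)) X) (n - r)\<rbrakk> \<Longrightarrow>
      At t n \<cdot>\<^bsub>A\<^esub> (tinj A (sdcpx A K X) n r \<cdot>\<^bsub>A\<^esub> z) =
      tinj A (sdcpx A L X) n r \<cdot>\<^bsub>A\<^esub> (At (At (f (nat r)) X) (n - r) \<cdot>\<^bsub>A\<^esub> z)"
    using T by auto
qed

lemma sEM_ar_cmap:
  assumes K: "K \<in> sMon C T A U" "sEM K \<in> Mon_ob C T A U" and L: "L \<in> sMon C T A U" "sEM L \<in> Mon_ob C T A U"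
    and X: "X \<in> Ob C" and f: "simplicial_map Mon K L f"
  shows "is_cmap A (At (sEM_ar C T A U K L f) X)"
proof -
  define t where "t = At (sEM_ar C T A U K L f) X"
  note t = sEM_ar_At[OF K(1) L(1) X f, folded t_def]
  have cpx: "is_cpx A (Tot A (sdcpx A K X))" "is_cpx A (Tot A (sdcpx A L X))"
    using Mon_ob_FO(1)[OF K(2) X] Mon_ob_FO(1)[OF L(2) X] X by simp_all
  have "At t (n - 1) \<cdot>\<^bsub>A\<^esub> Cdf (Tot A (sdcpx A K X)) n = Cdf (Tot A (sdcpx A L X)) n \<cdot>\<^bsub>A\<^esub> At t n" for n
  proof (rule sdcpx_ext[OF K(1) X])
    fix k :: nat
    show "(At t (n - 1) \<cdot>\<^bsub>A\<^esub> Cdf (Tot A (sdcpx A K X)) n) \<cdot>\<^bsub>A\<^esub> tinj A (sdcpx A K X) n (int k) =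
        (Cdf (Tot A (sdcpx A L X)) n \<cdot>\<^bsub>A\<^esub> At t n) \<cdot>\<^bsub>A\<^esub> tinj A (sdcpx A K X) n (int k)"
    proof (cases k)
      case 0
      have "(Cdf (Tot A (sdcpx A L X)) n \<cdot>\<^bsub>A\<^esub> At t n) \<cdot>\<^bsub>A\<^esub> tinj A (sdcpx A K X) n 0 =
          (Cdf (Tot A (sdcpx A L X)) n \<cdot>\<^bsub>A\<^esub> tinj A (sdcpx A L X) n 0) \<cdot>\<^bsub>A\<^esub> At (At (f 0) X) n"
        using K L X f t cpx by simp
      also have "\<dots> = tinj A (sdcpx A L X) (n - 1) 0 \<cdot>\<^bsub>A\<^esub> (Cdf (FO (SO L 0) X) n \<cdot>\<^bsub>A\<^esub> At (At (f 0) X) n)"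
        using K L X f by (subst sdcpx_Cdf_0) simp_all
      also have "\<dots> = tinj A (sdcpx A L X) (n - 1) 0 \<cdot>\<^bsub>A\<^esub> (At (At (f 0) X) (n - 1) \<cdot>\<^bsub>A\<^esub> Cdf (FO (SO K 0) X) n)"
        using Mon_ar_Cdf[of "f 0" X n] X f by simp
      also have "\<dots> = (At t (n - 1) \<cdot>\<^bsub>A\<^esub> Cdf (Tot A (sdcpx A K X)) n) \<cdot>\<^bsub>A\<^esub> tinj A (sdcpx A K X) n 0"
        using K L X f t cpx by (simp add: sdcpx_Cdf_0)
      finally show ?thesis using 0 by simp
    next
      \<comment> \<open>The two parts of the total differential are compared separately: the faces
        by \<open>simplicial_map_face_sum\<close>, the internal differential because each level of
        \<open>f\<close> consists of chain maps.\<close>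
      case (Suc j)
      let ?q = "n - (1 + int j)"
      have e: "n - 1 - int j = ?q" "n - 1 - (1 + int j) = ?q - 1" by simp_all
      have "(Cdf (Tot A (sdcpx A L X)) n \<cdot>\<^bsub>A\<^esub> At t n) \<cdot>\<^bsub>A\<^esub> tinj A (sdcpx A K X) n (1 + int j) =
          (Cdf (Tot A (sdcpx A L X)) n \<cdot>\<^bsub>A\<^esub> tinj A (sdcpx A L X) n (1 + int j)) \<cdot>\<^bsub>A\<^esub> At (At (f (Suc j)) X) ?q"
        using K L X f t cpx by simp
      also have "\<dots> = Plus A (tinj A (sdcpx A L X) (n - 1) (int j) \<cdot>\<^bsub>A\<^esub> (face_sum L X j ?q \<cdot>\<^bsub>A\<^esub> At (At (f (Suc j)) X) ?q))
          (signed A (1 + int j) (tinj A (sdcpx A L X) (n - 1) (1 + int j) \<cdot>\<^bsub>A\<^esub>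
            (Cdf (FO (SO L (Suc j)) X) ?q \<cdot>\<^bsub>A\<^esub> At (At (f (Suc j)) X) ?q)))"
        using K L X f by (subst sdcpx_Cdf_Suc) (simp_all add: e)
      also have "\<dots> = Plus A (tinj A (sdcpx A L X) (n - 1) (int j) \<cdot>\<^bsub>A\<^esub> (At (At (f j) X) ?q \<cdot>\<^bsub>A\<^esub> face_sum K X j ?q))
          (signed A (1 + int j) (tinj A (sdcpx A L X) (n - 1) (1 + int j) \<cdot>\<^bsub>A\<^esub>
            (At (At (f (Suc j)) X) (?q - 1) \<cdot>\<^bsub>A\<^esub> Cdf (FO (SO K (Suc j)) X) ?q)))"
        using Mon_ar_Cdf[of "f (Suc j)" X ?q] simplicial_map_face_sum[OF K(1) L(1) X f, of j ?q] X f by simp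
      also have "\<dots> = (At t (n - 1) \<cdot>\<^bsub>A\<^esub> Cdf (Tot A (sdcpx A K X)) n) \<cdot>\<^bsub>A\<^esub> tinj A (sdcpx A K X) n (1 + int j)"
        using K L X f t cpx by (simp add: sdcpx_Cdf_Suc e)
      finally show ?thesis using Suc by simp
    qed
  qed (use K L X f t cpx in auto)
  then show ?thesis using X t by (simp add: is_cmap_def Hom_iff flip: t_def) (simp add: t_def)
qed

lemma sEM_ar_nat:
  assumes K: "K \<in> sMon C T A U" "sEM K \<in> Mon_ob C T A U" and L: "L \<in> sMon C T A U" "sEM L \<in> Mon_ob C T A U"
    and \<phi>: "\<phi> \<in> Ar C" and f: "simplicial_map Mon K L f"
  shows "At (At (sEM_ar C T A U K L f) (Cod C \<phi>)) n \<cdot>\<^bsub>A\<^esub> At (FA (sEM K) \<phi>) n =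
      At (FA (sEM L) \<phi>) n \<cdot>\<^bsub>A\<^esub> At (At (sEM_ar C T A U K L f) (Dom C \<phi>)) n"
proof -
  have ob: "Dom C \<phi> \<in> Ob C" "Cod C \<phi> \<in> Ob C" using \<phi> by auto
  note t = sEM_ar_At[OF K(1) L(1) ob(1) f] sEM_ar_At[OF K(1) L(1) ob(2) f] sEM_FA[OF K(1) \<phi>] sEM_FA[OF L(1) \<phi>]
  show ?thesis
  proof (rule sdcpx_ext[OF K(1) ob(1)])
    fix k
    show "(At (At (sEM_ar C T A U K L f) (Cod C \<phi>)) n \<cdot>\<^bsub>A\<^esub> At (FA (sEM K) \<phi>) n) \<cdot>\<^bsub>A\<^esub> tinj A (sdcpx A K (Dom C \<phi>)) n (int k) =
      (At (FA (sEM L) \<phi>) n \<cdot>\<^bsub>A\<^esub> At (At (sEM_ar C T A U K L f) (Dom C \<phi>)) n) \<cdot>\<^bsub>A\<^esub> tinj A (sdcpx A K (Dom C \<phi>)) n (int k)"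
      using K L \<phi> f ob t Mon_ar_nat[of "f k" \<phi> "n - int k"] by simp
  qed (use K L \<phi> f ob t in auto)
qed

section \<open>The shuffle map\<close>

text \<open>The smallest index is applied first, and strict increase keeps every later index within
  the range of the degree reached by then.\<close>

lemma degs_typing:
  assumes "K \<in> sMon C T A U" "sorted_wrt (<) ns" "\<forall>x \<in> set ns. x < n + length ns"
  shows "degs Mon K n ns \<in> Ar Mon \<and> Src (degs Mon K n ns) = SO K n \<and>
    Tgt (degs Mon K n ns) = SO K (n + length ns)"
  using assms(2,3)
proof (induction ns arbitrary: n)
  case Nil
  then show ?case using assms(1) Mon.idt_typing by simp
next
  case (Cons i ns)
  have i: "i \<le> n" using strict_sorted_hd_le[OF Cons.prems] .
  have "degs Mon K (Suc n) ns \<in> Ar Mon \<and> Src (degs Mon K (Suc n) ns) = SO K (Suc n) \<and>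
    Tgt (degs Mon K (Suc n) ns) = SO K (Suc n + length ns)"
    using Cons by auto
  then show ?case using Mon.cmp_typing[of "Deg K n i" "degs Mon K (Suc n) ns"] i assms(1) by simp
qed

lemma degs_nat:
  assumes K: "K \<in> sMon C T A U" and L: "L \<in> sMon C T A U" and f: "simplicial_map Mon K L f"
    and "sorted_wrt (<) ns" "\<forall>x \<in> set ns. x < n + length ns"
  shows "f (n + length ns) \<cdot>\<^bsub>Mon\<^esub> degs Mon K n ns = degs Mon L n ns \<cdot>\<^bsub>Mon\<^esub> f n"
  using assms(4,5)
proof (induction ns arbitrary: n)
  case Nil
  then show ?case using f by (simp add: Mon.idt_left Mon.idt_right)
next
  case (Cons i ns)
  have i: "i \<le> n" using strict_sorted_hd_le[OF Cons.prems] .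
  have p: "sorted_wrt (<) ns" "\<forall>x \<in> set ns. x < Suc n + length ns" using Cons.prems by auto
  note dK = degs_typing[OF K p] and dL = degs_typing[OF L p]
  have "f (n + length (i # ns)) \<cdot>\<^bsub>Mon\<^esub> degs Mon K n (i # ns) =
      (f (Suc n + length ns) \<cdot>\<^bsub>Mon\<^esub> degs Mon K (Suc n) ns) \<cdot>\<^bsub>Mon\<^esub> Deg K n i"
    using dK K L f i by (simp add: Mon.assoc)
  also have "\<dots> = degs Mon L (Suc n) ns \<cdot>\<^bsub>Mon\<^esub> (f (Suc n) \<cdot>\<^bsub>Mon\<^esub> Deg K n i)"
    using Cons.IH[OF p] dL K L f i by (simp add: Mon.assoc)
  also have "f (Suc n) \<cdot>\<^bsub>Mon\<^esub> Deg K n i = Deg L n i \<cdot>\<^bsub>Mon\<^esub> f n"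
    using f i unfolding simplicial_map_def by blast
  also have "degs Mon L (Suc n) ns \<cdot>\<^bsub>Mon\<^esub> (Deg L n i \<cdot>\<^bsub>Mon\<^esub> f n) = degs Mon L n (i # ns) \<cdot>\<^bsub>Mon\<^esub> f n"
    using dL K L f i by (simp add: Mon.assoc)
  finally show ?case .
qed

lemma degs_set:
  assumes K: "K \<in> sMon C T A U" and S: "S \<subseteq> {..<p + q}" "card S = q"
  shows "degs Mon K p (sorted_list_of_set S) \<in> Ar Mon"
    "Src (degs Mon K p (sorted_list_of_set S)) = SO K p"
    "Tgt (degs Mon K p (sorted_list_of_set S)) = SO K (p + q)"
    "\<lbrakk>L \<in> sMon C T A U; simplicial_map Mon K L f; X \<in> Ob C\<rbrakk> \<Longrightarrow>
      At (At (f (p + q)) X) i \<cdot>\<^bsub>A\<^esub> At (At (degs Mon K p (sorted_list_of_set S)) X) i =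
      At (At (degs Mon L p (sorted_list_of_set S)) X) i \<cdot>\<^bsub>A\<^esub> At (At (f p) X) i"
proof -
  have "finite S" using S(1) finite_subset by blast
  then have p: "sorted_wrt (<) (sorted_list_of_set S)" "length (sorted_list_of_set S) = q"
    "\<forall>x \<in> set (sorted_list_of_set S). x < p + length (sorted_list_of_set S)"
    using S by auto
  show "degs Mon K p (sorted_list_of_set S) \<in> Ar Mon"
    "Src (degs Mon K p (sorted_list_of_set S)) = SO K p"
    "Tgt (degs Mon K p (sorted_list_of_set S)) = SO K (p + q)"
    using degs_typing[OF K p(1,3)] p(2) by auto
  assume L: "L \<in> sMon C T A U" "simplicial_map Mon K L f" "X \<in> Ob C"
  have "At (At (f (p + q) \<cdot>\<^bsub>Mon\<^esub> degs Mon K p (sorted_list_of_set S)) X) i =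
      At (At (degs Mon L p (sorted_list_of_set S) \<cdot>\<^bsub>Mon\<^esub> f p) X) i"
    using degs_nat[OF K L(1,2) p(1,3)] p(2) by simp
  then show "At (At (f (p + q)) X) i \<cdot>\<^bsub>A\<^esub> At (At (degs Mon K p (sorted_list_of_set S)) X) i =
      At (At (degs Mon L p (sorted_list_of_set S)) X) i \<cdot>\<^bsub>A\<^esub> At (At (f p) X) i"
    using L(3) by simp
qed

text \<open>The complement of \<open>\<mu>\<close> indexes the \<open>q\<close> degeneracies raising
  \<open>p\<close> to \<open>p + q\<close>, and \<open>\<mu>\<close> those raising \<open>q\<close>
  to \<open>q + p\<close>. The last two clauses let \<open>degs_set\<close> be used with
  \<open>p\<close> and \<open>q\<close> exchanged.\<close>

lemma shuffle_complement:
  assumes "\<mu> \<subseteq> {..<p + q}" "card \<mu> = p"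
  shows "{..<p + q} - \<mu> \<subseteq> {..<p + q}" "card ({..<p + q} - \<mu>) = q"
    "\<mu> \<subseteq> {..<q + p}" "q + p = p + q"
  using assms by (auto simp: card_Diff_subset finite_subset)

definition shuffle_summand where
  "shuffle_summand K X Y p q i j \<mu> = signed A (int (card {(a, b). a \<in> \<mu> \<and> b \<in> {..<p + q} - \<mu> \<and> b < a}))
    (TA U (At (At (degs Mon K p (sorted_list_of_set ({..<p + q} - \<mu>))) X) i)
          (At (At (degs Mon K q (sorted_list_of_set \<mu>)) Y) j))"

lemma shuffle_eq:
  "shuffle C T A U K X Y p q i j =
    hsum (TO U (Cob (FO (SO K p) X) i) (Cob (FO (SO K q) Y) j))
      (TO U (Cob (FO (SO K (p + q)) X) i) (Cob (FO (SO K (p + q)) Y) j))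
      (shuffle_summand K X Y p q i j) {\<mu>. \<mu> \<subseteq> {..<p + q} \<and> card \<mu> = p}"
  unfolding shuffle_def hsum_def Let_def shuffle_summand_def ..

lemma shuffle_summand_typing [simp]:
  assumes "K \<in> sMon C T A U" "X \<in> Ob C" "Y \<in> Ob C" "\<mu> \<subseteq> {..<p + q}" "card \<mu> = p"
  shows "shuffle_summand K X Y p q i j \<mu> \<in> Ar A"
    "Dom A (shuffle_summand K X Y p q i j \<mu>) = TO U (Cob (FO (SO K p) X) i) (Cob (FO (SO K q) Y) j)"
    "Cod A (shuffle_summand K X Y p q i j \<mu>) =
      TO U (Cob (FO (SO K (p + q)) X) i) (Cob (FO (SO K (p + q)) Y) j)"
  using assms degs_set[OF assms(1) shuffle_complement(1,2)[OF assms(4,5)]]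
    degs_set[OF assms(1) shuffle_complement(3)[OF assms(4,5)] assms(5), unfolded shuffle_complement(4)[OF assms(4,5)]]
  by (simp_all add: shuffle_summand_def)

lemma shuffle_typing [simp]:
  assumes "K \<in> sMon C T A U" "X \<in> Ob C" "Y \<in> Ob C"
  shows "shuffle C T A U K X Y p q i j \<in> Ar A"
    "Dom A (shuffle C T A U K X Y p q i j) = TO U (Cob (FO (SO K p) X) i) (Cob (FO (SO K q) Y) j)"
    "Cod A (shuffle C T A U K X Y p q i j) =
      TO U (Cob (FO (SO K (p + q)) X) i) (Cob (FO (SO K (p + q)) Y) j)"
  unfolding shuffle_eq using assms by (subst hsum_typing; auto simp: Hom_iff)+

text \<open>Simplicial maps commute with iterated degeneracies in each tensor factor, and the sign
  depends on \<open>\<mu>\<close> alone, so the summands match one by one.\<close>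

lemma shuffle_nat:
  assumes K: "K \<in> sMon C T A U" and L: "L \<in> sMon C T A U" and f: "simplicial_map Mon K L f"
    and X: "X \<in> Ob C" "Y \<in> Ob C"
  shows "TA U (At (At (f (p + q)) X) i) (At (At (f (p + q)) Y) j) \<cdot>\<^bsub>A\<^esub> shuffle C T A U K X Y p q i j =
    shuffle C T A U L X Y p q i j \<cdot>\<^bsub>A\<^esub> TA U (At (At (f p) X) i) (At (At (f q) Y) j)"
    (is "?F \<cdot>\<^bsub>A\<^esub> _ = _ \<cdot>\<^bsub>A\<^esub> ?G")
proof -
  let ?S = "{\<mu>. \<mu> \<subseteq> {..<p + q} \<and> card \<mu> = p}"
  let ?X = "TO U (Cob (FO (SO K p) X) i) (Cob (FO (SO K q) Y) j)"
  let ?Y = "TO U (Cob (FO (SO L (p + q)) X) i) (Cob (FO (SO L (p + q)) Y) j)"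
  have "?F \<cdot>\<^bsub>A\<^esub> shuffle C T A U K X Y p q i j =
      hsum ?X ?Y (\<lambda>\<mu>. ?F \<cdot>\<^bsub>A\<^esub> shuffle_summand K X Y p q i j \<mu>) ?S"
    unfolding shuffle_eq using K L f X by (subst cmp_hsum) (auto simp: Hom_iff)
  also have "\<dots> = hsum ?X ?Y (\<lambda>\<mu>. shuffle_summand L X Y p q i j \<mu> \<cdot>\<^bsub>A\<^esub> ?G) ?S"
  proof (intro hsum_cong)
    fix \<mu> assume "\<mu> \<in> ?S"
    then have \<mu>: "\<mu> \<subseteq> {..<p + q}" "card \<mu> = p" by auto
    note c = shuffle_complement[OF \<mu>]
    show "?F \<cdot>\<^bsub>A\<^esub> shuffle_summand K X Y p q i j \<mu> \<in> Hom A ?X ?Y"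
      using K L f X \<mu> by (simp add: Hom_iff)
    note d = degs_set[OF K c(1,2)] degs_set[OF L c(1,2)]
      degs_set[OF K c(3) \<mu>(2), unfolded c(4)] degs_set[OF L c(3) \<mu>(2), unfolded c(4)]
    have "At (At (f (p + q)) X) i \<cdot>\<^bsub>A\<^esub> At (At (degs Mon K p (sorted_list_of_set ({..<p + q} - \<mu>))) X) i =
        At (At (degs Mon L p (sorted_list_of_set ({..<p + q} - \<mu>))) X) i \<cdot>\<^bsub>A\<^esub> At (At (f p) X) i"
      "At (At (f (p + q)) Y) j \<cdot>\<^bsub>A\<^esub> At (At (degs Mon K q (sorted_list_of_set \<mu>)) Y) j =
        At (At (degs Mon L q (sorted_list_of_set \<mu>)) Y) j \<cdot>\<^bsub>A\<^esub> At (At (f q) Y) j"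
      using degs_set(4)[OF K c(1,2) L f X(1)] degs_set(4)[OF K c(3) \<mu>(2) L f X(2), unfolded c(4)] by auto
    then show "?F \<cdot>\<^bsub>A\<^esub> shuffle_summand K X Y p q i j \<mu> = shuffle_summand L X Y p q i j \<mu> \<cdot>\<^bsub>A\<^esub> ?G"
      unfolding shuffle_summand_def using K L f X d(1-3,5-7,9-11,13-15) by simp
  qed (use K L f X in auto)
  also have "\<dots> = shuffle C T A U L X Y p q i j \<cdot>\<^bsub>A\<^esub> ?G"
    unfolding shuffle_eq using K L f X by (subst hsum_cmp) (auto simp: Hom_iff)
  finally show ?thesis .
qed

text \<open>The only (0,0)-shuffle is the empty one, with sign +1 and no degeneracies.\<close>

lemma shuffle_0:
  assumes "K \<in> sMon C T A U" "X \<in> Ob C" "Y \<in> Ob C"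
  shows "shuffle C T A U K X Y 0 0 i j = Idt A (TO U (Cob (FO (SO K 0) X) i) (Cob (FO (SO K 0) Y) j))"
proof -
  have "{\<mu>. \<mu> \<subseteq> {..<0 + (0::nat)} \<and> card \<mu> = 0} = {{}}" by auto
  then have "shuffle C T A U K X Y 0 0 i j = shuffle_summand K X Y 0 0 i j {}"
    unfolding shuffle_eq using assms shuffle_summand_typing[OF assms, of "{}" 0 0 i j]
    by (subst hsum_single[where k = "{}"]) (auto simp: Hom_iff)
  also have "\<dots> = Idt A (TO U (Cob (FO (SO K 0) X) i) (Cob (FO (SO K 0) Y) j))"
    using assms by (simp add: shuffle_summand_def)
  finally show ?thesis .
qed

section \<open>The Kuenneth morphism of the total complex\<close>

text \<open>The prescribed component of the Kuenneth morphism on one summand. The total degree is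
  spelled out, and \<open>int p + int q\<close> replaces \<open>int (p + q)\<close>, to match the
  normal form of the simplifier.\<close>

definition kap_comp where
  "kap_comp K X Y p q i j = signed A (i * int q)
    (tinj A (sdcpx A K (TO T X Y)) (int p + i + (int q + j)) (int p + int q)
      \<cdot>\<^bsub>A\<^esub> At (Kap (SO K (p + q)) X Y) (i + j)
      \<cdot>\<^bsub>A\<^esub> tinj A (tensor_dcpx A U (FO (SO K (p + q)) X) (FO (SO K (p + q)) Y)) (i + j) i
      \<cdot>\<^bsub>A\<^esub> shuffle C T A U K X Y p q i j)"

lemma deg_cancel: "int p + i + (int q + j) - (int p + int q) = i + j"
  by simp

lemma kap_comp_typing [simp]:
  assumes "K \<in> sMon C T A U" "X \<in> Ob C" "Y \<in> Ob C"
  shows "kap_comp K X Y p q i j \<in> Ar A"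
    "Dom A (kap_comp K X Y p q i j) = TO U (Cob (FO (SO K p) X) i) (Cob (FO (SO K q) Y) j)"
    "Cod A (kap_comp K X Y p q i j) = Cob (Tot A (sdcpx A K (TO T X Y))) (int p + i + (int q + j))"
  unfolding kap_comp_def using assms by simp_all

text \<open>Summands of negative simplicial degree vanish, so that only natural numbers have to be
  considered.\<close>

lemma sEM_tensor_ext:
  assumes K: "K \<in> sMon C T A U" "sEM K \<in> Mon_ob C T A U" and X: "X \<in> Ob C" "Y \<in> Ob C"
  defines "D \<equiv> tensor_dcpx A U (Tot A (sdcpx A K X)) (Tot A (sdcpx A K Y))"
  assumes h: "h \<in> Ar A" "h' \<in> Ar A" "Dom A h = Cob (Tot A D) n" "Dom A h' = Cob (Tot A D) n" "Cod A h = Cod A h'"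
    and eq: "\<And>p q i j. n = int p + i + (int q + j) \<Longrightarrow>
      h \<cdot>\<^bsub>A\<^esub> (tinj A D n (int p + i) \<cdot>\<^bsub>A\<^esub> TA U (tinj A (sdcpx A K X) (int p + i) (int p)) (tinj A (sdcpx A K Y) (int q + j) (int q))) =
      h' \<cdot>\<^bsub>A\<^esub> (tinj A D n (int p + i) \<cdot>\<^bsub>A\<^esub> TA U (tinj A (sdcpx A K X) (int p + i) (int p)) (tinj A (sdcpx A K Y) (int q + j) (int q)))"
  shows "h = h'"
proof -
  have cpx: "is_cpx A (Tot A (sdcpx A K X))" "bounded_below A (Tot A (sdcpx A K X))"
    "is_cpx A (Tot A (sdcpx A K Y))" "bounded_below A (Tot A (sdcpx A K Y))"
    using Mon_ob_FO[OF K(2) X(1)] Mon_ob_FO[OF K(2) X(2)] X by simp_all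
  have F: "fin_supp (diag (sdcpx A K X) m)" "fin_supp (diag (sdcpx A K Y) m)" for m using K X by auto
  show ?thesis
  proof (rule Tot_tensor_ext[OF cpx F])
    fix m p q
    let ?t = "tinj A D n m \<cdot>\<^bsub>A\<^esub> TA U (tinj A (sdcpx A K X) m p) (tinj A (sdcpx A K Y) (n - m) q)"
    have t: "?t \<in> Ar A" "Cod A ?t = Cob (Tot A D) n"
      "Dom A ?t = TO U (Dob (sdcpx A K X) p (m - p)) (Dob (sdcpx A K Y) q (n - m - q))"
      using cpx F unfolding D_def by simp_all
    have "h \<cdot>\<^bsub>A\<^esub> ?t = h' \<cdot>\<^bsub>A\<^esub> ?t"
    proof (cases "0 \<le> p \<and> 0 \<le> q")
      case True
      then show ?thesis using eq[of "nat p" "m - p" "nat q" "n - m - q"] by simp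
    next
      case False
      then have "zero_object A (Dom A ?t)"
        unfolding t(3) using K X by (intro zero_object_TO) (auto simp: sdcpx_Dob)
      then show ?thesis using h t by - (rule zero_object_unique; simp)
    qed
    then show "h \<cdot>\<^bsub>A\<^esub> tinj A (tensor_dcpx A U (Tot A (sdcpx A K X)) (Tot A (sdcpx A K Y))) n m
          \<cdot>\<^bsub>A\<^esub> TA U (tinj A (sdcpx A K X) m p) (tinj A (sdcpx A K Y) (n - m) q) =
        h' \<cdot>\<^bsub>A\<^esub> tinj A (tensor_dcpx A U (Tot A (sdcpx A K X)) (Tot A (sdcpx A K Y))) n m
          \<cdot>\<^bsub>A\<^esub> TA U (tinj A (sdcpx A K X) m p) (tinj A (sdcpx A K Y) (n - m) q)"
      unfolding D_def .
  qed (use h in \<open>simp_all add: D_def\<close>)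
qed

text \<open>Evaluates the definite description: existence comes from \<open>Tot_tensor_ex\<close>,
  uniqueness from \<open>sEM_tensor_ext\<close>. Membership of \<open>sEM K\<close> in
  \<open>Mon_ob\<close> supplies that the total complexes are bounded below complexes.\<close>

lemma sEM_kap_comp:
  assumes K: "K \<in> sMon C T A U" "sEM K \<in> Mon_ob C T A U" and X: "X \<in> Ob C" "Y \<in> Ob C"
    and n: "n = int p + i + (int q + j)"
  shows "At (Kap (sEM K) X Y) n \<cdot>\<^bsub>A\<^esub>
      (tinj A (tensor_dcpx A U (Tot A (sdcpx A K X)) (Tot A (sdcpx A K Y))) n (int p + i)
      \<cdot>\<^bsub>A\<^esub> TA U (tinj A (sdcpx A K X) (int p + i) (int p)) (tinj A (sdcpx A K Y) (int q + j) (int q))) =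
    kap_comp K X Y p q i j"
proof -
  define D where "D = tensor_dcpx A U (Tot A (sdcpx A K X)) (Tot A (sdcpx A K Y))"
  define Z where "Z = Cob (Tot A (sdcpx A K (TO T X Y))) n"
  define w where "w = (\<lambda>p q i j. tinj A D n (int p + i)
      \<cdot>\<^bsub>A\<^esub> TA U (tinj A (sdcpx A K X) (int p + i) (int p)) (tinj A (sdcpx A K Y) (int q + j) (int q)))"
  define P where "P = (\<lambda>h. h \<in> Hom A (Cob (Tot A D) n) Z \<and>
    (\<forall>p q i j. int p + i + (int q + j) = n \<longrightarrow> h \<cdot>\<^bsub>A\<^esub> w p q i j = kap_comp K X Y p q i j))"
  have Kap: "At (Kap (sEM K) X Y) n = The P"
    using X unfolding sEM_ob_def sEM_kap_def P_def w_def D_def Z_def kap_comp_def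
    by (simp add: Let_def tensor_cpx_def cong: conj_cong imp_cong)
  have cpx: "is_cpx A (Tot A (sdcpx A K X))" "bounded_below A (Tot A (sdcpx A K X))"
    "is_cpx A (Tot A (sdcpx A K Y))" "bounded_below A (Tot A (sdcpx A K Y))"
    using Mon_ob_FO[OF K(2) X(1)] Mon_ob_FO[OF K(2) X(2)] X by simp_all
  have F: "fin_supp (diag (sdcpx A K X) m)" "fin_supp (diag (sdcpx A K Y) m)" for m using K X by auto
  have Z: "Z \<in> Ob A" using K X by (simp add: Z_def)
  \<comment> \<open>\<open>Tot_tensor_ex\<close> wants components for all integer columns. Those
    with a negative column start at a zero object and can only be zero.\<close>
  define g where "g = (\<lambda>m p q. if 0 \<le> p \<and> 0 \<le> q then kap_comp K X Y (nat p) (nat q) (m - p) (n - m - q)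
    else Zer A (TO U (Dob (sdcpx A K X) p (m - p)) (Dob (sdcpx A K Y) q (n - m - q))) Z)"
  have g: "g m p q \<in> Hom A (TO U (Dob (sdcpx A K X) p (m - p)) (Dob (sdcpx A K Y) q (n - m - q))) Z" for m p q
    using K X Z by (auto simp: g_def Hom_iff sdcpx_Dob) (simp_all add: Z_def)
  obtain h where h: "h \<in> Hom A (Cob (Tot A D) n) Z"
    "\<And>m p q. h \<cdot>\<^bsub>A\<^esub> tinj A D n m \<cdot>\<^bsub>A\<^esub> TA U (tinj A (sdcpx A K X) m p) (tinj A (sdcpx A K Y) (n - m) q) = g m p q"
    using Tot_tensor_ex[OF cpx F Z g] unfolding D_def by blast
  have "P h"
    unfolding P_def
  proof (intro conjI allI impI)
    fix p q i j assume n: "int p + i + (int q + j) = n"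
    have e: "n - (int p + i) = int q + j" using n by simp
    have "h \<cdot>\<^bsub>A\<^esub> w p q i j = g (int p + i) (int p) (int q)"
      unfolding w_def using h(2)[of "int p + i" "int p" "int q"] unfolding e .
    then show "h \<cdot>\<^bsub>A\<^esub> w p q i j = kap_comp K X Y p q i j" by (simp add: g_def e)
  qed (rule h(1))
  moreover have "h' = h" if "P h'" for h'
  proof (rule sEM_tensor_ext[OF K X, of h' h n])
    fix p q i j assume "n = int p + i + (int q + j)"
    then have "h' \<cdot>\<^bsub>A\<^esub> w p q i j = h \<cdot>\<^bsub>A\<^esub> w p q i j" using that \<open>P h\<close> unfolding P_def by metis
    then show "h' \<cdot>\<^bsub>A\<^esub> (tinj A (tensor_dcpx A U (Tot A (sdcpx A K X)) (Tot A (sdcpx A K Y))) n (int p + i)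
        \<cdot>\<^bsub>A\<^esub> TA U (tinj A (sdcpx A K X) (int p + i) (int p)) (tinj A (sdcpx A K Y) (int q + j) (int q))) =
      h \<cdot>\<^bsub>A\<^esub> (tinj A (tensor_dcpx A U (Tot A (sdcpx A K X)) (Tot A (sdcpx A K Y))) n (int p + i)
        \<cdot>\<^bsub>A\<^esub> TA U (tinj A (sdcpx A K X) (int p + i) (int p)) (tinj A (sdcpx A K Y) (int q + j) (int q)))"
      unfolding w_def D_def .
  next
    have "h \<in> Hom A (Cob (Tot A D) n) Z" "h' \<in> Hom A (Cob (Tot A D) n) Z"
      using that \<open>P h\<close> unfolding P_def by auto
    then show "h' \<in> Ar A" "h \<in> Ar A" "Cod A h' = Cod A h"
      "Dom A h' = Cob (Tot A (tensor_dcpx A U (Tot A (sdcpx A K X)) (Tot A (sdcpx A K Y)))) n"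
      "Dom A h = Cob (Tot A (tensor_dcpx A U (Tot A (sdcpx A K X)) (Tot A (sdcpx A K Y)))) n"
      by (simp_all add: Hom_iff D_def)
  qed
  ultimately have "P (The P)" by (rule theI)
  then show ?thesis using n unfolding Kap unfolding P_def w_def D_def by simp
qed

text \<open>Three naturalities in a row: of the Kuenneth morphism at level \<open>p + q\<close>,
  since \<open>f (p + q)\<close> is monoidal, of the inclusion of a tensor summand, and of the
  shuffle map. The Koszul sign is the same on both sides.\<close>

lemma kap_comp_nat:
  assumes K: "K \<in> sMon C T A U" and L: "L \<in> sMon C T A U" and f: "simplicial_map Mon K L f"
    and X: "X \<in> Ob C" "Y \<in> Ob C"
  shows "At (At (sEM_ar C T A U K L f) (TO T X Y)) (int p + i + (int q + j)) \<cdot>\<^bsub>A\<^esub> kap_comp K X Y p q i j =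
    kap_comp L X Y p q i j \<cdot>\<^bsub>A\<^esub> TA U (At (At (f p) X) i) (At (At (f q) Y) j)"
proof -
  have XY: "TO T X Y \<in> Ob C" using X by simp
  let ?n = "int p + i + (int q + j)"
  let ?tK = "tinj A (tensor_dcpx A U (FO (SO K (p + q)) X) (FO (SO K (p + q)) Y)) (i + j) i"
  let ?tL = "tinj A (tensor_dcpx A U (FO (SO L (p + q)) X) (FO (SO L (p + q)) Y)) (i + j) i"
  let ?F = "\<lambda>Z. At (f (p + q)) Z"
  let ?FF = "At (TA (chain_ten A U) (?F X) (?F Y)) (i + j)"
  note t = sEM_ar_At[OF K L XY f]
  have ch: "?F X \<in> Ar (chain_cat A)" "?F Y \<in> Ar (chain_cat A)" using f X K L by simp_all
  have FF: "?FF \<in> Ar A"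
    "Dom A ?FF = Cob (Tot A (tensor_dcpx A U (FO (SO K (p + q)) X) (FO (SO K (p + q)) Y))) (i + j)"
    "Cod A ?FF = Cob (Tot A (tensor_dcpx A U (FO (SO L (p + q)) X) (FO (SO L (p + q)) Y))) (i + j)"
    "?FF \<cdot>\<^bsub>A\<^esub> ?tK = ?tL \<cdot>\<^bsub>A\<^esub> TA U (At (?F X) i) (At (?F Y) j)"
    using chain_TA_typing[OF ch, of "i + j"] chain_TA_typing(4)[OF ch, of "i + j" i] f X by simp_all
  have "At (?F (TO T X Y)) (i + j) \<cdot>\<^bsub>A\<^esub> (At (Kap (SO K (p + q)) X Y) (i + j) \<cdot>\<^bsub>A\<^esub> (?tK \<cdot>\<^bsub>A\<^esub> shuffle C T A U K X Y p q i j)) =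
      (At (Kap (SO L (p + q)) X Y) (i + j) \<cdot>\<^bsub>A\<^esub> ?FF) \<cdot>\<^bsub>A\<^esub> (?tK \<cdot>\<^bsub>A\<^esub> shuffle C T A U K X Y p q i j)"
    using K L f X by - (rule cmp_sub; use Mon_ar_Kap[of "f (p + q)" X Y "i + j"] in simp_all)
  also have "\<dots> = At (Kap (SO L (p + q)) X Y) (i + j) \<cdot>\<^bsub>A\<^esub> ((?FF \<cdot>\<^bsub>A\<^esub> ?tK) \<cdot>\<^bsub>A\<^esub> shuffle C T A U K X Y p q i j)"
    using K L f X FF(1-3) by (simp del: chain_ten_simps)
  also have "\<dots> = At (Kap (SO L (p + q)) X Y) (i + j) \<cdot>\<^bsub>A\<^esub> (?tL \<cdot>\<^bsub>A\<^esub> (TA U (At (?F X) i) (At (?F Y) j) \<cdot>\<^bsub>A\<^esub> shuffle C T A U K X Y p q i j))"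
    unfolding FF(4) using K L f X by simp
  also have "\<dots> = At (Kap (SO L (p + q)) X Y) (i + j) \<cdot>\<^bsub>A\<^esub> (?tL \<cdot>\<^bsub>A\<^esub>
      (shuffle C T A U L X Y p q i j \<cdot>\<^bsub>A\<^esub> TA U (At (At (f p) X) i) (At (At (f q) Y) j)))"
    unfolding shuffle_nat[OF K L f X] ..
  finally show ?thesis
    unfolding kap_comp_def using K L f X t by (simp add: deg_cancel nat_int_add)
qed

lemma sEM_ar_in_Ar:
  assumes K: "K \<in> sMon C T A U" "sEM K \<in> Mon_ob C T A U" and L: "L \<in> sMon C T A U" "sEM L \<in> Mon_ob C T A U"
    and f: "simplicial_map Mon K L f"
  shows "sEM_ar C T A U K L f \<in> Ar Mon"
proof (rule Mon_arI)
  fix X Y n assume X: "X \<in> Ob C" "Y \<in> Ob C"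
  let ?t = "sEM_ar C T A U K L f"
  let ?D = "tensor_dcpx A U (Tot A (sdcpx A K X)) (Tot A (sdcpx A K Y))"
  let ?E = "tensor_dcpx A U (Tot A (sdcpx A L X)) (Tot A (sdcpx A L Y))"
  let ?tt = "At (TA (chain_ten A U) (At ?t X) (At ?t Y)) n"
  have XY: "TO T X Y \<in> Ob C" using X by simp
  note tX = sEM_ar_At[OF K(1) L(1) X(1) f] and tY = sEM_ar_At[OF K(1) L(1) X(2) f]
    and tXY = sEM_ar_At[OF K(1) L(1) XY f]
  have cpx: "is_cpx A (Tot A (sdcpx A K Z))" "bounded_below A (Tot A (sdcpx A K Z))"
    "is_cpx A (Tot A (sdcpx A L Z))" "bounded_below A (Tot A (sdcpx A L Z))" if "Z \<in> Ob C" for Z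
    using Mon_ob_FO[OF K(2) that] Mon_ob_FO[OF L(2) that] that by simp_all
  have ch: "At ?t Z \<in> Ar (chain_cat A)" if "Z \<in> Ob C" for Z
    using sEM_ar_cmap[OF K L that f] cpx[OF that] that by simp
  have tt: "?tt \<in> Ar A" "Dom A ?tt = Cob (Tot A ?D) n" "Cod A ?tt = Cob (Tot A ?E) n"
    "\<And>p. ?tt \<cdot>\<^bsub>A\<^esub> tinj A ?D n p = tinj A ?E n p \<cdot>\<^bsub>A\<^esub> TA U (At (At ?t X) p) (At (At ?t Y) (n - p))"
    using chain_TA_typing[OF ch[OF X(1)] ch[OF X(2)], of n] X by simp_all
  have kapK: "At (Kap (sEM K) X Y) n \<in> Ar A" "Dom A (At (Kap (sEM K) X Y) n) = Cob (Tot A ?D) n"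
    "Cod A (At (Kap (sEM K) X Y) n) = Cob (Tot A (sdcpx A K (TO T X Y))) n"
    using Mon_ob_Kap[OF K(2) X] X XY by simp_all
  have kapL: "At (Kap (sEM L) X Y) n \<in> Ar A" "Dom A (At (Kap (sEM L) X Y) n) = Cob (Tot A ?E) n"
    "Cod A (At (Kap (sEM L) X Y) n) = Cob (Tot A (sdcpx A L (TO T X Y))) n"
    using Mon_ob_Kap[OF L(2) X] X XY by simp_all
  show "At (At ?t (TO T X Y)) n \<cdot>\<^bsub>A\<^esub> At (Kap (Src ?t) X Y) n = At (Kap (Tgt ?t) X Y) n \<cdot>\<^bsub>A\<^esub> ?tt"
    unfolding sEM_ar_simps
  proof (rule sEM_tensor_ext[OF K X])
    fix p q :: nat and i j :: int
    assume n: "n = int p + i + (int q + j)"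
    \<comment> \<open>\<open>?J\<close> after \<open>?W\<close> includes one summand into the tensor
      product of the total complexes of \<open>K\<close>; the primed versions do the same for
      \<open>L\<close>.\<close>
    let ?J = "tinj A ?D n (int p + i)" and ?J' = "tinj A ?E n (int p + i)"
    let ?W = "TA U (tinj A (sdcpx A K X) (int p + i) (int p)) (tinj A (sdcpx A K Y) (int q + j) (int q))"
    let ?W' = "TA U (tinj A (sdcpx A L X) (int p + i) (int p)) (tinj A (sdcpx A L Y) (int q + j) (int q))"
    let ?G = "TA U (At (At (f p) X) i) (At (At (f q) Y) j)"
    have e: "n - (int p + i) = int q + j" using n by simp
    have J: "?J \<in> Ar A" "Dom A ?J = TO U (Cob (Tot A (sdcpx A K X)) (int p + i)) (Cob (Tot A (sdcpx A K Y)) (int q + j))"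
      "Cod A ?J = Cob (Tot A ?D) n" using cpx X e by simp_all
    have J': "?J' \<in> Ar A" "Dom A ?J' = TO U (Cob (Tot A (sdcpx A L X)) (int p + i)) (Cob (Tot A (sdcpx A L Y)) (int q + j))"
      "Cod A ?J' = Cob (Tot A ?E) n" using cpx X e by simp_all
    have W: "?W \<in> Ar A" "Cod A ?W = Dom A ?J" using K X J by simp_all
    have W': "?W' \<in> Ar A" "Cod A ?W' = Dom A ?J'"
      "Dom A ?W' = TO U (Cob (FO (SO L p) X) i) (Cob (FO (SO L q) Y) j)" using L X J' by simp_all
    have "(At (At ?t (TO T X Y)) n \<cdot>\<^bsub>A\<^esub> At (Kap (sEM K) X Y) n) \<cdot>\<^bsub>A\<^esub> (?J \<cdot>\<^bsub>A\<^esub> ?W) =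
        At (At ?t (TO T X Y)) n \<cdot>\<^bsub>A\<^esub> (At (Kap (sEM K) X Y) n \<cdot>\<^bsub>A\<^esub> (?J \<cdot>\<^bsub>A\<^esub> ?W))"
      using tXY(1-3) kapK J W by (intro assoc) (simp_all del: tinj_typing TA_typing)
    also have "\<dots> = kap_comp L X Y p q i j \<cdot>\<^bsub>A\<^esub> ?G"
      unfolding sEM_kap_comp[OF K X n] using kap_comp_nat[OF K(1) L(1) f X, of p i q j] n by simp
    also have "\<dots> = (At (Kap (sEM L) X Y) n \<cdot>\<^bsub>A\<^esub> (?J' \<cdot>\<^bsub>A\<^esub> ?W')) \<cdot>\<^bsub>A\<^esub> ?G"
      unfolding sEM_kap_comp[OF L X n] ..
    also have "\<dots> = At (Kap (sEM L) X Y) n \<cdot>\<^bsub>A\<^esub> (?J' \<cdot>\<^bsub>A\<^esub> (?W' \<cdot>\<^bsub>A\<^esub> ?G))"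
      using kapL J' W' f X K L by (simp del: tinj_typing TA_cmp)
    also have "?W' \<cdot>\<^bsub>A\<^esub> ?G = TA U (At (At ?t X) (int p + i)) (At (At ?t Y) (int q + j)) \<cdot>\<^bsub>A\<^esub> ?W"
      using tX tY f X K L by simp
    also have "?J' \<cdot>\<^bsub>A\<^esub> (TA U (At (At ?t X) (int p + i)) (At (At ?t Y) (int q + j)) \<cdot>\<^bsub>A\<^esub> ?W) = (?tt \<cdot>\<^bsub>A\<^esub> ?J) \<cdot>\<^bsub>A\<^esub> ?W"
      unfolding tt(4) e using tX(1-3) tY(1-3) J' W(1) K X by (simp del: TA_cmp)
    also have "At (Kap (sEM L) X Y) n \<cdot>\<^bsub>A\<^esub> ((?tt \<cdot>\<^bsub>A\<^esub> ?J) \<cdot>\<^bsub>A\<^esub> ?W) =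
        (At (Kap (sEM L) X Y) n \<cdot>\<^bsub>A\<^esub> ?tt) \<cdot>\<^bsub>A\<^esub> (?J \<cdot>\<^bsub>A\<^esub> ?W)"
      using kapL tt(1-3) J W by (simp del: tinj_typing TA_typing TA_cmp chain_ten_simps)
    finally show "(At (At ?t (TO T X Y)) n \<cdot>\<^bsub>A\<^esub> At (Kap (sEM K) X Y) n) \<cdot>\<^bsub>A\<^esub> (?J \<cdot>\<^bsub>A\<^esub> ?W) =
      (At (Kap (sEM L) X Y) n \<cdot>\<^bsub>A\<^esub> ?tt) \<cdot>\<^bsub>A\<^esub> (?J \<cdot>\<^bsub>A\<^esub> ?W)" .
  qed (use tXY kapK kapL tt in \<open>simp_all del: chain_ten_simps\<close>)
next
  fix n
  note t = sEM_ar_At[OF K(1) L(1) Unt_obC f]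
  show "At (At (sEM_ar C T A U K L f) (Unt T)) n \<cdot>\<^bsub>A\<^esub> At (Eta (Src (sEM_ar C T A U K L f))) n =
      At (Eta (Tgt (sEM_ar C T A U K L f))) n"
    using t K L f Mon_ar_Eta[of "f 0" n] by simp
qed (use K L f sEM_ar_cmap[OF K L _ f] sEM_ar_nat[OF K L _ f] in \<open>auto simp: sEM_ar_def\<close>)

lemma sEM_ar_idt:
  assumes "K \<in> sMon C T A U" "sEM K \<in> Mon_ob C T A U"
    and f: "simplicial_map Mon K K (\<lambda>n. Idt Mon (SO K n))"
  shows "sEM_ar C T A U K K (\<lambda>n. Idt Mon (SO K n)) = Idt Mon (sEM K)"
proof (rule Mon_ar_eqI)
  fix X n assume X: "X \<in> Ob C"
  note t = sEM_ar_At[OF assms(1,1) X f]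
  have c: "is_cpx A (Tot A (sdcpx A K X))" using Mon_ob_FO(1)[OF assms(2) X] X by simp
  show "At (At (sEM_ar C T A U K K (\<lambda>n. Idt Mon (SO K n))) X) n = At (At (Idt Mon (sEM K)) X) n"
  proof (rule sdcpx_ext[OF assms(1) X])
    fix k
    show "At (At (sEM_ar C T A U K K (\<lambda>n. Idt Mon (SO K n))) X) n \<cdot>\<^bsub>A\<^esub> tinj A (sdcpx A K X) n (int k) =
      At (At (Idt Mon (sEM K)) X) n \<cdot>\<^bsub>A\<^esub> tinj A (sdcpx A K X) n (int k)"
      using t(4)[of "int k" n] assms X by simp
  qed (use t assms X c in simp_all)
qed (use assms sEM_ar_in_Ar[OF assms(1,2) assms(1,2) f] Mon.idt_typing[of "sEM K"] in simp_all)

lemma sEM_ar_cmp: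
  assumes K: "K \<in> sMon C T A U" "sEM K \<in> Mon_ob C T A U" and L: "L \<in> sMon C T A U" "sEM L \<in> Mon_ob C T A U"
    and N: "N \<in> sMon C T A U" "sEM N \<in> Mon_ob C T A U"
    and f: "simplicial_map Mon K L f" and g: "simplicial_map Mon L N g"
    and gf: "simplicial_map Mon K N (\<lambda>n. g n \<cdot>\<^bsub>Mon\<^esub> f n)"
  shows "sEM_ar C T A U K N (\<lambda>n. g n \<cdot>\<^bsub>Mon\<^esub> f n) = sEM_ar C T A U L N g \<cdot>\<^bsub>Mon\<^esub> sEM_ar C T A U K L f"
proof (rule Mon_ar_eqI)
  fix X n assume X: "X \<in> Ob C"
  note t = sEM_ar_At[OF K(1) L(1) X f] sEM_ar_At[OF L(1) N(1) X g] sEM_ar_At[OF K(1) N(1) X gf]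
  show "At (At (sEM_ar C T A U K N (\<lambda>n. g n \<cdot>\<^bsub>Mon\<^esub> f n)) X) n =
      At (At (sEM_ar C T A U L N g \<cdot>\<^bsub>Mon\<^esub> sEM_ar C T A U K L f) X) n"
  proof (rule sdcpx_ext[OF K(1) X])
    fix k
    show "At (At (sEM_ar C T A U K N (\<lambda>n. g n \<cdot>\<^bsub>Mon\<^esub> f n)) X) n \<cdot>\<^bsub>A\<^esub> tinj A (sdcpx A K X) n (int k) =
      At (At (sEM_ar C T A U L N g \<cdot>\<^bsub>Mon\<^esub> sEM_ar C T A U K L f) X) n \<cdot>\<^bsub>A\<^esub> tinj A (sdcpx A K X) n (int k)"
      using t K L N X f g by simp
  qed (use t K L N X f g in simp_all)
qed (use sEM_ar_in_Ar[OF K L f] sEM_ar_in_Ar[OF L N g] sEM_ar_in_Ar[OF K N gf]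
    Mon.cmp_typing[of "sEM_ar C T A U K L f" "sEM_ar C T A U L N g"] in simp_all)

section \<open>Augmentations\<close>

text \<open>Formed from any simplicial \<open>S\<close> and arrow \<open>e\<close> out of its level
  0; for the standard construction and the counit it is \<open>augmentation\<close>.\<close>

definition aug_ar where
  "aug_ar S e = \<lparr>Src = sEM S, Tgt = Tgt e, At = (\<lambda>X \<in> Ob C. \<lparr>Src = Tot A (sdcpx A S X), Tgt = FO (Tgt e) X,
     At = (\<lambda>n. copair A (diag (sdcpx A S X) n) (Cob (FO (Tgt e) X) n)
       (\<lambda>p. if p = 0 then At (At e X) n else Zer A (diag (sdcpx A S X) n p) (Cob (FO (Tgt e) X) n)))\<rparr>)\<rparr>"

lemma aug_ar_simps [simp]:
  "Src (aug_ar S e) = sEM S" "Tgt (aug_ar S e) = Tgt e"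
  "X \<in> Ob C \<Longrightarrow> Src (At (aug_ar S e) X) = Tot A (sdcpx A S X)"
  "X \<in> Ob C \<Longrightarrow> Tgt (At (aug_ar S e) X) = FO (Tgt e) X"
  by (simp_all add: aug_ar_def)

lemma aug_ar_At:
  assumes S: "S \<in> sMon C T A U" and e: "e \<in> Ar Mon" "Src e = SO S 0" and X: "X \<in> Ob C"
  defines "t \<equiv> At (aug_ar S e) X"
  shows "At t n \<in> Ar A" "Dom A (At t n) = Cob (Tot A (sdcpx A S X)) n" "Cod A (At t n) = Cob (FO (Tgt e) X) n"
    "At t n \<cdot>\<^bsub>A\<^esub> tinj A (sdcpx A S X) n 0 = At (At e X) n"
    "p > 0 \<Longrightarrow> At t n \<cdot>\<^bsub>A\<^esub> tinj A (sdcpx A S X) n p = Zer A (Dob (sdcpx A S X) p (n - p)) (Cob (FO (Tgt e) X) n)"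
    "\<lbrakk>z \<in> Ar A; Cod A z = Cob (FO (SO S 0) X) n\<rbrakk> \<Longrightarrow>
      At t n \<cdot>\<^bsub>A\<^esub> (tinj A (sdcpx A S X) n 0 \<cdot>\<^bsub>A\<^esub> z) = At (At e X) n \<cdot>\<^bsub>A\<^esub> z"
    "\<lbrakk>p > 0; z \<in> Ar A; Cod A z = Dob (sdcpx A S X) p (n - p)\<rbrakk> \<Longrightarrow>
      At t n \<cdot>\<^bsub>A\<^esub> (tinj A (sdcpx A S X) n p \<cdot>\<^bsub>A\<^esub> z) = Zer A (Dom A z) (Cob (FO (Tgt e) X) n)"
proof -
  let ?D = "diag (sdcpx A S X) n" and ?Z = "Cob (FO (Tgt e) X) n"
  have F: "fin_supp ?D" using S X by simp
  have Z: "?Z \<in> Ob A" using e X by simp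
  have g: "(if p = 0 then At (At e X) n else Zer A (?D p) ?Z) \<in> Hom A (?D p) ?Z" for p
    using S e X F Z by (auto simp: Hom_iff) (simp add: diag_def)
  have t: "At t n = copair A ?D ?Z (\<lambda>p. if p = 0 then At (At e X) n else Zer A (?D p) ?Z)"
    using X by (simp add: t_def aug_ar_def)
  note T = copair_typing[OF F Z g] copair_incl[OF F Z g]
  show 1: "At t n \<in> Ar A" "Dom A (At t n) = Cob (Tot A (sdcpx A S X)) n" "Cod A (At t n) = ?Z"
    using T(1-3) by (simp_all add: t Tot_def)
  show 2: "At t n \<cdot>\<^bsub>A\<^esub> tinj A (sdcpx A S X) n 0 = At (At e X) n"
    using T(4)[of 0] by (simp add: t tinj_def)
  have 3: "At t n \<cdot>\<^bsub>A\<^esub> tinj A (sdcpx A S X) n p = Zer A (Dob (sdcpx A S X) p (n - p)) ?Z" if "p > 0" for p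
    using T(4)[of p] that by (simp add: t tinj_def) (simp add: diag_def)
  show "p > 0 \<Longrightarrow> At t n \<cdot>\<^bsub>A\<^esub> tinj A (sdcpx A S X) n p = Zer A (Dob (sdcpx A S X) p (n - p)) ?Z"
    by (rule 3)
  show "At t n \<cdot>\<^bsub>A\<^esub> (tinj A (sdcpx A S X) n 0 \<cdot>\<^bsub>A\<^esub> z) = At (At e X) n \<cdot>\<^bsub>A\<^esub> z"
    if "z \<in> Ar A" "Cod A z = Cob (FO (SO S 0) X) n"
    using cmp_sub[OF 2, of z] 1 F that by simp
  show "At t n \<cdot>\<^bsub>A\<^esub> (tinj A (sdcpx A S X) n p \<cdot>\<^bsub>A\<^esub> z) = Zer A (Dom A z) ?Z"
    if "p > 0" "z \<in> Ar A" "Cod A z = Dob (sdcpx A S X) p (n - p)"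
    using cmp_sub[OF 3[OF that(1)], of z] 1 F Z that by simp
qed

text \<open>\<open>e\<close> agrees on the two faces out of level 1, which enter the differential
  with opposite signs.\<close>

lemma augmented_face_sum:
  assumes S: "S \<in> sMon C T A U" and e: "e \<in> Ar Mon" "Src e = SO S 0"
    and eq: "e \<cdot>\<^bsub>Mon\<^esub> Fac S (Suc 0) 0 = e \<cdot>\<^bsub>Mon\<^esub> Fac S (Suc 0) (Suc 0)" and X: "X \<in> Ob C"
  shows "At (At e X) q \<cdot>\<^bsub>A\<^esub> face_sum S X 0 q = Zer A (Cob (FO (SO S (Suc 0)) X) q) (Cob (FO (Tgt e) X) q)"
proof -
  let ?d = "\<lambda>i. At (At e X) q \<cdot>\<^bsub>A\<^esub> At (At (Fac S (Suc 0) i) X) q"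
  have "At (At (e \<cdot>\<^bsub>Mon\<^esub> Fac S (Suc 0) 0) X) q = At (At (e \<cdot>\<^bsub>Mon\<^esub> Fac S (Suc 0) (Suc 0)) X) q"
    by (simp only: eq)
  then have d: "?d (Suc 0) = ?d 0" using X by simp
  have h: "\<And>j. j \<in> {0..Suc 0} \<Longrightarrow> signed A (int j) (?d j) \<in> Hom A (Cob (FO (SO S (Suc 0)) X) q) (Cob (FO (Tgt e) X) q)"
    using S e X by (simp add: Hom_iff)
  have "At (At e X) q \<cdot>\<^bsub>A\<^esub> face_sum S X 0 q =
      hsum (Cob (FO (SO S (Suc 0)) X) q) (Cob (FO (Tgt e) X) q)
        (\<lambda>i. At (At e X) q \<cdot>\<^bsub>A\<^esub> signed A (int i) (At (At (Fac S (Suc 0) i) X) q)) {0..Suc 0}"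
    unfolding face_sum_def using S e X by (subst cmp_hsum) (auto simp: Hom_iff)
  also have "\<dots> = hsum (Cob (FO (SO S (Suc 0)) X) q) (Cob (FO (Tgt e) X) q)
        (\<lambda>i. signed A (int i) (?d i)) {0..Suc 0}"
    using S e X by (intro hsum_cong) (auto simp: Hom_iff)
  also have "\<dots> = Plus A (signed A (int 0) (?d 0)) (signed A (int (Suc 0)) (?d (Suc 0)))"
    using S e X h by (intro hsum_pair) (auto simp: Hom_iff)
  also have "\<dots> = Zer A (Cob (FO (SO S (Suc 0)) X) q) (Cob (FO (Tgt e) X) q)"
    unfolding d using S e X by (simp add: signed_def)
  finally show ?thesis .
qed

lemma aug_ar_cmap:
  assumes S: "S \<in> sMon C T A U" "sEM S \<in> Mon_ob C T A U" and e: "e \<in> Ar Mon" "Src e = SO S 0"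
    and eq: "e \<cdot>\<^bsub>Mon\<^esub> Fac S (Suc 0) 0 = e \<cdot>\<^bsub>Mon\<^esub> Fac S (Suc 0) (Suc 0)" and X: "X \<in> Ob C"
  shows "is_cmap A (At (aug_ar S e) X)"
proof -
  define t where "t = At (aug_ar S e) X"
  note t = aug_ar_At[OF S(1) e X, folded t_def]
  have cpx: "is_cpx A (Tot A (sdcpx A S X))" "is_cpx A (FO (Tgt e) X)"
    using Mon_ob_FO(1)[OF S(2) X] e X by simp_all
  have "At t (n - 1) \<cdot>\<^bsub>A\<^esub> Cdf (Tot A (sdcpx A S X)) n = Cdf (FO (Tgt e) X) n \<cdot>\<^bsub>A\<^esub> At t n" for n
  proof (rule sdcpx_ext[OF S(1) X])
    fix k :: nat
    \<comment> \<open>In column 0 the claim is that \<open>e\<close> consists of chain maps, in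
      column 1 it is \<open>augmented_face_sum\<close>. From column 2 on the differential stays in
      positive columns, where the augmentation is zero.\<close>
    consider "k = 0" | "k = 1" | j where "k = Suc (Suc j)" by (metis One_nat_def not0_implies_Suc)
    then show "(At t (n - 1) \<cdot>\<^bsub>A\<^esub> Cdf (Tot A (sdcpx A S X)) n) \<cdot>\<^bsub>A\<^esub> tinj A (sdcpx A S X) n (int k) =
        (Cdf (FO (Tgt e) X) n \<cdot>\<^bsub>A\<^esub> At t n) \<cdot>\<^bsub>A\<^esub> tinj A (sdcpx A S X) n (int k)"
    proof cases
      case 1
      then show ?thesis using S e X t cpx Mon_ar_Cdf[OF e(1) X, of n] by (simp add: sdcpx_Cdf_0)
    next
      case 2
      have "(At t (n - 1) \<cdot>\<^bsub>A\<^esub> Cdf (Tot A (sdcpx A S X)) n) \<cdot>\<^bsub>A\<^esub> tinj A (sdcpx A S X) n (1 + int 0) =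
        (Cdf (FO (Tgt e) X) n \<cdot>\<^bsub>A\<^esub> At t n) \<cdot>\<^bsub>A\<^esub> tinj A (sdcpx A S X) n (1 + int 0)"
        using S e X t cpx augmented_face_sum[OF S(1) e eq X, of "n - 1"] sdcpx_Cdf_Suc[OF S(1) X, of n 0]
          sdcpx_Dob_nat(3)[of S X 0] by simp
      then show ?thesis using 2 by simp
    next
      case (3 j)
      have ed: "n - 1 - int (Suc j) = n - (1 + int (Suc j))"
        "n - 1 - (1 + int (Suc j)) = n - (1 + int (Suc j)) - 1" by simp_all
      have "(At t (n - 1) \<cdot>\<^bsub>A\<^esub> Cdf (Tot A (sdcpx A S X)) n) \<cdot>\<^bsub>A\<^esub> tinj A (sdcpx A S X) n (1 + int (Suc j)) =
        (Cdf (FO (Tgt e) X) n \<cdot>\<^bsub>A\<^esub> At t n) \<cdot>\<^bsub>A\<^esub> tinj A (sdcpx A S X) n (1 + int (Suc j))"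
        using S e X t cpx sdcpx_Cdf_Suc[OF S(1) X, of n "Suc j"] sdcpx_Dob_nat(3)[of S X "Suc j"]
        by (simp add: ed del: of_nat_Suc)
      then show ?thesis using 3 by simp
    qed
  qed (use S e X t cpx in auto)
  then show ?thesis using X t by (simp add: is_cmap_def Hom_iff flip: t_def) (simp add: t_def)
qed

text \<open>For p = q = 0 the shuffle is the identity and the claim is that \<open>e\<close> is
  monoidal. Otherwise the left side passes through column p + q > 0, and one tensor factor on the
  right starts in a positive column, so both are zero.\<close>

lemma aug_kap_comp:
  assumes S: "S \<in> sMon C T A U" "sEM S \<in> Mon_ob C T A U" and e: "e \<in> Ar Mon" "Src e = SO S 0"
    and X: "X \<in> Ob C" "Y \<in> Ob C"
  shows "At (At (aug_ar S e) (TO T X Y)) (int p + i + (int q + j)) \<cdot>\<^bsub>A\<^esub> kap_comp S X Y p q i j =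
    At (Kap (Tgt e) X Y) (int p + i + (int q + j)) \<cdot>\<^bsub>A\<^esub>
      (tinj A (tensor_dcpx A U (FO (Tgt e) X) (FO (Tgt e) Y)) (int p + i + (int q + j)) (int p + i) \<cdot>\<^bsub>A\<^esub>
        TA U (At (At (aug_ar S e) X) (int p + i) \<cdot>\<^bsub>A\<^esub> tinj A (sdcpx A S X) (int p + i) (int p))
          (At (At (aug_ar S e) Y) (int q + j) \<cdot>\<^bsub>A\<^esub> tinj A (sdcpx A S Y) (int q + j) (int q)))"
proof -
  have XY: "TO T X Y \<in> Ob C" using X by simp
  note tX = aug_ar_At[OF S(1) e X(1)] and tY = aug_ar_At[OF S(1) e X(2)] and tXY = aug_ar_At[OF S(1) e XY]
  show ?thesis
  proof (cases "p = 0 \<and> q = 0")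
    case True
    let ?tS = "tinj A (tensor_dcpx A U (FO (SO S 0) X) (FO (SO S 0) Y)) (i + j) i"
    let ?tK = "tinj A (tensor_dcpx A U (FO (Tgt e) X) (FO (Tgt e) Y)) (i + j) i"
    let ?ee = "At (TA (chain_ten A U) (At e X) (At e Y)) (i + j)"
    have ch: "At e X \<in> Ar (chain_cat A)" "At e Y \<in> Ar (chain_cat A)" using e X S by simp_all
    have ee: "?ee \<in> Ar A"
      "Dom A ?ee = Cob (Tot A (tensor_dcpx A U (FO (SO S 0) X) (FO (SO S 0) Y))) (i + j)"
      "Cod A ?ee = Cob (Tot A (tensor_dcpx A U (FO (Tgt e) X) (FO (Tgt e) Y))) (i + j)"
      "?ee \<cdot>\<^bsub>A\<^esub> ?tS = ?tK \<cdot>\<^bsub>A\<^esub> TA U (At (At e X) i) (At (At e Y) j)"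
      using chain_TA_typing[OF ch, of "i + j"] chain_TA_typing(4)[OF ch, of "i + j" i] e X by simp_all
    have "At (At e (TO T X Y)) (i + j) \<cdot>\<^bsub>A\<^esub> (At (Kap (SO S 0) X Y) (i + j) \<cdot>\<^bsub>A\<^esub> ?tS) =
        (At (Kap (Tgt e) X Y) (i + j) \<cdot>\<^bsub>A\<^esub> ?ee) \<cdot>\<^bsub>A\<^esub> ?tS"
      using S e X by - (rule cmp_sub; use Mon_ar_Kap[OF e(1) X, of "i + j"] in simp)
    also have "\<dots> = At (Kap (Tgt e) X Y) (i + j) \<cdot>\<^bsub>A\<^esub> (?ee \<cdot>\<^bsub>A\<^esub> ?tS)"
      using S e X ee(1-3) by (simp del: chain_ten_simps)
    finally show ?thesis
      unfolding ee(4) using True S e X tX tY tXY by (simp add: kap_comp_def shuffle_0)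
  next
    case False
    then have pq: "0 < int p + int q" by auto
    let ?n = "int p + i + (int q + j)"
    let ?Z = "Zer A (TO U (Cob (FO (SO S p) X) i) (Cob (FO (SO S q) Y) j)) (Cob (FO (Tgt e) (TO T X Y)) ?n)"
    have "At (At (aug_ar S e) (TO T X Y)) ?n \<cdot>\<^bsub>A\<^esub> kap_comp S X Y p q i j = ?Z"
      using pq S e X tXY by (simp add: kap_comp_def deg_cancel)
    moreover have "TA U (At (At (aug_ar S e) X) (int p + i) \<cdot>\<^bsub>A\<^esub> tinj A (sdcpx A S X) (int p + i) (int p))
          (At (At (aug_ar S e) Y) (int q + j) \<cdot>\<^bsub>A\<^esub> tinj A (sdcpx A S Y) (int q + j) (int q)) =
        Zer A (TO U (Cob (FO (SO S p) X) i) (Cob (FO (SO S q) Y) j))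
          (TO U (Cob (FO (Tgt e) X) (int p + i)) (Cob (FO (Tgt e) Y) (int q + j)))"
      using False S e X tX tY by (cases "p = 0") (simp_all del: assoc)
    ultimately show ?thesis using S e X by simp
  qed
qed

lemma aug_ar_in_Ar:
  assumes S: "S \<in> sMon C T A U" "sEM S \<in> Mon_ob C T A U" and e: "e \<in> Ar Mon" "Src e = SO S 0"
    and eq: "e \<cdot>\<^bsub>Mon\<^esub> Fac S (Suc 0) 0 = e \<cdot>\<^bsub>Mon\<^esub> Fac S (Suc 0) (Suc 0)"
  shows "aug_ar S e \<in> Ar Mon"
proof (rule Mon_arI)
  fix X Y n assume X: "X \<in> Ob C" "Y \<in> Ob C"
  let ?t = "aug_ar S e" and ?K = "Tgt e"
  let ?D = "tensor_dcpx A U (Tot A (sdcpx A S X)) (Tot A (sdcpx A S Y))"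
  let ?E = "tensor_dcpx A U (FO ?K X) (FO ?K Y)"
  let ?tt = "At (TA (chain_ten A U) (At ?t X) (At ?t Y)) n"
  have XY: "TO T X Y \<in> Ob C" using X by simp
  note tX = aug_ar_At[OF S(1) e X(1)] and tY = aug_ar_At[OF S(1) e X(2)] and tXY = aug_ar_At[OF S(1) e XY]
  have cpx: "is_cpx A (Tot A (sdcpx A S Z))" "bounded_below A (Tot A (sdcpx A S Z))"
    "is_cpx A (FO ?K Z)" "bounded_below A (FO ?K Z)" if "Z \<in> Ob C" for Z
    using Mon_ob_FO[OF S(2) that] e that by simp_all
  have ch: "At ?t Z \<in> Ar (chain_cat A)" if "Z \<in> Ob C" for Z
    using aug_ar_cmap[OF S e eq that] cpx[OF that] that by simp
  have tt: "?tt \<in> Ar A" "Dom A ?tt = Cob (Tot A ?D) n" "Cod A ?tt = Cob (Tot A ?E) n"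
    "\<And>p. ?tt \<cdot>\<^bsub>A\<^esub> tinj A ?D n p = tinj A ?E n p \<cdot>\<^bsub>A\<^esub> TA U (At (At ?t X) p) (At (At ?t Y) (n - p))"
    using chain_TA_typing[OF ch[OF X(1)] ch[OF X(2)], of n] X by simp_all
  have kapK: "At (Kap (sEM S) X Y) n \<in> Ar A" "Dom A (At (Kap (sEM S) X Y) n) = Cob (Tot A ?D) n"
    "Cod A (At (Kap (sEM S) X Y) n) = Cob (Tot A (sdcpx A S (TO T X Y))) n"
    using Mon_ob_Kap[OF S(2) X] X XY by simp_all
  have kapL: "At (Kap ?K X Y) n \<in> Ar A" "Dom A (At (Kap ?K X Y) n) = Cob (Tot A ?E) n"
    "Cod A (At (Kap ?K X Y) n) = Cob (FO ?K (TO T X Y)) n"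
    using e X XY by simp_all
  show "At (At ?t (TO T X Y)) n \<cdot>\<^bsub>A\<^esub> At (Kap (Src ?t) X Y) n = At (Kap (Tgt ?t) X Y) n \<cdot>\<^bsub>A\<^esub> ?tt"
    unfolding aug_ar_simps
  proof (rule sEM_tensor_ext[OF S X])
    fix p q :: nat and i j :: int
    assume n: "n = int p + i + (int q + j)"
    let ?J = "tinj A ?D n (int p + i)" and ?J' = "tinj A ?E n (int p + i)"
    let ?W = "TA U (tinj A (sdcpx A S X) (int p + i) (int p)) (tinj A (sdcpx A S Y) (int q + j) (int q))"
    have ed: "n - (int p + i) = int q + j" using n by simp
    have J: "?J \<in> Ar A" "Dom A ?J = TO U (Cob (Tot A (sdcpx A S X)) (int p + i)) (Cob (Tot A (sdcpx A S Y)) (int q + j))"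
      "Cod A ?J = Cob (Tot A ?D) n" using cpx X ed by simp_all
    have J': "?J' \<in> Ar A" "Dom A ?J' = TO U (Cob (FO ?K X) (int p + i)) (Cob (FO ?K Y) (int q + j))"
      "Cod A ?J' = Cob (Tot A ?E) n" using cpx X ed by simp_all
    have W: "?W \<in> Ar A" "Cod A ?W = Dom A ?J" using S X J by simp_all
    have "(At (At ?t (TO T X Y)) n \<cdot>\<^bsub>A\<^esub> At (Kap (sEM S) X Y) n) \<cdot>\<^bsub>A\<^esub> (?J \<cdot>\<^bsub>A\<^esub> ?W) =
        At (At ?t (TO T X Y)) n \<cdot>\<^bsub>A\<^esub> (At (Kap (sEM S) X Y) n \<cdot>\<^bsub>A\<^esub> (?J \<cdot>\<^bsub>A\<^esub> ?W))"
      using tXY(1-3) kapK J W by (intro assoc) (simp_all del: tinj_typing TA_typing)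
    also have "\<dots> = At (Kap ?K X Y) n \<cdot>\<^bsub>A\<^esub> (?J' \<cdot>\<^bsub>A\<^esub>
        TA U (At (At ?t X) (int p + i) \<cdot>\<^bsub>A\<^esub> tinj A (sdcpx A S X) (int p + i) (int p))
          (At (At ?t Y) (int q + j) \<cdot>\<^bsub>A\<^esub> tinj A (sdcpx A S Y) (int q + j) (int q)))"
      unfolding sEM_kap_comp[OF S X n] using aug_kap_comp[OF S e X, of p i q j] n by simp
    also have "\<dots> = At (Kap ?K X Y) n \<cdot>\<^bsub>A\<^esub> (?J' \<cdot>\<^bsub>A\<^esub>
        (TA U (At (At ?t X) (int p + i)) (At (At ?t Y) (int q + j)) \<cdot>\<^bsub>A\<^esub> ?W))"
      using S X tX(1-3) tY(1-3) by simp
    also have "?J' \<cdot>\<^bsub>A\<^esub> (TA U (At (At ?t X) (int p + i)) (At (At ?t Y) (int q + j)) \<cdot>\<^bsub>A\<^esub> ?W) = (?tt \<cdot>\<^bsub>A\<^esub> ?J) \<cdot>\<^bsub>A\<^esub> ?W"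
      unfolding tt(4) ed using tX(1-3) tY(1-3) J' W(1) S X by (simp del: TA_cmp)
    also have "At (Kap ?K X Y) n \<cdot>\<^bsub>A\<^esub> ((?tt \<cdot>\<^bsub>A\<^esub> ?J) \<cdot>\<^bsub>A\<^esub> ?W) =
        (At (Kap ?K X Y) n \<cdot>\<^bsub>A\<^esub> ?tt) \<cdot>\<^bsub>A\<^esub> (?J \<cdot>\<^bsub>A\<^esub> ?W)"
      using kapL tt(1-3) J W by (simp del: tinj_typing TA_typing TA_cmp chain_ten_simps)
    finally show "(At (At ?t (TO T X Y)) n \<cdot>\<^bsub>A\<^esub> At (Kap (sEM S) X Y) n) \<cdot>\<^bsub>A\<^esub> (?J \<cdot>\<^bsub>A\<^esub> ?W) =
      (At (Kap ?K X Y) n \<cdot>\<^bsub>A\<^esub> ?tt) \<cdot>\<^bsub>A\<^esub> (?J \<cdot>\<^bsub>A\<^esub> ?W)" .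
  qed (use tXY kapK kapL tt in \<open>simp_all del: chain_ten_simps\<close>)
next
  fix n
  show "At (At (aug_ar S e) (Unt T)) n \<cdot>\<^bsub>A\<^esub> At (Eta (Src (aug_ar S e))) n = At (Eta (Tgt (aug_ar S e))) n"
    using aug_ar_At[OF S(1) e Unt_obC] S e Mon_ar_Eta[OF e(1), of n] by simp
next
  fix \<phi> n assume \<phi>: "\<phi> \<in> Ar C"
  have ob: "Dom C \<phi> \<in> Ob C" "Cod C \<phi> \<in> Ob C" using \<phi> by auto
  note t = aug_ar_At[OF S(1) e ob(1)] aug_ar_At[OF S(1) e ob(2)] sEM_FA[OF S(1) \<phi>]
  have s: "FA (sEM S) \<phi> \<in> {g. is_cmap A g}" "Src (FA (sEM S) \<phi>) = Tot A (sdcpx A S (Dom C \<phi>))"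
    "Tgt (FA (sEM S) \<phi>) = Tot A (sdcpx A S (Cod C \<phi>))"
    using Mon_ob_FA[OF S(2) \<phi>] ob by simp_all
  show "At (At (aug_ar S e) (Cod C \<phi>)) n \<cdot>\<^bsub>A\<^esub> At (FA (Src (aug_ar S e)) \<phi>) n =
      At (FA (Tgt (aug_ar S e)) \<phi>) n \<cdot>\<^bsub>A\<^esub> At (At (aug_ar S e) (Dom C \<phi>)) n"
    unfolding aug_ar_simps
  proof (rule sdcpx_ext[OF S(1) ob(1)])
    fix k
    show "(At (At (aug_ar S e) (Cod C \<phi>)) n \<cdot>\<^bsub>A\<^esub> At (FA (sEM S) \<phi>) n) \<cdot>\<^bsub>A\<^esub> tinj A (sdcpx A S (Dom C \<phi>)) n (int k) =
      (At (FA (Tgt e) \<phi>) n \<cdot>\<^bsub>A\<^esub> At (At (aug_ar S e) (Dom C \<phi>)) n) \<cdot>\<^bsub>A\<^esub> tinj A (sdcpx A S (Dom C \<phi>)) n (int k)"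
      using S e \<phi> ob t s Mon_ar_nat[OF e(1) \<phi>, of n] by (cases "k = 0") simp_all
  qed (use S e \<phi> ob t s in auto)
qed (use S e aug_ar_cmap[OF S e eq] in \<open>auto simp: aug_ar_def\<close>)

text \<open>Away from column 0 both sides vanish; in column 0 the claim is the hypothesis
  \<open>fg\<close>.\<close>

lemma aug_ar_nat:
  assumes S: "S \<in> sMon C T A U" "sEM S \<in> Mon_ob C T A U" and e: "e \<in> Ar Mon" "Src e = SO S 0"
    and eq: "e \<cdot>\<^bsub>Mon\<^esub> Fac S (Suc 0) 0 = e \<cdot>\<^bsub>Mon\<^esub> Fac S (Suc 0) (Suc 0)"
    and S': "S' \<in> sMon C T A U" "sEM S' \<in> Mon_ob C T A U" and e': "e' \<in> Ar Mon" "Src e' = SO S' 0"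
    and eq': "e' \<cdot>\<^bsub>Mon\<^esub> Fac S' (Suc 0) 0 = e' \<cdot>\<^bsub>Mon\<^esub> Fac S' (Suc 0) (Suc 0)"
    and f: "simplicial_map Mon S S' f" and g: "g \<in> Hom Mon (Tgt e) (Tgt e')"
    and fg: "e' \<cdot>\<^bsub>Mon\<^esub> f 0 = g \<cdot>\<^bsub>Mon\<^esub> e"
  shows "aug_ar S' e' \<cdot>\<^bsub>Mon\<^esub> sEM_ar C T A U S S' f = g \<cdot>\<^bsub>Mon\<^esub> aug_ar S e"
proof -
  have g': "g \<in> Ar Mon" "Src g = Tgt e" "Tgt g = Tgt e'" using g by (auto simp: Hom_iff)
  note ar = aug_ar_in_Ar[OF S e eq] aug_ar_in_Ar[OF S' e' eq'] sEM_ar_in_Ar[OF S S' f]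
  show ?thesis
  proof (rule Mon_ar_eqI)
    fix X n assume X: "X \<in> Ob C"
    note t = aug_ar_At[OF S(1) e X] aug_ar_At[OF S'(1) e' X] sEM_ar_At[OF S(1) S'(1) X f]
    have "At (At (e' \<cdot>\<^bsub>Mon\<^esub> f 0) X) n = At (At (g \<cdot>\<^bsub>Mon\<^esub> e) X) n" by (simp only: fg)
    then have fg': "At (At e' X) n \<cdot>\<^bsub>A\<^esub> At (At (f 0) X) n = At (At g X) n \<cdot>\<^bsub>A\<^esub> At (At e X) n" using X by simp
    have "At (At (aug_ar S' e') X) n \<cdot>\<^bsub>A\<^esub> At (At (sEM_ar C T A U S S' f) X) n =
        At (At g X) n \<cdot>\<^bsub>A\<^esub> At (At (aug_ar S e) X) n"
    proof (rule sdcpx_ext[OF S(1) X])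
      fix k
      show "(At (At (aug_ar S' e') X) n \<cdot>\<^bsub>A\<^esub> At (At (sEM_ar C T A U S S' f) X) n) \<cdot>\<^bsub>A\<^esub> tinj A (sdcpx A S X) n (int k) =
        (At (At g X) n \<cdot>\<^bsub>A\<^esub> At (At (aug_ar S e) X) n) \<cdot>\<^bsub>A\<^esub> tinj A (sdcpx A S X) n (int k)"
        using S S' e e' f g' X t fg' by (cases "k = 0") simp_all
    qed (use S S' e e' f g' X t in auto)
    then show "At (At (aug_ar S' e' \<cdot>\<^bsub>Mon\<^esub> sEM_ar C T A U S S' f) X) n = At (At (g \<cdot>\<^bsub>Mon\<^esub> aug_ar S e) X) n"
      using X by simp
  qed (use ar g' e e' in simp_all)
qed

end

section \<open>Identities are weak equivalences\<close>

lemma fun_cat_simps [simp]: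
  "Ob (fun_cat C A) = {F. ext_functor C A F}"
  "Ar (fun_cat C A) = {t. ext_functor C A (Src t) \<and> ext_functor C A (Tgt t) \<and> nat_trans C A t}"
  "Dom (fun_cat C A) = Src" "Cod (fun_cat C A) = Tgt"
  "Idt (fun_cat C A) = trf_idt C A" "Cmp (fun_cat C A) = trf_cmp C A"
  "Plus (fun_cat C A) t u = \<lparr>Src = Src t, Tgt = Tgt t, At = (\<lambda>X \<in> Ob C. Plus A (At t X) (At u X))\<rparr>"
  "Zer (fun_cat C A) F G = \<lparr>Src = F, Tgt = G, At = (\<lambda>X \<in> Ob C. Zer A (FO F X) (FO G X))\<rparr>"
  by (simp_all add: fun_cat_def)

context monoidal_setting
begin

section \<open>Functors to complexes as complexes of functors\<close>

definition und_term where
  "und_term F n = \<lparr>FO = (\<lambda>X \<in> Ob C. Cob (FO F X) n), FA = (\<lambda>f \<in> Ar C. At (FA F f) n)\<rparr>"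

lemma und_ob_simps [simp]:
  "Cob (und_ob C F) n = und_term F n"
  "Cdf (und_ob C F) n = \<lparr>Src = und_term F n, Tgt = und_term F (n - 1), At = (\<lambda>X \<in> Ob C. Cdf (FO F X) n)\<rparr>"
  by (simp_all add: und_ob_def und_term_def Let_def)

lemma und_term_functor:
  assumes F: "F \<in> Mon_ob C T A U"
  shows "ext_functor C A (und_term F n)"
  unfolding ext_functor_def is_functor_def
proof (intro conjI ballI allI)
  note fn = Mon_obD(2)[OF F, unfolded is_functor_def]
  fix X assume X: "X \<in> Ob C"
  show "FO (und_term F n) X \<in> Ob A" using F X by (simp add: und_term_def)
  have "FA F (Idt C X) = Idt (chain_cat A) (FO F X)" using fn X by blast
  then show "FA (und_term F n) (Idt C X) = Idt A (FO (und_term F n) X)"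
    using X by (simp add: und_term_def)
next
  fix X Y \<phi> assume "\<phi> \<in> Hom C X Y"
  then have \<phi>: "\<phi> \<in> Ar C" "Dom C \<phi> = X" "Cod C \<phi> = Y" "X \<in> Ob C" "Y \<in> Ob C"
    by (auto simp: Hom_iff)
  show "FA (und_term F n) \<phi> \<in> Hom A (FO (und_term F n) X) (FO (und_term F n) Y)"
    using F \<phi> by (simp add: und_term_def Hom_iff)
next
  note fn = Mon_obD(2)[OF F, unfolded is_functor_def]
  fix X Y Z \<phi> \<psi> assume *: "\<phi> \<in> Hom C X Y" "\<psi> \<in> Hom C Y Z"
  then have **: "\<phi> \<in> Ar C" "\<psi> \<in> Ar C" "Cod C \<phi> = Dom C \<psi>" by (auto simp: Hom_iff)
  have "FA F (\<psi> \<cdot>\<^bsub>C\<^esub> \<phi>) = FA F \<psi> \<cdot>\<^bsub>chain_cat A\<^esub> FA F \<phi>" using fn * by blast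
  then show "FA (und_term F n) (\<psi> \<cdot>\<^bsub>C\<^esub> \<phi>) = FA (und_term F n) \<psi> \<cdot>\<^bsub>A\<^esub> FA (und_term F n) \<phi>"
    using ** by (simp add: und_term_def)
qed (simp_all add: und_term_def)

lemma und_ob_cpx:
  assumes F: "F \<in> Mon_ob C T A U"
  shows "is_cpx (fun_cat C A) (und_ob C F)"
  unfolding is_cpx_def
proof (intro conjI allI)
  fix n
  show "Cob (und_ob C F) n \<in> Ob (fun_cat C A)" using und_term_functor[OF F] by simp
  have "nat_trans C A (Cdf (und_ob C F) n)"
    unfolding nat_trans_def
  proof (intro conjI ballI allI)
    fix X Y \<phi> assume "\<phi> \<in> Hom C X Y"
    then have \<phi>: "\<phi> \<in> Ar C" "Dom C \<phi> = X" "Cod C \<phi> = Y" "X \<in> Ob C" "Y \<in> Ob C"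
      by (auto simp: Hom_iff)
    have "At (FA F \<phi>) (n - 1) \<cdot>\<^bsub>A\<^esub> Cdf (FO F X) n = Cdf (FO F Y) n \<cdot>\<^bsub>A\<^esub> At (FA F \<phi>) n"
      using Mon_ob_FA[OF F \<phi>(1)] unfolding is_cmap_def by (simp add: \<phi>)
    then show "At (Cdf (und_ob C F) n) Y \<cdot>\<^bsub>A\<^esub> FA (Src (Cdf (und_ob C F) n)) \<phi> =
        FA (Tgt (Cdf (und_ob C F) n)) \<phi> \<cdot>\<^bsub>A\<^esub> At (Cdf (und_ob C F) n) X"
      using \<phi> by (simp add: und_term_def)
  qed (use F in \<open>simp_all add: und_term_def Hom_iff\<close>)
  then show "Cdf (und_ob C F) n \<in> Hom (fun_cat C A) (Cob (und_ob C F) n) (Cob (und_ob C F) (n - 1))"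
    using und_term_functor[OF F] by (simp add: Hom_iff)
  have "Cdf (FO F X) (n - 1) \<cdot>\<^bsub>A\<^esub> Cdf (FO F X) n = Zer A (Cob (FO F X) n) (Cob (FO F X) (n - 2))"
    if "X \<in> Ob C" for X
    using Mon_ob_FO(1)[OF F that] unfolding is_cpx_def by blast
  then show "Cdf (und_ob C F) (n - 1) \<cdot>\<^bsub>fun_cat C A\<^esub> Cdf (und_ob C F) n =
      Zer (fun_cat C A) (Cob (und_ob C F) n) (Cob (und_ob C F) (n - 2))"
    by (simp add: trf_cmp_def und_term_def cong: restrict_cong)
qed

text \<open>The bound in \<open>Mon_ob\<close> is uniform in the object, so below it the functor of
  a given degree is zero at all objects simultaneously, and hence a zero object of the functor
  category.\<close>

lemma und_ob_bounded:
  assumes F: "F \<in> Mon_ob C T A U"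
  shows "bounded_below (fun_cat C A) (und_ob C F)"
proof -
  obtain m where m: "\<And>X n. X \<in> Ob C \<Longrightarrow> n < m \<Longrightarrow> zero_object A (Cob (FO F X) n)"
    using F unfolding Mon_ob_def by blast
  have "zero_object (fun_cat C A) (und_term F n)" if n: "n < m" for n
  proof -
    let ?Z = "und_term F n"
    have Z: "ext_functor C A ?Z" by (rule und_term_functor[OF F])
    have zo: "zero_object A (FO ?Z X)" if "X \<in> Ob C" for X using m[OF that n] that by (simp add: und_term_def)
    have ob: "FO H X \<in> Ob A" if "ext_functor C A H" "X \<in> Ob C" for H :: "('c, 'd, 'a, 'b) fct" and X
      using that unfolding ext_functor_def is_functor_def by blast
    have FAh: "FA H \<phi> \<in> Ar A \<and> Dom A (FA H \<phi>) = FO H (Dom C \<phi>) \<and> Cod A (FA H \<phi>) = FO H (Cod C \<phi>)"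
      if "ext_functor C A H" "\<phi> \<in> Ar C" for H :: "('c, 'd, 'a, 'b) fct" and \<phi>
    proof -
      have "FA H \<phi> \<in> Hom A (FO H (Dom C \<phi>)) (FO H (Cod C \<phi>))"
        using that(1) C.hom_self[OF that(2)] unfolding ext_functor_def is_functor_def by blast
      then show ?thesis by (simp add: Hom_iff)
    qed
    have zt: "nat_trans C A \<lparr>Src = H, Tgt = H', At = (\<lambda>X \<in> Ob C. Zer A (FO H X) (FO H' X))\<rparr>"
      if "ext_functor C A H" "ext_functor C A H'" for H H' :: "('c, 'd, 'a, 'b) fct"
      unfolding nat_trans_def using that ob FAh by (auto simp: Hom_iff)
    \<comment> \<open>On \<open>Ob C\<close> uniqueness comes from the zero objects; elsewhere the
      two agree because transformations are extensional.\<close>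
    have uniq: "t = u" if "nat_trans C A t" "nat_trans C A u" "Src t = Src u" "Tgt t = Tgt u"
      "Src t = ?Z \<or> Tgt t = ?Z" for t u
    proof (rule trf_eqI)
      fix X show "At t X = At u X"
      proof (cases "X \<in> Ob C")
        case True
        then have "At t X \<in> Hom A (FO (Src t) X) (FO (Tgt t) X)" "At u X \<in> Hom A (FO (Src u) X) (FO (Tgt u) X)"
          using that unfolding nat_trans_def by blast+
        then show ?thesis using that(3-5) zo[OF True] by - (rule zero_object_unique; auto simp: Hom_iff)
      next
        case False
        have "At t \<in> extensional (Ob C)" "At u \<in> extensional (Ob C)"
          using that(1,2) unfolding nat_trans_def by blast+
        then show ?thesis using False by (metis extensional_arb)
      qed
    qed (use that in auto)
    have "(\<exists>!f. f \<in> Hom (fun_cat C A) H ?Z) \<and> (\<exists>!f. f \<in> Hom (fun_cat C A) ?Z H)" if H: "ext_functor C A H" for H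
    proof (intro conjI ex1I)
      show "\<lparr>Src = H, Tgt = ?Z, At = (\<lambda>X \<in> Ob C. Zer A (FO H X) (FO ?Z X))\<rparr> \<in> Hom (fun_cat C A) H ?Z"
        "\<lparr>Src = ?Z, Tgt = H, At = (\<lambda>X \<in> Ob C. Zer A (FO ?Z X) (FO H X))\<rparr> \<in> Hom (fun_cat C A) ?Z H"
        using zt[OF H Z] zt[OF Z H] H Z by (simp_all add: Hom_iff)
    next
      fix f assume "f \<in> Hom (fun_cat C A) H ?Z"
      then show "f = \<lparr>Src = H, Tgt = ?Z, At = (\<lambda>X \<in> Ob C. Zer A (FO H X) (FO ?Z X))\<rparr>"
        using zt[OF H Z] by (intro uniq) (auto simp: Hom_iff)
    next
      fix f assume "f \<in> Hom (fun_cat C A) ?Z H"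
      then show "f = \<lparr>Src = ?Z, Tgt = H, At = (\<lambda>X \<in> Ob C. Zer A (FO ?Z X) (FO H X))\<rparr>"
        using zt[OF Z H] by (intro uniq) (auto simp: Hom_iff)
    qed
    then show ?thesis using Z by (simp add: zero_object_def)
  qed
  then show ?thesis by (auto simp: bounded_below_def)
qed

lemma und_ar_idt:
  assumes F: "F \<in> Mon_ob C T A U"
  shows "und_ar C (Idt Mon F) = Idt (chain_cat (fun_cat C A)) (und_ob C F)"
  by (rule trf_eqI) (simp_all add: und_ar_def trf_idt_def und_term_def cong: restrict_cong)

text \<open>\<Sigma> is assumed to contain the homotopy equivalences; this is how the identities get
  into it.\<close>

lemma homotopy_equivalence_idt:
  assumes F: "F \<in> Mon_ob C T A U"
  shows "Idt Mon F \<in> homotopy_equivalences C T A U"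
proof -
  let ?B = "fun_cat C A" and ?K = "und_ob C F"
  let ?I = "Idt (chain_cat ?B) ?K"
  note ext = und_term_functor[OF F]
  have nI: "nat_trans C A (trf_idt C A (und_term F n))" for n
    unfolding nat_trans_def
  proof (intro conjI ballI allI)
    fix X Y \<phi> assume "\<phi> \<in> Hom C X Y"
    then have \<phi>: "\<phi> \<in> Ar C" "Dom C \<phi> = X" "Cod C \<phi> = Y" "X \<in> Ob C" "Y \<in> Ob C"
      by (auto simp: Hom_iff)
    then show "At (trf_idt C A (und_term F n)) Y \<cdot>\<^bsub>A\<^esub> FA (Src (trf_idt C A (und_term F n))) \<phi> =
        FA (Tgt (trf_idt C A (und_term F n))) \<phi> \<cdot>\<^bsub>A\<^esub> At (trf_idt C A (und_term F n)) X"
      using F by (simp add: und_term_def trf_idt_def)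
  qed (use F in \<open>simp_all add: und_term_def trf_idt_def Hom_iff\<close>)
  have idt: "trf_idt C A (und_term F n) \<in> Hom ?B (und_term F n) (und_term F n)" for n
    using nI ext by (simp add: Hom_iff trf_idt_def)
  have I: "?I \<in> Hom (chain_cat ?B) ?K ?K"
    using und_ob_cpx[OF F] und_ob_bounded[OF F] idt F
    by (auto simp: Hom_iff is_cmap_def trf_cmp_def und_term_def trf_idt_def intro!: restrict_ext)
  have II: "?I \<cdot>\<^bsub>chain_cat ?B\<^esub> ?I = ?I"
    by (rule trf_eqI) (use F in \<open>auto simp: trf_cmp_def trf_idt_def und_term_def intro!: restrict_ext\<close>)
  \<comment> \<open>The zero homotopy works, since the identity is its own inverse on the
    nose.\<close>
  define h where "h = (\<lambda>n. Zer ?B (und_term F n) (und_term F (n + 1)))"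
  have hn: "h n \<in> Hom ?B (und_term F n) (und_term F (n + 1))" for n
    unfolding h_def using ext F by (auto simp: Hom_iff nat_trans_def und_term_def)
  have "At ?I n = Plus ?B (At ?I n) (Plus ?B (Cdf ?K (n + 1) \<cdot>\<^bsub>?B\<^esub> h n) (h (n - 1) \<cdot>\<^bsub>?B\<^esub> Cdf ?K n))" for n
    by (rule trf_eqI) (use F in \<open>auto simp: trf_idt_def trf_cmp_def und_term_def h_def restrict_def\<close>)
  then have "homotopic ?B ?I ?I"
    unfolding homotopic_def using hn by auto
  then have "homotopy_equivalence ?B ?I"
    unfolding homotopy_equivalence_def using I II by (intro conjI bexI[of _ ?I]) (simp_all add: Hom_iff)
  then show ?thesis
    using Mon.idt_typing[of F] F by (simp add: homotopy_equivalences_def und_ar_idt)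
qed

end

section \<open>The factorization theorem\<close>

text \<open>Collects what makes the resolution a functor preserving \<open>W\<close>. For \<Sigma>,
  \<open>W_idt\<close> follows from the homotopy equivalences and \<open>W_G\<close> is
  compatibility with the cotriple.\<close>

locale cotriple_resolution = monoidal_setting C T A U + Cot: cotriple "Mon_cat C T A U" G
  for C :: "('c, 'd) cat" and T :: "('c, 'd) monstr"
    and A :: "('a, 'b) addcat" and U :: "('a, 'b) monstr"
    and G :: "(('c, 'd, 'a, 'b) cmf, ('c, 'd, 'a, 'b) cmt) cotr" +
  fixes W :: "('c, 'd, 'a, 'b) cmt set"
  assumes W_ar: "W \<subseteq> Ar (Mon_cat C T A U)"
    and W_idt: "F \<in> Mon_ob C T A U \<Longrightarrow> Idt (Mon_cat C T A U) F \<in> W"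
    and W_sEM: "sEM_compatible C T A U W"
    and W_G: "FA G ` W \<subseteq> W"
    and bounded: "uniformly_bounded_cotriple C T A U G"
begin

abbreviation res where "res K \<equiv> standard_construction G K"

definition res_ar where
  "res_ar f = sEM_ar C T A U (res (Src f)) (res (Tgt f)) (\<lambda>n. (FA G ^^ Suc n) f)"

lemma res_sMon:
  assumes "K \<in> Mon_ob C T A U"
  shows "res K \<in> sMon C T A U"
  using Cot.simplicial_object_standard_construction[of K] assms bounded
  unfolding sMon_def uniformly_bounded_cotriple_def by simp

text \<open>Compatibility with the identity morphisms already forces the total complex to be an object of
  the category, so that the associativity of the shuffle maps need not be checked.\<close>

lemma sEM_in_Mon_ob:
  assumes K: "K \<in> sMon C T A U"
  shows "sEM K \<in> Mon_ob C T A U"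
proof -
  have "simplicial_map Mon K K (\<lambda>n. Idt Mon (SO K n))"
    unfolding simplicial_map_def using K Mon.idt_typing by (auto simp: Hom_iff)
  then have "sEM_ar C T A U K K (\<lambda>n. Idt Mon (SO K n)) \<in> W"
    using W_sEM W_idt K unfolding sEM_compatible_def by simp
  then have "sEM_ar C T A U K K (\<lambda>n. Idt Mon (SO K n)) \<in> Ar Mon" using W_ar by blast
  from Mon_ar_ob(1)[OF this] show ?thesis by simp
qed

lemma res_ar_sEM:
  assumes f: "f \<in> Ar Mon"
  shows "res_ar f \<in> Ar Mon" "Src (res_ar f) = sEM (res (Src f))" "Tgt (res_ar f) = sEM (res (Tgt f))"
proof -
  have "f \<in> Hom Mon (Src f) (Tgt f)" using f by (simp add: Hom_iff)
  from sEM_ar_in_Ar[OF _ _ _ _ Cot.simplicial_map_standard_construction[OF this]]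
  show "res_ar f \<in> Ar Mon" using f by (simp add: res_ar_def res_sMon sEM_in_Mon_ob)
qed (simp_all add: res_ar_def)

lemma augmentation_eq_aug_ar:
  assumes "K \<in> Mon_ob C T A U"
  shows "augmentation C T A U G K = aug_ar (res K) (Eps G K)"
proof -
  have "Tgt (Eps G K) = K" using Cot.eps_hom[of K] assms by (simp add: Hom_iff)
  then show ?thesis by (simp add: augmentation_def aug_ar_def Bstar_def Let_def cong: if_cong)
qed

lemma eps_augments:
  assumes K: "K \<in> Mon_ob C T A U"
  shows "Eps G K \<in> Ar Mon" "Src (Eps G K) = SO (res K) 0" "Tgt (Eps G K) = K"
    "Eps G K \<cdot>\<^bsub>Mon\<^esub> Fac (res K) (Suc 0) 0 = Eps G K \<cdot>\<^bsub>Mon\<^esub> Fac (res K) (Suc 0) (Suc 0)"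
  using Cot.eps_hom[of K] Cot.eps_nat[OF Cot.eps_hom[of K]] K by (simp_all add: Hom_iff)

lemma res_augmented_functor: "augmented_functor Mon W (\<lambda>K. sEM (res K)) res_ar (augmentation C T A U G)"
proof (unfold_locales)
  show "w \<in> Ar Mon" if "w \<in> W" for w using that W_ar by blast
  show "res_ar f \<in> Hom Mon (sEM (res X)) (sEM (res Y))" if "f \<in> Hom Mon X Y" for f X Y
    using that res_ar_sEM[of f] by (auto simp: Hom_iff)
  show "res_ar w \<in> W" if w: "w \<in> W" for w
  proof -
    have Gw: "(FA G ^^ n) w \<in> W" for n by (induction n) (use w W_G in auto)
    have "w \<in> Hom Mon (Src w) (Tgt w)" using w W_ar by (auto simp: Hom_iff)
    then have f: "simplicial_map Mon (res (Src w)) (res (Tgt w)) (\<lambda>n. (FA G ^^ Suc n) w)"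
      by (rule Cot.simplicial_map_standard_construction)
    have "w \<in> Ar Mon" using w W_ar by blast
    then have "res (Src w) \<in> sMon C T A U" "res (Tgt w) \<in> sMon C T A U" by (simp_all add: res_sMon)
    then show ?thesis using W_sEM f Gw unfolding sEM_compatible_def res_ar_def by blast
  qed
  show "res_ar (Idt Mon X) = Idt Mon (sEM (res X))" if X: "X \<in> Ob Mon" for X
  proof -
    have "(\<lambda>n. (FA G ^^ Suc n) (Idt Mon X)) = (\<lambda>n. Idt Mon (SO (res X) n))"
      using Cot.G_pow_idt[OF X, of "Suc _"] by (simp add: fun_eq_iff)
    moreover have "simplicial_map Mon (res X) (res X) (\<lambda>n. (FA G ^^ Suc n) (Idt Mon X))"
      using Cot.simplicial_map_standard_construction[OF Mon.idt_hom[OF X]] .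
    ultimately show ?thesis
      using sEM_ar_idt[of "res X"] X by (simp add: res_ar_def res_sMon sEM_in_Mon_ob)
  qed
  show "res_ar (g \<cdot>\<^bsub>Mon\<^esub> f) = res_ar g \<cdot>\<^bsub>Mon\<^esub> res_ar f" if fg: "f \<in> Hom Mon X Y" "g \<in> Hom Mon Y Z" for f g X Y Z
  proof -
    have e: "(\<lambda>n. (FA G ^^ Suc n) (g \<cdot>\<^bsub>Mon\<^esub> f)) = (\<lambda>n. (FA G ^^ Suc n) g \<cdot>\<^bsub>Mon\<^esub> (FA G ^^ Suc n) f)"
      using Cot.G_pow_cmp[OF fg] by blast
    have ob: "X \<in> Mon_ob C T A U" "Y \<in> Mon_ob C T A U" "Z \<in> Mon_ob C T A U"
      using Mon.hom_obD[OF fg(1)] Mon.hom_obD[OF fg(2)] by auto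
    have s: "Src f = X" "Tgt f = Y" "Src g = Y" "Tgt g = Z" using fg by (auto simp: Hom_iff)
    note m = Cot.simplicial_map_standard_construction
    show ?thesis
      using sEM_ar_cmp[OF res_sMon sEM_in_Mon_ob[OF res_sMon] res_sMon sEM_in_Mon_ob[OF res_sMon]
          res_sMon sEM_in_Mon_ob[OF res_sMon] m[OF fg(1)] m[OF fg(2)] m[OF Mon.cmp_hom[OF fg], unfolded e],
          OF ob(1,1,2,2,3,3)]
      unfolding res_ar_def Mon_cat_simps s e .
  qed
  show "augmentation C T A U G X \<in> Hom Mon (sEM (res X)) X" if "X \<in> Ob Mon" for X
  proof -
    have X: "X \<in> Mon_ob C T A U" using that by simp
    note e = eps_augments[OF X]
    from aug_ar_in_Ar[OF res_sMon[OF X] sEM_in_Mon_ob[OF res_sMon[OF X]] e(1,2,4)]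
    show ?thesis using X e(3) by (simp add: augmentation_eq_aug_ar Hom_iff)
  qed
  show "augmentation C T A U G Y \<cdot>\<^bsub>Mon\<^esub> res_ar f = f \<cdot>\<^bsub>Mon\<^esub> augmentation C T A U G X"
    if f: "f \<in> Hom Mon X Y" for f X Y
  proof -
    have ob: "X \<in> Mon_ob C T A U" "Y \<in> Mon_ob C T A U" using Mon.hom_obD[OF f] by auto
    have s: "Src f = X" "Tgt f = Y" using f by (auto simp: Hom_iff)
    note eX = eps_augments[OF ob(1)] and eY = eps_augments[OF ob(2)]
    \<comment> \<open>Level 0 of the standard construction is already one copy of \<open>G\<close>,
      so naturality of the counit is the square required there.\<close>
    have "Eps G Y \<cdot>\<^bsub>Mon\<^esub> (FA G ^^ Suc 0) f = f \<cdot>\<^bsub>Mon\<^esub> Eps G X" using Cot.eps_nat[OF f] by simp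
    from aug_ar_nat[OF res_sMon[OF ob(1)] sEM_in_Mon_ob[OF res_sMon[OF ob(1)]] eX(1,2,4)
        res_sMon[OF ob(2)] sEM_in_Mon_ob[OF res_sMon[OF ob(2)]] eY(1,2,4)
        Cot.simplicial_map_standard_construction[OF f] _ this]
    show ?thesis using f ob eX(3) eY(3) by (simp add: res_ar_def augmentation_eq_aug_ar s)
  qed
qed

end

theorem theorem4p3p1:
  fixes C :: "('c, 'd) cat" and T :: "('c, 'd) monstr"
    and A :: "('a, 'b) addcat" and U :: "('a, 'b) monstr"
    and \<Gamma> :: "('c, 'd, 'a, 'b) fcpx set"
    and \<Sigma> :: "('c, 'd, 'a, 'b) cmt set"
    and G :: "(('c, 'd, 'a, 'b) cmf, ('c, 'd, 'a, 'b) cmt) cotr"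
    and K L M :: "('c, 'd, 'a, 'b) cmf"
    and s \<alpha> :: "('c, 'd, 'a, 'b) cmt"
  defines "Mon \<equiv> Mon_cat C T A U"
  assumes "monoidal_category C T"
    and "abelian_monoidal_category A U"
    and "acyclic_class (fun_cat C A) \<Gamma>"
    and "\<Sigma> = weak_equivalences C T A U \<Gamma>"
    and "homotopy_equivalences C T A U \<subseteq> \<Sigma>"
    and "sEM_compatible C T A U \<Sigma>"
    and "cotriple Mon G"
    and "uniformly_bounded_cotriple C T A U G"
    and "presentable C T A U G \<Sigma> K"
    and "s \<in> Hom Mon L M"
    and "G_weak_equivalence Mon G \<Sigma> s"
    and "FA G ` \<Sigma> \<subseteq> \<Sigma>"
    and "\<alpha> \<in> Hom Mon K M"
  shows "\<exists>!\<beta>. \<beta> \<in> Hom (localization Mon \<Sigma>) K L \<and>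
           loc Mon \<Sigma> \<alpha> = loc Mon \<Sigma> s \<cdot>\<^bsub>localization Mon \<Sigma>\<^esub> \<beta>"
proof -
  interpret Cot: cotriple "Mon_cat C T A U" G using assms(8) by (simp add: Mon_def)
  interpret S: monoidal_setting C T A U
    by (intro monoidal_setting.intro assms Cot.category_axioms)
  interpret R: cotriple_resolution C T A U G \<Sigma>
  proof
    show "\<Sigma> \<subseteq> Ar (Mon_cat C T A U)" using assms(5) by (auto simp: weak_equivalences_def)
    show "Idt (Mon_cat C T A U) F \<in> \<Sigma>" if "F \<in> Mon_ob C T A U" for F
      using S.homotopy_equivalence_idt[OF that] assms(6) by blast
  qed (use assms in auto)
  interpret B: augmented_functor Mon \<Sigma> "\<lambda>K. sEM_ob C T A U (standard_construction G K)" R.res_ar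
    "augmentation C T A U G"
    using R.res_augmented_functor by (simp add: Mon_def)
  \<comment> \<open>\<open>s\<close> itself may lie outside \<Sigma>, so the induction starts at
    \<open>FA G s\<close> and covers positive powers only; these are exactly the levels of the
    standard construction.\<close>
  have Gs: "(FA G ^^ Suc n) s \<in> \<Sigma>" for n
  proof (induction n)
    case 0
    then show ?case using assms(12) by (simp add: G_weak_equivalence_def)
  next
    case (Suc n)
    then show ?case using assms(13) by auto
  qed
  have s: "s \<in> Hom (Mon_cat C T A U) L M" using assms(11) by (simp add: Mon_def)
  have "L \<in> Mon_ob C T A U" "M \<in> Mon_ob C T A U" using Cot.hom_obD[OF s] by auto
  \<comment> \<open>Since \<open>s\<close> need not be in \<Sigma>, \<open>B_W\<close> cannot be
    applied to it; \<open>sEM_compatible\<close> is used directly on the levels.\<close>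
  then have "R.res_ar s \<in> \<Sigma>"
    using assms(7) Gs Cot.simplicial_map_standard_construction[OF s] s R.res_sMon
    unfolding sEM_compatible_def R.res_ar_def by (simp add: Hom_iff)
  then show ?thesis
    using B.ex1_lift[OF _ _ assms(11) _ assms(14)] assms(10) by (simp add: presentable_def Mon_def)
qed

end
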